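(* Let $\beta\ge\frac12$ and $\mu\ge0$. Then, for $(x,t),(y,s)\in\mathbb V^{d+1}$ and $0\le r<1$, $$\mathbf P^E\big(W_{\beta,\mu};r,(x,t),(y,s)\big)=\frac{1}{(1-r^2)^{\beta+\mu+\frac d2}}\,e^{-\frac{s^2+t^2}{1-r^2}r^2}\int_{[-1,1]^3}e^{\frac{2r}{1-r^2}\phi(x,t,y,s;u,z)}\,c_{\mu+\frac{d-1}2,\beta-\frac32}\,c_{\beta-\frac12}\,c_{\mu-\frac12}\,(1-z_1)^{\mu+\frac{d-1}2}(1+z_1)^{\beta-\frac32}(1-z_2^2)^{\beta-1}(1-u^2)^{\mu-1}\,dz\,du,$$ where $z=(z_1,z_2)$ and $$\phi(x,t,y,s;u,z)=\frac{1-z_1}2\Big(\langle x,y\rangle+u\sqrt{t^2-\|x\|^2}\sqrt{s^2-\|y\|^2}\Big)\mathrm{sign}(st)+\frac{1+z_1}2z_2\,st .$$ For $\beta=\frac12$ and/or $\mu=0$ the right-hand side is understood as the limit $\beta\to\frac12$ and/or $\mu\to0$.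
   Context: $\mathbb V^{d+1}=\{(x,t)\in\mathbb R^d\times\mathbb R:\ \|x\|\le|t|\}$ is the infinite solid double cone, $W_{\beta,\mu}(x,t)=|t|^{2\beta}e^{-t^2}(t^2-\|x\|^2)^{\mu-\frac12}$, and $\langle f,g\rangle=b\int_{\mathbb V^{d+1}}f\,g\,W_{\beta,\mu}\,dx\,dt$ with $b$ such that $\langle1,1\rangle=1$. $\mathcal V_n^E(\mathbb V^{d+1},W_{\beta,\mu})$ is the space of polynomials in $(x,t)$ of degree at most $n$ that are even in $t$ and orthogonal to all polynomials of degree at most $n-1$. $\mathbf P_n^E(W_{\beta,\mu};\cdot,\cdot)$ is its reproducing kernel with respect to $\langle\cdot,\cdot\rangle$. The Poisson kernel is $\mathbf P^E(W_{\beta,\mu};r,(x,t),(y,s))=\sum_{n=0}^\infty\mathbf P_n^E(W_{\beta,\mu};(x,t),(y,s))\,r^n$, $0\le r<1$. Constants: $c_\lambda=\frac{\Gamma(\lambda+1)}{\Gamma(\frac12)\Gamma(\lambda+\frac12)}$, $c_{a,b}=\frac{\Gamma(a+b+2)}{\Gamma(a+1)\Gamma(b+1)}$.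
   Formalization: Two misprints are corrected: the integrand gets the factor 2^{-(β+μ+d/2-1)}, since at r=0 the left side is 1; and in φ, sign(st) multiplies only the term u√(t²-‖x‖²)√(s²-‖y‖²), not ⟨x,y⟩, since the kernel is even in t. *)

theory Defs
  imports "HOL-Analysis.Analysis"
begin

definition double_cone :: "((real ^ 'd) \<times> real) set" where
  "double_cone = {(x, t). norm x \<le> \<bar>t\<bar>}"

definition cone_weight :: "real \<Rightarrow> real \<Rightarrow> (real ^ 'd) \<times> real \<Rightarrow> real" where
  "cone_weight \<beta> \<mu> = (\<lambda>(x, t).
     \<bar>t\<bar> powr (2 * \<beta>) * exp (- t\<^sup>2) * (t\<^sup>2 - (norm x)\<^sup>2) powr (\<mu> - 1/2))"

definition cone_inner ::
  "real \<Rightarrow> real \<Rightarrow> ((real ^ 'd) \<times> real \<Rightarrow> real) \<Rightarrow> ((real ^ 'd) \<times> real \<Rightarrow> real) \<Rightarrow> real" where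
  "cone_inner \<beta> \<mu> f g =
     set_lebesgue_integral lborel double_cone (\<lambda>p. f p * g p * cone_weight \<beta> \<mu> p) /
     set_lebesgue_integral lborel double_cone (cone_weight \<beta> \<mu> :: (real ^ 'd) \<times> real \<Rightarrow> real)"

text \<open>Polynomials in \<open>(x, t)\<close> of total degree at most \<open>n\<close>, as functions on all of
  the ambient space. A multi-index is a pair: the exponents of the coordinates of \<open>x\<close> and
  the exponent of \<open>t\<close>.\<close>

definition polys_upto :: "nat \<Rightarrow> ((real ^ 'd) \<times> real \<Rightarrow> real) set" where
  "polys_upto n = {f. \<exists>c :: ('d \<Rightarrow> nat) \<times> nat \<Rightarrow> real. \<forall>x t. f (x, t) =
     (\<Sum>(a, k) \<in> {(a, k). (\<Sum>i\<in>UNIV. a i) + k \<le> n}. c (a, k) * (\<Prod>i\<in>UNIV. (x $ i) ^ a i) * t ^ k)}"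

text \<open>Orthogonality to \<open>polys_upto m\<close> for all \<open>m < n\<close> is orthogonality to all polynomials of
  degree at most \<open>n - 1\<close>, without truncated subtraction at \<open>n = 0\<close> (no condition there).\<close>

definition V_even :: "real \<Rightarrow> real \<Rightarrow> nat \<Rightarrow> ((real ^ 'd) \<times> real \<Rightarrow> real) set" where
  "V_even \<beta> \<mu> n = {f \<in> polys_upto n.
     (\<forall>x t. f (x, - t) = f (x, t)) \<and>
     (\<forall>m<n. \<forall>g\<in>polys_upto m. cone_inner \<beta> \<mu> f g = 0)}"

definition is_reproducing_kernel ::
  "(('p \<Rightarrow> real) \<Rightarrow> ('p \<Rightarrow> real) \<Rightarrow> real) \<Rightarrow> ('p \<Rightarrow> real) set \<Rightarrow> ('p \<Rightarrow> 'p \<Rightarrow> real) \<Rightarrow> bool" where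
  "is_reproducing_kernel ip V K \<longleftrightarrow>
     (\<forall>p. K p \<in> V \<and> (\<forall>f\<in>V. ip f (K p) = f p))"

definition P_even ::
  "real \<Rightarrow> real \<Rightarrow> nat \<Rightarrow> (real ^ 'd) \<times> real \<Rightarrow> (real ^ 'd) \<times> real \<Rightarrow> real" where
  "P_even \<beta> \<mu> n = (THE K. is_reproducing_kernel (cone_inner \<beta> \<mu>) (V_even \<beta> \<mu> n) K)"

definition poisson_even ::
  "real \<Rightarrow> real \<Rightarrow> real \<Rightarrow> (real ^ 'd) \<times> real \<Rightarrow> (real ^ 'd) \<times> real \<Rightarrow> real" where
  "poisson_even \<beta> \<mu> r p q = (\<Sum>n. P_even \<beta> \<mu> n p q * r ^ n)"

definition c_gegenbauer :: "real \<Rightarrow> real" where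
  "c_gegenbauer l = Gamma (l + 1) / (Gamma (1/2) * Gamma (l + 1/2))"

text \<open>\<open>c_gegenbauer l\<close> normalizes \<open>(1 - z\<^sup>2)\<close> to the power \<open>l - 1/2\<close> on \<open>[-1,1]\<close>.
  The constant \<open>c_jacobi a b\<close> normalizes \<open>(1 - v) powr a * v powr b\<close> on \<open>[0,1]\<close>; for the weight
  \<open>(1 - z) powr a * (1 + z) powr b\<close> on \<open>[-1,1]\<close> it must be multiplied by
  \<open>2 powr (- (a + b + 1))\<close>, a factor missing from the source's formula; without it the
  formula fails at \<open>r = 0\<close>, where the Poisson kernel is \<open>1\<close>.\<close>

definition c_jacobi :: "real \<Rightarrow> real \<Rightarrow> real" where
  "c_jacobi a b = Gamma (a + b + 2) / (Gamma (a + 1) * Gamma (b + 1))"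

text \<open>The factor \<open>sgn (s * t)\<close> belongs to the second summand of the bracket only. The source
  prints \<open>sgn (s * t)\<close> as a factor of the whole bracket. That is the same when
  \<open>s * t \<ge> 0\<close> (see the lemma below), but for \<open>s * t < 0\<close> it cannot represent a kernel that is even
  in \<open>t\<close>, since it reverses the sign of the inner product of \<open>x\<close> and \<open>y\<close>.\<close>

definition cone_phi ::
  "(real ^ 'd) \<times> real \<Rightarrow> (real ^ 'd) \<times> real \<Rightarrow> real \<Rightarrow> real \<Rightarrow> real \<Rightarrow> real" where
  "cone_phi = (\<lambda>(x, t) (y, s) z1 z2 u.
     (1 - z1) / 2 *
       (x \<bullet> y + u * sqrt (t\<^sup>2 - (norm x)\<^sup>2) * sqrt (s\<^sup>2 - (norm y)\<^sup>2) * sgn (s * t)) +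
     (1 + z1) / 2 * z2 * (s * t))"

lemma cone_phi_outer_sgn:
  fixes x y :: "real ^ 'd"
  assumes "(x, t) \<in> double_cone" and "(y, s) \<in> double_cone" and "s * t \<ge> 0"
  shows "cone_phi (x, t) (y, s) z1 z2 u =
     (1 - z1) / 2 *
       ((x \<bullet> y + u * sqrt (t\<^sup>2 - (norm x)\<^sup>2) * sqrt (s\<^sup>2 - (norm y)\<^sup>2)) * sgn (s * t)) +
     (1 + z1) / 2 * z2 * (s * t)"
proof (cases "s * t = 0")
  case True
  then have "x = 0 \<or> y = 0"
    using assms by (auto simp: double_cone_def)
  then show ?thesis
    using True by (auto simp: cone_phi_def)
next
  case False
  then have "0 < s * t"
    using assms(3) by linarith
  then have "sgn (s * t) = 1"
    by (rule sgn_pos)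
  then show ?thesis
    by (simp add: cone_phi_def)
qed

definition poisson_integrand ::
  "real \<Rightarrow> real \<Rightarrow> real \<Rightarrow> (real ^ 'd) \<times> real \<Rightarrow> (real ^ 'd) \<times> real \<Rightarrow> real \<times> real \<times> real \<Rightarrow> real" where
  "poisson_integrand \<beta> \<mu> r p q = (\<lambda>(z1, z2, u).
     let a = \<mu> + (real CARD('d) - 1) / 2; b = \<beta> - 3/2 in
     exp (2 * r / (1 - r\<^sup>2) * cone_phi p q z1 z2 u) *
     (2 powr (- (a + b + 1)) * c_jacobi a b) * c_gegenbauer (\<beta> - 1/2) * c_gegenbauer (\<mu> - 1/2) *
     (1 - z1) powr a * (1 + z1) powr b * (1 - z2\<^sup>2) powr (\<beta> - 1) * (1 - u\<^sup>2) powr (\<mu> - 1))"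

definition cube3 :: "(real \<times> real \<times> real) set" where
  "cube3 = {-1..1} \<times> {-1..1} \<times> {-1..1}"

definition poisson_formula ::
  "real \<Rightarrow> real \<Rightarrow> real \<Rightarrow> (real ^ 'd) \<times> real \<Rightarrow> (real ^ 'd) \<times> real \<Rightarrow> real" where
  "poisson_formula \<beta> \<mu> r p q =
     1 / (1 - r\<^sup>2) powr (\<beta> + \<mu> + real CARD('d) / 2) *
     exp (- (((snd q)\<^sup>2 + (snd p)\<^sup>2) / (1 - r\<^sup>2) * r\<^sup>2)) *
     set_lebesgue_integral lborel cube3 (poisson_integrand \<beta> \<mu> r p q)"

end

theory Submission
  imports Defs
begin

text \<open>The kernel is found in closed form for all \<open>\<beta> \<ge> 1/2\<close>, \<open>\<mu> \<ge> 0\<close>. With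
  \<open>\<gamma> = \<beta> + \<mu> + d/2\<close>, expanding the right-hand side in powers of \<open>r / (1 - r\<^sup>2)\<close> and using
  the beta-integral moments of the three weights gives coefficients \<open>gexp n p q\<close>, which are polynomials in
  \<open>p\<close>, \<open>q\<close> and remain meaningful at \<open>\<beta> = 1/2\<close> and \<open>\<mu> = 0\<close>. Re-expanding
  \<open>(1 - r\<^sup>2)\<close> to the power \<open>-\<gamma>\<close> and the exponential factor in powers of \<open>r\<close> defines the candidate kernels
  \<open>kern N\<close>. That these reproduce is tested on the polynomials \<open>s\<close> to the power \<open>2 w\<close> times
  \<open>zonal m \<xi>\<close>, which by polarization span the even polynomials; on them the cone integrals separate, the inner
  (ball) integral being evaluated through a Gaussian shift, and the reproducing property becomes
  a Rothe-Hagen convolution identity followed by a Chu-Vandermonde cancellation. On the cone \<open>\<bar>\<phi>\<bar> \<le> \<bar>s t\<bar>\<close>,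
  so the series converges uniformly in \<open>\<beta>\<close>, \<open>\<mu>\<close>, which gives the limiting cases.\<close>

text \<open>The cone integrals are explicit because of the special case
  \<open>\<beta> = 1 / 2\<close>: there the weight carries one factor \<open>\<bar>t\<bar>\<close>,
  so the substitution \<open>v = t\<^sup>2 - (norm x)\<^sup>2\<close> on the fibre over
  \<open>x\<close> leaves a Gamma value times \<open>exp (- (norm x)\<^sup>2)\<close>, and a cone
  integral becomes a Gaussian integral over the whole space. General \<open>\<beta>\<close> and even
  powers of \<open>t\<close> cost only a quotient of Gamma values, since with
  \<open>x = \<bar>t\<bar> *\<^sub>R z\<close> the integral of a homogeneous function factors into a
  radial and a ball integral. The constants \<open>\<delta> = \<mu> + (d + 1) / 2\<close> and
  \<open>\<gamma>\<close> are the Gamma arguments of these radial integrals for \<open>1 / 2\<close>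
  and for \<open>\<beta>\<close>. No orthogonal basis is constructed. Two facts identify
  \<open>kern n\<close> as the kernel of \<open>V_even \<beta> \<mu> n\<close>: it annihilates every
  polynomial of degree below \<open>n\<close>, and \<open>kern 0, ..., kern n\<close> together
  return every even polynomial of degree at most \<open>n\<close>. The definite description in
  \<open>P_even\<close> is then resolved by uniqueness of reproducing kernels for a symmetric
  form.\<close>

section \<open>Alternating binomial sums of Pochhammer symbols\<close>

lemma pochhammer_backward_diff:
  fixes y :: real
  shows "pochhammer y (Suc w) - pochhammer (y - 1) (Suc w) = real (Suc w) * pochhammer y w"
proof -
  have "pochhammer (y - 1) (Suc w) = (y - 1) * pochhammer y w"
    using pochhammer_rec[of "y - 1" w] by simp
  moreover have "pochhammer y (Suc w) = pochhammer y w * (y + real w)"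
    by (rule pochhammer_Suc)
  ultimately show ?thesis
    by (simp add: algebra_simps)
qed

text \<open>Pascal's rule in the form used for finite differences: the difference of order
  \<open>Suc G\<close> is the difference of order \<open>G\<close> of \<open>f\<close> minus that of
  the shifted \<open>f\<close>. It drives the next two inductions on \<open>G\<close>.\<close>

lemma alternating_binomial_pascal:
  fixes f :: "nat \<Rightarrow> real"
  shows "(\<Sum>i\<le>Suc G. (-1) ^ i * real (Suc G choose i) * f i) =
    (\<Sum>i\<le>G. (-1) ^ i * real (G choose i) * f i) -
    (\<Sum>i\<le>G. (-1) ^ i * real (G choose i) * f (Suc i))"
proof -
  have "(\<Sum>i\<le>Suc G. (-1) ^ i * real (Suc G choose i) * f i) =
      f 0 + (\<Sum>i\<le>G. (-1) ^ Suc i * real (Suc G choose Suc i) * f (Suc i))"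
    by (subst sum.atMost_Suc_shift) simp
  also have "(\<Sum>i\<le>G. (-1) ^ Suc i * real (Suc G choose Suc i) * f (Suc i)) =
      (\<Sum>i\<le>G. (-1) ^ Suc i * real (G choose Suc i) * f (Suc i)) -
      (\<Sum>i\<le>G. (-1) ^ i * real (G choose i) * f (Suc i))"
    by (subst sum_subtractf[symmetric], intro sum.cong refl) (simp add: algebra_simps)
  also have "f 0 + ((\<Sum>i\<le>G. (-1) ^ Suc i * real (G choose Suc i) * f (Suc i)) -
      (\<Sum>i\<le>G. (-1) ^ i * real (G choose i) * f (Suc i))) =
    (\<Sum>i\<le>Suc G. (-1) ^ i * real (G choose i) * f i) -
      (\<Sum>i\<le>G. (-1) ^ i * real (G choose i) * f (Suc i))"
    by (subst sum.atMost_Suc_shift) simp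
  finally show ?thesis
    by simp
qed

text \<open>This is the \<open>G\<close>-th backward difference in \<open>y\<close> of a polynomial
  of degree \<open>w\<close>. Each difference lowers the degree by one and brings down the current
  degree as a factor; once the degree is exhausted the result is zero.\<close>

lemma alternating_sum_pochhammer:
  fixes y :: real
  shows "(\<Sum>i\<le>G. (-1) ^ i * real (G choose i) * pochhammer (y - real i) w) =
    (if w < G then 0 else fact w / fact (w - G) * pochhammer y (w - G))"
proof (induction G arbitrary: y w)
  case 0
  then show ?case by simp
next
  case (Suc G)
  have eq: "y - real (Suc i) = (y - 1) - real i" for i by simp
  have S: "(\<Sum>i\<le>Suc G. (-1) ^ i * real (Suc G choose i) * pochhammer (y - real i) w) =
    (if w < G then 0 else fact w / fact (w - G) * (pochhammer y (w - G) - pochhammer (y - 1) (w - G)))"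
    unfolding alternating_binomial_pascal eq Suc.IH by (simp add: algebra_simps)
  show ?case
  proof (cases "w < Suc G")
    case True
    then have "w < G \<or> w - G = 0" by auto
    then show ?thesis using True unfolding S by auto
  next
    case False
    then obtain v where v: "w - G = Suc v" "w - Suc G = v"
      by (metis Suc_diff_Suc not_less_eq linorder_neqE_nat not_less)
    show ?thesis using False unfolding S v pochhammer_backward_diff
      by (simp add: divide_simps)
  qed
qed

text \<open>The same differencing for reciprocals: each step adds one factor to the denominator and
  one factor \<open>e + 1 + G\<close> to the numerator. The bound on \<open>x\<close> keeps all
  Pochhammer factors positive, so that denominators may be cleared.\<close>

lemma alternating_sum_inverse_pochhammer:
  fixes x :: real
  assumes "x > real G"
  shows "(\<Sum>i\<le>G. (-1) ^ i * real (G choose i) / pochhammer (x - real i) (Suc e)) =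
    (-1) ^ G * pochhammer (real e + 1) G / pochhammer (x - real G) (Suc e + G)"
  using assms
proof (induction G arbitrary: x)
  case 0
  then show ?case by simp
next
  case (Suc G)
  have eq: "x - real (Suc i) = (x - 1) - real i" for i by simp
  define c where "c = pochhammer (real e + 1) G"
  define P where "P = pochhammer (x - real G) (e + G)"
  have pos: "x - 1 - real G > 0" using Suc.prems by simp
  then have P: "P > 0" unfolding P_def by (intro pochhammer_pos) simp
  have 1: "pochhammer (x - real G) (Suc e + G) = P * (x + real e)"
    by (simp add: P_def pochhammer_Suc)
  have 2: "pochhammer (x - 1 - real G) (Suc e + G) = (x - 1 - real G) * P"
    using pochhammer_rec[of "x - 1 - real G" "e + G"] by (simp add: P_def)
  have 3: "pochhammer (x - 1 - real G) (Suc e + Suc G) = (x - 1 - real G) * P * (x + real e)"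
    using pochhammer_Suc[of "x - 1 - real G" "Suc e + G"] 2 by simp
  have p2: "x + real e > 0" using pos by simp
  have "(\<Sum>i\<le>Suc G. (-1) ^ i * real (Suc G choose i) / pochhammer (x - real i) (Suc e)) =
    (-1) ^ G * c / pochhammer (x - real G) (Suc e + G) -
    (-1) ^ G * c / pochhammer (x - 1 - real G) (Suc e + G)"
    using alternating_binomial_pascal[of G "\<lambda>i. 1 / pochhammer (x - real i) (Suc e)"]
      Suc.IH[of x] Suc.IH[of "x - 1"] Suc.prems
    unfolding c_def eq by simp
  also have "\<dots> = (-1) ^ Suc G * (c * (real e + 1 + real G)) / ((x - 1 - real G) * P * (x + real e))"
  proof -
    \<comment> \<open>Since \<open>e + 1 + G = Y - X\<close>, the induction step is the partial
      fraction \<open>1 / (P * Y) - 1 / (X * P) = - (Y - X) / (X * P * Y)\<close>.\<close>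
    define X where "X = x - 1 - real G"
    have X: "X > 0" "X \<noteq> 0" using pos by (auto simp: X_def)
    define Y where "Y = x + real e"
    have Y: "Y \<noteq> 0" using p2 by (auto simp: Y_def)
    have d: "real e + 1 + real G = Y - X" by (simp add: X_def Y_def)
    show ?thesis unfolding 1 2 d unfolding X_def[symmetric] Y_def[symmetric] using X Y P
      by (simp add: divide_simps) (simp add: algebra_simps)
  qed
  finally show ?case
    by (simp only: 3[symmetric] c_def pochhammer_Suc) (simp add: eq algebra_simps)
qed

text \<open>The reflection \<open>pochhammer_minus\<close> turns the last factor into a Pochhammer
  symbol with base \<open>1 - a - R\<close> and absorbs the alternating sign. What remains is the
  binomial-type sum for Pochhammer symbols, and a second reflection undoes the first.\<close>

lemma chu_vandermonde_pochhammer: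
  fixes a b :: real
  shows "(\<Sum>j\<le>R. (-1) ^ j * real (R choose j) * pochhammer b j * pochhammer (a + real j) (R - j)) =
    pochhammer (a - b) R"
proof -
  have "(-1) ^ j * pochhammer (a + real j) (R - j) = (-1) ^ R * pochhammer (1 - a - real R) (R - j)"
    if "j \<le> R" for j
  proof -
    have "pochhammer (1 - a - real R) (R - j) = (-1) ^ (R - j) * pochhammer (a + real j) (R - j)"
      using pochhammer_minus[of "a + real R - 1" "R - j"] that
      by (simp add: of_nat_diff algebra_simps)
    moreover have "(-1 :: real) ^ R * (-1) ^ (R - j) = (-1) ^ j"
      using that by (auto simp: minus_one_power_iff)
    ultimately show ?thesis by (metis mult.assoc)
  qed
  then have "(\<Sum>j\<le>R. (-1) ^ j * real (R choose j) * pochhammer b j * pochhammer (a + real j) (R - j)) =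
    (-1) ^ R * (\<Sum>j\<le>R. real (R choose j) * pochhammer b j * pochhammer (1 - a - real R) (R - j))"
    unfolding sum_distrib_left by (intro sum.cong refl) (simp add: algebra_simps)
  also have "\<dots> = (-1) ^ R * pochhammer (b + (1 - a - real R)) R"
    using pochhammer_binomial_sum[of b "1 - a - real R" R] by simp
  also have "\<dots> = pochhammer (a - b) R"
    using pochhammer_minus[of "a - b + real R - 1" R]
    by (simp add: algebra_simps flip: power_mult_distrib mult.assoc)
  finally show ?thesis .
qed

section \<open>Rothe-Hagen convolution\<close>

text \<open>Rothe-Hagen coefficients: \<open>rothe x k = x / (x + 2 k) * ((x + 2 k) gchoose k)\<close>, in a form without
  division by zero at \<open>x = 0\<close>.\<close>

fun rothe :: "real \<Rightarrow> nat \<Rightarrow> real" where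
  "rothe x 0 = 1"
| "rothe x (Suc j) = x * pochhammer (x + real j + 2) j / fact (Suc j)"

text \<open>The binomial coefficient \<open>(y + 2 j - 1) gchoose j\<close>. In terms of the Catalan
  series \<open>C = 1 + z C^2\<close>, these are the coefficients of \<open>C\<close> to the power
  \<open>y - 1\<close>, divided by \<open>sqrt (1 - 4 z)\<close>.\<close>

definition ballot :: "real \<Rightarrow> nat \<Rightarrow> real" where
  "ballot y j = pochhammer (y + real j) j / fact j"

text \<open>The numbers \<open>rothe x j\<close> are the coefficients of the \<open>x\<close>-th
  power of the Catalan series \<open>C = 1 + z C^2\<close>; multiplying that equation by the power
  \<open>x - 1\<close> of \<open>C\<close> gives this recurrence. \<open>ballot\<close> obeys the
  same one, which is why the convolution below is again a \<open>ballot\<close> number.\<close>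

lemma rothe_rec: "rothe x (Suc j) = rothe (x - 1) (Suc j) + rothe (x + 1) j"
proof (cases j)
  case 0
  then show ?thesis by simp
next
  case (Suc i)
  define P where "P = pochhammer (x + real i + 3) i"
  have 1: "pochhammer (x + real j + 2) j = P * (x + 3 + 2 * real i)"
    using pochhammer_Suc[of "x + real i + 3" i] by (simp add: Suc P_def algebra_simps)
  have 2: "pochhammer (x - 1 + real j + 2) j = (x + real i + 2) * P"
    using pochhammer_rec[of "x + real i + 2" i] by (simp add: Suc P_def algebra_simps)
  have 3: "pochhammer (x + 1 + real i + 2) i = P"
    by (simp add: P_def algebra_simps)
  have 4: "fact (Suc j) = (real i + 2) * fact j" by (simp add: Suc)
  have "x * (P * (x + 3 + 2 * real i)) = (x - 1) * ((x + real i + 2) * P) + (x + 1) * P * (real i + 2)"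
    by (simp add: algebra_simps)
  moreover have "real i + 2 \<noteq> 0" by linarith
  ultimately have "x * (P * (x + 3 + 2 * real i)) / ((real i + 2) * fact j) =
      (x - 1) * ((x + real i + 2) * P) / ((real i + 2) * fact j) + (x + 1) * P / fact j"
    by (simp add: divide_simps)
  moreover have "rothe (x + 1) j = (x + 1) * P / fact j"
    using 3 by (simp add: Suc)
  ultimately show ?thesis
    by (simp only: rothe.simps 1 2 4)
qed

lemma ballot_rec: "ballot y (Suc j) = ballot (y - 1) (Suc j) + ballot (y + 1) j"
proof -
  define P where "P = pochhammer (y + 1 + real j) j"
  have 1: "pochhammer (y + real (Suc j)) (Suc j) = P * (y + 1 + 2 * real j)"
    by (simp add: P_def pochhammer_Suc algebra_simps)
  have 2: "pochhammer (y - 1 + real (Suc j)) (Suc j) = (y + real j) * P"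
    using pochhammer_rec[of "y + real j" j] by (simp add: P_def algebra_simps)
  have "fact (Suc j) = (real j + 1) * fact j" by simp
  then show ?thesis
    unfolding ballot_def 1 2 P_def[symmetric]
    by (simp add: divide_simps) (simp add: algebra_simps)
qed

lemma poly_pochhammer: "\<exists>p. \<forall>x :: real. pochhammer (x + c) n = poly p x"
proof (induction n)
  case 0
  then show ?case by (intro exI[of _ 1]) simp
next
  case (Suc n)
  then obtain p where "\<forall>x. pochhammer (x + c) n = poly p x" by blast
  then show ?case
    by (intro exI[of _ "p * [:c + real n, 1:]"]) (simp add: pochhammer_Suc algebra_simps)
qed

lemma poly_rothe: "\<exists>p. \<forall>x. rothe x k = poly p x"
proof (cases k)
  case 0
  then show ?thesis by (intro exI[of _ 1]) simp
next
  case (Suc j)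
  obtain p where "\<forall>x :: real. pochhammer (x + (real j + 2)) j = poly p x"
    using poly_pochhammer by blast
  then show ?thesis
    by (intro exI[of _ "smult (1 / fact (Suc j)) ([:0, 1:] * p)"]) (simp add: Suc add.assoc)
qed

lemma rothe_0_left: "rothe 0 k = (if k = 0 then 1 else 0)"
  by (cases k) auto

text \<open>Both sides are polynomials in \<open>x\<close>; by induction on \<open>h\<close> their difference is periodic in \<open>x\<close>
  and it vanishes at \<open>x = 0\<close>.\<close>

lemma rothe_hagen:
  "(\<Sum>k\<le>h. rothe x k * ballot y (h - k)) = ballot (x + y) h"
proof (induction h arbitrary: x)
  case 0
  then show ?case by (simp add: ballot_def)
next
  case (Suc h)
  define D where "D x = (\<Sum>k\<le>Suc h. rothe x k * ballot y (Suc h - k)) - ballot (x + y) (Suc h)" for x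
  \<comment> \<open>Only the first factor is expanded. The terms with \<open>rothe (x + 1) k\<close>
    form the convolution of length \<open>h\<close>, which the induction hypothesis evaluates at
    \<open>x + 1\<close>, and \<open>ballot_rec\<close> absorbs the value.\<close>
  have rec: "D x = D (x - 1)" for x
  proof -
    have "(\<Sum>k\<le>Suc h. rothe x k * ballot y (Suc h - k)) =
      ballot y (Suc h) + (\<Sum>k\<le>h. (rothe (x - 1) (Suc k) + rothe (x + 1) k) * ballot y (h - k))"
      unfolding sum.atMost_Suc_shift rothe_rec[symmetric] by simp
    also have "\<dots> = (ballot y (Suc h) + (\<Sum>k\<le>h. rothe (x - 1) (Suc k) * ballot y (h - k))) +
      (\<Sum>k\<le>h. rothe (x + 1) k * ballot y (h - k))"
      by (simp add: sum.distrib distrib_right)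
    also have "ballot y (Suc h) + (\<Sum>k\<le>h. rothe (x - 1) (Suc k) * ballot y (h - k)) =
      (\<Sum>k\<le>Suc h. rothe (x - 1) k * ballot y (Suc h - k))"
      unfolding sum.atMost_Suc_shift by simp
    finally show ?thesis
      unfolding D_def Suc.IH ballot_rec[of "x + y"] by (simp add: algebra_simps)
  qed
  have D0: "D (real n) = 0" for n
  proof (induction n)
    case 0
    have "(\<Sum>k\<le>Suc h. rothe 0 k * ballot y (Suc h - k)) = ballot y (Suc h)"
      unfolding sum.atMost_Suc_shift rothe_0_left by simp
    then show ?case by (simp add: D_def)
  next
    case (Suc n)
    then show ?case using rec[of "real (Suc n)"] by simp
  qed
  obtain p where p: "\<And>k x. rothe x k = poly (p k) x"
    using poly_rothe by metis
  obtain q where q: "\<And>x. pochhammer (x + (y + real (Suc h))) (Suc h) = poly q x"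
    using poly_pochhammer by blast
  define P where "P = (\<Sum>k\<le>Suc h. smult (ballot y (Suc h - k)) (p k)) - smult (1 / fact (Suc h)) q"
  have P: "poly P x = D x" for x
    unfolding P_def D_def ballot_def[of "x + y"] add.assoc q
    by (simp add: poly_sum p mult.commute)
  have "infinite (range real)"
    using finite_imageD infinite_UNIV_nat inj_of_nat by blast
  moreover have "range real \<subseteq> {x. poly P x = 0}"
    using D0 P by auto
  ultimately have "P = 0"
    using poly_roots_finite finite_subset by blast
  then have "D x = 0"
    using P[of x] by simp
  then show ?case by (simp add: D_def)
qed

section \<open>Gegenbauer coefficients and the sums that diagonalize the pairing\<close>

text \<open>Coefficients of the Gegenbauer polynomial of degree \<open>m\<close> and index
  \<open>\<delta> - 1\<close> with respect to \<open>(2 x) ^ (m - 2 i) / fact (m - 2 i)\<close>,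
  divided by \<open>pochhammer (\<delta> - 1) m\<close>. After this division the leading coefficient
  is \<open>1\<close>, and the case \<open>\<delta> = 1\<close>, which occurs for
  \<open>d = 1\<close> and \<open>\<mu> = 0\<close>, needs no separate treatment.\<close>

definition zc :: "real \<Rightarrow> nat \<Rightarrow> nat \<Rightarrow> real" where
  "zc \<delta> m i = (-1) ^ i / (fact i * pochhammer (\<delta> + real m - 1 - real i) i)"

lemma inverse_fact_diff: "i \<le> G \<Longrightarrow> 1 / (fact i * fact (G - i)) = real (G choose i) / fact G"
  by (simp add: binomial_fact field_simps)

text \<open>For \<open>l = m + 2 * e\<close> this is the inner sum of the pairing with a zonal
  polynomial of degree \<open>m\<close>. Clearing the common factor
  \<open>pochhammer \<delta> (m - 1)\<close> leaves an alternating binomial sum of reciprocals of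
  \<open>pochhammer (x - i) (Suc e)\<close>.\<close>

lemma sum_zc_nonneg:
  assumes \<delta>: "\<delta> > 0" and G: "2 * G \<le> m"
  shows "(\<Sum>i\<le>G. zc \<delta> m i / (pochhammer \<delta> (m + e - i) * fact (G - i))) =
    zc \<delta> m G * fact (e + G) / (fact e * pochhammer \<delta> (m + e))"
\<comment> \<open>For \<open>G\<close> at least \<open>1\<close> one has \<open>m \<ge> 2\<close>,
  so that \<open>m - 1\<close> is not truncated and \<open>x > G\<close> holds.\<close>
proof (cases "G = 0")
  case True
  then show ?thesis by (simp add: zc_def)
next
  case False
  then have m: "m \<ge> 2" using G by auto
  define x where "x = \<delta> + real m - 1"
  define Q where "Q = pochhammer \<delta> (m - 1)"
  have Q: "Q > 0" unfolding Q_def using \<delta> by (rule pochhammer_pos)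
  have x: "x > real G" using m G \<delta> unfolding x_def by linarith
  have "zc \<delta> m i / (pochhammer \<delta> (m + e - i) * fact (G - i)) =
      (1 / (fact G * Q)) * ((-1) ^ i * real (G choose i) / pochhammer (x - real i) (Suc e))"
    if i: "i \<le> G" for i
  proof -
    have im: "i \<le> m - 1" using i G m by auto
    have 1: "Q = pochhammer \<delta> (m - 1 - i) * pochhammer (x - real i) i"
      unfolding Q_def x_def using pochhammer_product[OF im, of \<delta>] im m
      using pochhammer_product'[of \<delta> "m - 1 - i" i] by (simp add: of_nat_diff algebra_simps)
    have 2: "pochhammer \<delta> (m + e - i) = pochhammer \<delta> (m - 1 - i) * pochhammer (x - real i) (Suc e)"
    proof -
      have "m + e - i = (m - 1 - i) + Suc e" using im m by auto
      then show ?thesis using pochhammer_product'[of \<delta> "m - 1 - i" "Suc e"] im m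
        by (simp add: x_def of_nat_diff algebra_simps)
    qed
    have xi: "x - real i > 0" using x i by linarith
    have p: "pochhammer (x - real i) i > 0" "pochhammer (x - real i) (Suc e) > 0"
      "pochhammer \<delta> (m - 1 - i) > 0"
      using xi \<delta> by (auto intro!: pochhammer_pos)
    have zc: "zc \<delta> m i = (-1) ^ i / (fact i * pochhammer (x - real i) i)"
      by (simp add: zc_def x_def)
    have "zc \<delta> m i / (pochhammer \<delta> (m + e - i) * fact (G - i)) =
      (-1) ^ i * (1 / (fact i * fact (G - i))) / (Q * pochhammer (x - real i) (Suc e))"
      unfolding zc 2 1 using p by (simp add: divide_simps)
    then show ?thesis unfolding inverse_fact_diff[OF i] by simp
  qed
  then have "(\<Sum>i\<le>G. zc \<delta> m i / (pochhammer \<delta> (m + e - i) * fact (G - i))) =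
      (1 / (fact G * Q)) * (\<Sum>i\<le>G. (-1) ^ i * real (G choose i) / pochhammer (x - real i) (Suc e))"
    unfolding sum_distrib_left by (intro sum.cong) auto
  also have "\<dots> = (1 / (fact G * Q)) * ((-1) ^ G * pochhammer (real e + 1) G / pochhammer (x - real G) (Suc e + G))"
    using alternating_sum_inverse_pochhammer[OF x] by simp
  also have "pochhammer (x - real G) (Suc e + G) = pochhammer (x - real G) G * pochhammer x (Suc e)"
    using pochhammer_product'[of "x - real G" G "Suc e"] by (simp add: add.commute)
  also have "pochhammer (real e + 1) G = fact (e + G) / fact e"
    using pochhammer_product'[of "1 :: real" e G] by (simp add: add.commute flip: pochhammer_fact)
  also have "(1 / (fact G * Q)) * ((-1) ^ G * (fact (e + G) / fact e) /
        (pochhammer (x - real G) G * pochhammer x (Suc e))) =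
      (-1) ^ G / (fact G * pochhammer (x - real G) G) * fact (e + G) / (fact e * (Q * pochhammer x (Suc e)))"
    by simp
  also have "Q * pochhammer x (Suc e) = pochhammer \<delta> (m + e)"
    using pochhammer_product'[of \<delta> "m - 1" "Suc e"] m
    by (simp add: Q_def x_def of_nat_diff algebra_simps)
  finally show ?thesis by (simp add: zc_def x_def)
qed

text \<open>This is the case \<open>l = m - 2 * f\<close> below \<open>m\<close>. The Pochhammer
  symbol in the denominator is now shorter than \<open>pochhammer \<delta> (m - 1)\<close>, so the
  quotient is a polynomial in \<open>i\<close> of degree \<open>f - 1 < G\<close>, and its
  \<open>G\<close>-th difference is zero.\<close>

lemma sum_zc_neg:
  assumes \<delta>: "\<delta> > 0" and G: "2 * G \<le> m" and f: "1 \<le> f" "f \<le> G"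
  shows "(\<Sum>i\<le>G. zc \<delta> m i / (pochhammer \<delta> (m - f - i) * fact (G - i))) = 0"
proof -
  have m: "m \<ge> 2" using G f by auto
  define x where "x = \<delta> + real m - 1"
  define Q where "Q = pochhammer \<delta> (m - 1)"
  have Q: "Q > 0" unfolding Q_def using \<delta> by (rule pochhammer_pos)
  have x: "x > real G" using m G \<delta> unfolding x_def by linarith
  have "zc \<delta> m i / (pochhammer \<delta> (m - f - i) * fact (G - i)) =
      (1 / (fact G * Q)) * ((-1) ^ i * real (G choose i) * pochhammer (\<delta> + real m - real f - real i) (f - 1))"
    if i: "i \<le> G" for i
  proof -
    have im: "i \<le> m - f" using i G f m by auto
    have im1: "i \<le> m - 1" using i G f m by auto
    have 1: "Q = pochhammer \<delta> (m - 1 - i) * pochhammer (x - real i) i"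
      unfolding Q_def x_def using im1 m
      using pochhammer_product'[of \<delta> "m - 1 - i" i] by (simp add: of_nat_diff algebra_simps)
    have 2: "pochhammer \<delta> (m - 1 - i) =
        pochhammer \<delta> (m - f - i) * pochhammer (\<delta> + real m - real f - real i) (f - 1)"
    proof -
      have "m - 1 - i = (m - f - i) + (f - 1)" using im f G by auto
      moreover have "real (m - f - i) = real m - real f - real i" using im f G by auto
      ultimately show ?thesis using pochhammer_product'[of \<delta> "m - f - i" "f - 1"]
        by (simp add: add_diff_eq)
    qed
    have xi: "x - real i > 0" using x i by linarith
    have d0: "\<delta> + real m - real f - real i > 0" using \<delta> i f G by linarith
    have p: "pochhammer (x - real i) i > 0" "pochhammer (\<delta> + real m - real f - real i) (f - 1) > 0"
      "pochhammer \<delta> (m - f - i) > 0"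
      using xi \<delta> d0 by (auto intro!: pochhammer_pos)
    have zc: "zc \<delta> m i = (-1) ^ i / (fact i * pochhammer (x - real i) i)"
      by (simp add: zc_def x_def)
    have "zc \<delta> m i / (pochhammer \<delta> (m - f - i) * fact (G - i)) =
      (-1) ^ i * (1 / (fact i * fact (G - i))) / Q * pochhammer (\<delta> + real m - real f - real i) (f - 1)"
      unfolding zc 1 2 using p by (simp add: divide_simps)
    then show ?thesis unfolding inverse_fact_diff[OF i] by simp
  qed
  then have "(\<Sum>i\<le>G. zc \<delta> m i / (pochhammer \<delta> (m - f - i) * fact (G - i))) =
      (1 / (fact G * Q)) * (\<Sum>i\<le>G. (-1) ^ i * real (G choose i) *
        pochhammer (\<delta> + real m - real f - real i) (f - 1))"
    unfolding sum_distrib_left by (intro sum.cong) auto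
  also have "\<dots> = 0"
    unfolding alternating_sum_pochhammer using f by auto
  finally show ?thesis .
qed

text \<open>The mean of \<open>hexp \<mu> l p\<close> against \<open>lpow \<xi> j\<close>, without
  its factor \<open>pochhammer \<gamma> ((l + j) div 2)\<close>. There \<open>t = snd p\<close>,
  \<open>b = norm \<xi>\<close> and \<open>A k = lpow \<xi> k (fst p)\<close>; with these
  abstracted, the diagonalization is pure algebra. The test \<open>j - 2 * g \<le> l\<close> guards
  the truncated difference \<open>l + 2 * g - j\<close>.\<close>

definition apair :: "real \<Rightarrow> real \<Rightarrow> real \<Rightarrow> (nat \<Rightarrow> real) \<Rightarrow> nat \<Rightarrow> nat \<Rightarrow> real" where
  "apair \<delta> t b A l j = (if even (l + j)
    then (\<Sum>g\<le>j div 2. if j - 2 * g \<le> l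
        then t ^ (l + 2 * g - j) * b ^ (2 * g) / (fact ((l + 2 * g - j) div 2) * fact g) * A (j - 2 * g)
        else 0) / pochhammer \<delta> ((l + j) div 2)
    else 0)"

lemma sum_triangle_diag:
  fixes f :: "nat \<Rightarrow> nat \<Rightarrow> real"
  shows "(\<Sum>i\<le>n. \<Sum>g\<le>n - i. f i g) = (\<Sum>G\<le>n. \<Sum>i\<le>G. f i (G - i))"
  unfolding sum.Sigma[OF finite_atMost ballI[OF finite_atMost]]
  by (rule sum.reindex_bij_witness[of _ "\<lambda>(G, i). (i, G - i)" "\<lambda>(i, g). (i + g, i)"]) auto

text \<open>The terms are grouped by the total power \<open>2 * G\<close> of \<open>b\<close>, with
  \<open>G = i + g\<close>. In \<open>F i G\<close> the first factor depends on \<open>G\<close>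
  only, and the sum over \<open>i\<close> of the second is \<open>sum_zc_nonneg\<close> or
  \<open>sum_zc_neg\<close>. For \<open>m \<le> l\<close> it is proportional to
  \<open>zc \<delta> m G\<close>, so the zonal shape reappears on the right; for
  \<open>m > l\<close> it vanishes.\<close>

lemma apair_zonal:
  assumes \<delta>: "\<delta> > 0"
  shows "(\<Sum>i\<le>m div 2. zc \<delta> m i * b ^ (2 * i) * apair \<delta> t b A l (m - 2 * i)) =
    (if m \<le> l \<and> even (l + m) then t ^ (l - m) / (fact ((l - m) div 2) * pochhammer \<delta> ((l + m) div 2)) *
        (\<Sum>i\<le>m div 2. zc \<delta> m i * (t * b) ^ (2 * i) * A (m - 2 * i))
     else 0)"
proof (cases "even (l + m)")
  case False
  then have "apair \<delta> t b A l (m - 2 * i) = 0" if "i \<le> m div 2" for i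
    using that by (auto simp: apair_def)
  then show ?thesis using False by simp
next
  case True
  define F where "F i G = (if m - 2 * G \<le> l then t ^ (l + 2 * G - m) * b ^ (2 * G) /
      fact ((l + 2 * G - m) div 2) * A (m - 2 * G) else 0) *
      (zc \<delta> m i / (pochhammer \<delta> ((l + m) div 2 - i) * fact (G - i)))" for i G
  have "zc \<delta> m i * b ^ (2 * i) * apair \<delta> t b A l (m - 2 * i) = (\<Sum>g\<le>m div 2 - i. F i (i + g))"
    if i: "i \<le> m div 2" for i
  proof -
    have ev: "even (l + (m - 2 * i))" using True i by auto
    have 1: "(m - 2 * i) div 2 = m div 2 - i" by linarith
    have 2: "(l + (m - 2 * i)) div 2 = (l + m) div 2 - i"
      using i by linarith
    have "zc \<delta> m i * b ^ (2 * i) * apair \<delta> t b A l (m - 2 * i) =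
      (\<Sum>g\<le>m div 2 - i. (zc \<delta> m i * b ^ (2 * i) / pochhammer \<delta> ((l + m) div 2 - i)) *
       (if m - 2 * i - 2 * g \<le> l
        then t ^ (l + 2 * g - (m - 2 * i)) * b ^ (2 * g) / (fact ((l + 2 * g - (m - 2 * i)) div 2) * fact g) *
          A (m - 2 * i - 2 * g) else 0))"
      using ev unfolding apair_def 1 2 by (simp add: sum_distrib_left sum_divide_distrib)
    also have "\<dots> = (\<Sum>g\<le>m div 2 - i. F i (i + g))"
    proof (intro sum.cong refl)
      fix g assume "g \<in> {..m div 2 - i}"
      then have g: "2 * i + 2 * g \<le> m" using i by auto
      have e1: "l + 2 * g - (m - 2 * i) = l + 2 * (i + g) - m" using g by auto
      have e2: "m - 2 * i - 2 * g = m - 2 * (i + g)" by auto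
      show "(zc \<delta> m i * b ^ (2 * i) / pochhammer \<delta> ((l + m) div 2 - i)) *
       (if m - 2 * i - 2 * g \<le> l
        then t ^ (l + 2 * g - (m - 2 * i)) * b ^ (2 * g) / (fact ((l + 2 * g - (m - 2 * i)) div 2) * fact g) *
          A (m - 2 * i - 2 * g) else 0) = F i (i + g)"
        unfolding F_def e1 e2 by (simp add: power_add power_mult mult_ac)
    qed
    finally show ?thesis .
  qed
  then have "(\<Sum>i\<le>m div 2. zc \<delta> m i * b ^ (2 * i) * apair \<delta> t b A l (m - 2 * i)) =
      (\<Sum>G\<le>m div 2. \<Sum>i\<le>G. F i G)"
    by (simp add: sum_triangle_diag)
  also have "\<dots> = (if m \<le> l then t ^ (l - m) / (fact ((l - m) div 2) * pochhammer \<delta> ((l + m) div 2)) *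
        (\<Sum>i\<le>m div 2. zc \<delta> m i * (t * b) ^ (2 * i) * A (m - 2 * i)) else 0)"
  proof (cases "m \<le> l")
    case le: True
    then obtain e where l: "l = m + 2 * e"
      using True by (metis dvd_add_right_iff dvd_def even_add le_Suc_ex)
    have "(\<Sum>i\<le>G. F i G) = t ^ (2 * e) / (fact e * pochhammer \<delta> (m + e)) *
        (zc \<delta> m G * (t * b) ^ (2 * G) * A (m - 2 * G))" if "G \<le> m div 2" for G
    proof -
      have "2 * G \<le> m" using that by auto
      note S = sum_zc_nonneg[OF \<delta> this, of e]
      have e: "(l + m) div 2 = m + e" "(l + 2 * G - m) div 2 = e + G" "l + 2 * G - m = 2 * e + 2 * G"
        by (auto simp: l)
      show ?thesis
        unfolding F_def sum_distrib_left[symmetric] e S using l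
        by (simp add: power_add power_mult_distrib)
    qed
    then show ?thesis using le by (simp add: l sum_distrib_left)
  next
    case False
    then obtain f where f: "m = l + 2 * f" "1 \<le> f"
      using True by (metis dvd_add_right_iff dvd_def even_add le_Suc_ex nat_le_linear add_0_right mult_is_0 not_less_eq_eq One_nat_def le_zero_eq nat_neq_iff)
    have "(\<Sum>i\<le>G. F i G) = 0" if "G \<le> m div 2" for G
    proof (cases "f \<le> G")
      case True
      have "2 * G \<le> m" using that by auto
      note S = sum_zc_neg[OF \<delta> this f(2) True]
      have e: "(l + m) div 2 = m - f"
        by (auto simp: f)
      show ?thesis unfolding F_def sum_distrib_left[symmetric] e S by simp
    next
      case False
      then show ?thesis using f by (simp add: F_def)
    qed
    then show ?thesis using False by simp
  qed
  finally show ?thesis using True by simp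
qed

text \<open>With \<open>n = m + 2 * h\<close> and \<open>j = h - k\<close>, the quotient of the two
  Pochhammer symbols in \<open>\<delta>\<close> and \<open>fact j\<close> is
  \<open>ballot (\<delta> + m) j\<close>. The sum is therefore a Rothe-Hagen convolution, whose
  effect is to replace \<open>\<delta>\<close> by \<open>\<delta> + \<kappa>\<close>. Applied with
  \<open>\<kappa> = \<beta> - 1 / 2\<close>, this is the passage from \<open>\<delta>\<close> to
  \<open>\<gamma>\<close>.\<close>

lemma sum_rothe_pair:
  assumes \<delta>: "\<delta> > 0" and \<kappa>: "\<kappa> \<ge> 0"
  shows "(\<Sum>k\<le>n div 2. pochhammer \<delta> (n - 2 * k) * rothe \<kappa> k / pochhammer (\<delta> + \<kappa>) n * t ^ (2 * k) *
      (if m \<le> n - 2 * k \<and> even (n - 2 * k + m)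
       then t ^ (n - 2 * k - m) / (fact ((n - 2 * k - m) div 2) * pochhammer \<delta> ((n - 2 * k + m) div 2))
       else 0)) =
    (if m \<le> n \<and> even (n + m)
     then t ^ (n - m) / (fact ((n - m) div 2) * pochhammer (\<delta> + \<kappa>) ((n + m) div 2)) else 0)"
    (is "(\<Sum>k\<le>n div 2. ?f k) = _")
proof (cases "m \<le> n \<and> even (n + m)")
  case False
  then have "?f k = 0" if "k \<le> n div 2" for k
    using that by auto
  then have "(\<Sum>k\<le>n div 2. ?f k) = 0" by (intro sum.neutral) blast
  then show ?thesis using False by argo
next
  case True
  then obtain h where n: "n = m + 2 * h"
    by (metis dvd_add_right_iff dvd_def even_add le_Suc_ex)
  have "(\<Sum>k\<le>n div 2. ?f k) = (\<Sum>k\<le>h. ?f k)"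
    by (rule sum.mono_neutral_right) (auto simp: n)
  also have "\<dots> = (\<Sum>k\<le>h. t ^ (2 * h) / pochhammer (\<delta> + \<kappa>) n * (rothe \<kappa> k * ballot (\<delta> + real m) (h - k)))"
  proof (intro sum.cong refl)
    fix k assume "k \<in> {..h}"
    then obtain j where h: "h = k + j" by (auto simp: le_iff_add)
    have e: "n - 2 * k = m + 2 * j" "m + 2 * j - m = 2 * j" "(m + 2 * j + m) div 2 = m + j" "h - k = j"
      by (auto simp: n h)
    have p: "pochhammer \<delta> (m + j) > 0" using \<delta> by (rule pochhammer_pos)
    have "pochhammer \<delta> (m + 2 * j) = pochhammer \<delta> (m + j) * pochhammer (\<delta> + real m + real j) j"
      using pochhammer_product'[of \<delta> "m + j" j] by (simp add: add.assoc mult_2)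
    then have "pochhammer \<delta> (m + 2 * j) / (fact j * pochhammer \<delta> (m + j)) = ballot (\<delta> + real m) j"
      using p by (simp add: ballot_def)
    then have b: "ballot (\<delta> + real m) j = pochhammer \<delta> (m + 2 * j) / (fact j * pochhammer \<delta> (m + j))"
      by simp
    show "?f k = t ^ (2 * h) / pochhammer (\<delta> + \<kappa>) n * (rothe \<kappa> k * ballot (\<delta> + real m) (h - k))"
      unfolding e b by (simp add: h power_add)
  qed
  also have "\<dots> = t ^ (2 * h) / pochhammer (\<delta> + \<kappa>) n * ballot (\<kappa> + (\<delta> + real m)) h"
    unfolding sum_distrib_left[symmetric] rothe_hagen ..
  also have "\<dots> = t ^ (2 * h) / (fact h * pochhammer (\<delta> + \<kappa>) (m + h))"
  proof -
    have "pochhammer (\<delta> + \<kappa>) n = pochhammer (\<delta> + \<kappa>) (m + h) * pochhammer (\<kappa> + (\<delta> + real m) + real h) h"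
      using pochhammer_product'[of "\<delta> + \<kappa>" "m + h" h]
      by (simp add: n mult_2 add.assoc add.left_commute add.commute)
    moreover have "pochhammer (\<kappa> + (\<delta> + real m) + real h) h > 0"
      using \<delta> \<kappa> by (intro pochhammer_pos) simp
    ultimately show ?thesis by (simp add: ballot_def)
  qed
  finally have S: "(\<Sum>k\<le>n div 2. ?f k) = t ^ (2 * h) / (fact h * pochhammer (\<delta> + \<kappa>) (m + h))" .
  have "n - m = 2 * h" "(n - m) div 2 = h" "(n + m) div 2 = m + h" by (auto simp: n)
  then show ?thesis unfolding S using True by simp
qed

section \<open>The factors by which the candidate kernels act on zonal polynomials\<close>

text \<open>Integrating \<open>kern \<beta> \<mu> N p\<close> against
  \<open>snd q ^ (2 * e) * zonal \<delta> m \<xi> q\<close> gives this factor, at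
  \<open>t = snd p\<close>, times \<open>zonal \<delta> m \<xi> p\<close>. The formula follows the
  sums in \<open>kern\<close> term by term.\<close>

definition kcoef :: "real \<Rightarrow> nat \<Rightarrow> nat \<Rightarrow> real \<Rightarrow> nat \<Rightarrow> real" where
  "kcoef \<gamma> m e t N = (\<Sum>i\<le>N div 2. \<Sum>j\<le>i. (-1) ^ j / fact j *
      (pochhammer (\<gamma> + real (N - 2 * i) + real j) (i - j) / fact (i - j)) *
      (\<Sum>k\<le>j. real (j choose k) * t ^ (2 * k) *
        (if m \<le> N - 2 * i \<and> even (N - 2 * i + m)
         then pochhammer (\<gamma> + (real (N - 2 * i) + real m) / 2) (e + (j - k)) * t ^ (N - 2 * i - m) /
           fact ((N - 2 * i - m) div 2)
         else 0)))"

text \<open>The triple sum is sorted by the power \<open>2 * L\<close> of \<open>t\<close>, with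
  \<open>j1 = k\<close>, \<open>j2 = j - k\<close> and \<open>L = j1 + h\<close>, where
  \<open>h = M - i\<close>. The sum over \<open>j2\<close> is of Chu-Vandermonde type and its value
  depends on the parameter difference \<open>L - e\<close> only, not on \<open>j1\<close>. The sum
  over \<open>j1\<close> is then an \<open>L\<close>-th backward difference of a Pochhammer symbol
  of length \<open>e\<close>, which produces \<open>e choose L\<close>.\<close>

lemma kcoef_eq:
  "kcoef \<gamma> m e t (m + 2 * M) = (\<Sum>L\<le>M. t ^ (2 * L) * real (e choose L) *
     pochhammer (\<gamma> + real m + real L) (e - L) * pochhammer (real L - real e) (M - L) / fact (M - L))"
proof -
  define g where "g = \<gamma> + real m"
  define T where "T h j1 j2 k = (-1) ^ (j1 + j2) * t ^ (2 * (j1 + h)) / (fact j1 * fact j2 * fact k * fact h) *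
    pochhammer (g + 2 * real h + real (j1 + j2)) k * pochhammer (g + real h) (e + j2)" for h j1 j2 k
  have "kcoef \<gamma> m e t (m + 2 * M) = (\<Sum>i\<le>M. \<Sum>j\<le>i. \<Sum>k\<le>j. T (M - i) k (j - k) (i - j))"
  proof -
    have "kcoef \<gamma> m e t (m + 2 * M) = (\<Sum>i\<le>M. \<Sum>j\<le>i. (-1) ^ j / fact j *
      (pochhammer (\<gamma> + real (m + 2 * M - 2 * i) + real j) (i - j) / fact (i - j)) *
      (\<Sum>k\<le>j. real (j choose k) * t ^ (2 * k) *
        (if m \<le> m + 2 * M - 2 * i \<and> even (m + 2 * M - 2 * i + m)
         then pochhammer (\<gamma> + (real (m + 2 * M - 2 * i) + real m) / 2) (e + (j - k)) *
           t ^ (m + 2 * M - 2 * i - m) / fact ((m + 2 * M - 2 * i - m) div 2)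
         else 0)))"
      unfolding kcoef_def by (rule sum.mono_neutral_right) (auto intro!: sum.neutral)
    also have "\<dots> = (\<Sum>i\<le>M. \<Sum>j\<le>i. \<Sum>k\<le>j. T (M - i) k (j - k) (i - j))"
    proof (intro sum.cong refl)
      fix i j assume "i \<in> {..M}" and j: "j \<in> {..i}"
      then obtain h where M: "M = i + h" by (auto simp: le_iff_add)
      have e: "m + 2 * M - 2 * i = m + 2 * h" "m + 2 * h - m = 2 * h" "M - i = h" by (auto simp: M)
      show "(-1) ^ j / fact j *
      (pochhammer (\<gamma> + real (m + 2 * M - 2 * i) + real j) (i - j) / fact (i - j)) *
      (\<Sum>k\<le>j. real (j choose k) * t ^ (2 * k) *
        (if m \<le> m + 2 * M - 2 * i \<and> even (m + 2 * M - 2 * i + m)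
         then pochhammer (\<gamma> + (real (m + 2 * M - 2 * i) + real m) / 2) (e + (j - k)) *
           t ^ (m + 2 * M - 2 * i - m) / fact ((m + 2 * M - 2 * i - m) div 2)
         else 0)) = (\<Sum>k\<le>j. T (M - i) k (j - k) (i - j))"
        unfolding sum_distrib_left e
      proof (intro sum.cong refl)
        fix k assume "k \<in> {..j}"
        then have k: "k \<le> j" by auto
        have a: "\<gamma> + (real (m + 2 * h) + real m) / 2 = g + real h"
          "\<gamma> + real (m + 2 * h) + real j = g + 2 * real h + real j"
          by (auto simp: g_def field_simps)
        have "(-1) ^ j / fact j * real (j choose k) = (-1) ^ j / (fact k * fact (j - k) :: real)"
          using inverse_fact_diff[OF k] k by (simp add: field_simps)
        then show "(-1) ^ j / fact j * (pochhammer (\<gamma> + real (m + 2 * h) + real j) (i - j) / fact (i - j)) *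
          (real (j choose k) * t ^ (2 * k) * (if m \<le> m + 2 * h \<and> even (m + 2 * h + m)
           then pochhammer (\<gamma> + (real (m + 2 * h) + real m) / 2) (e + (j - k)) * t ^ (2 * h) / fact (2 * h div 2)
           else 0)) = T h k (j - k) (i - j)"
          unfolding a T_def using k by (simp add: field_simps power_add)
      qed
    qed
    finally show ?thesis .
  qed
  also have "\<dots> = (\<Sum>L\<le>M. \<Sum>j1\<le>L. \<Sum>j2\<le>M - L. T (L - j1) j1 j2 (M - L - j2))"
    by (simp add: sum.Sigma)
      (rule sum.reindex_bij_witness[of _ "\<lambda>(L, j1, j2). (M - L + j1, j1 + j2, j1)" "\<lambda>(i, j, k). (M - i + k, k, j - k)"];
       auto)
  also have "\<dots> = (\<Sum>L\<le>M. t ^ (2 * L) * real (e choose L) *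
     pochhammer (g + real L) (e - L) * pochhammer (real L - real e) (M - L) / fact (M - L))"
  proof (intro sum.cong refl)
    fix L assume "L \<in> {..M}"
    define R where "R = M - L"
    have "(\<Sum>j2\<le>R. T (L - j1) j1 j2 (R - j2)) =
      (-1) ^ j1 * real (L choose j1) * pochhammer (g + real L - real j1) e *
      (t ^ (2 * L) / fact L * pochhammer (real L - real e) R / fact R)" if j1: "j1 \<le> L" for j1
    proof -
      have h: "real (L - j1) = real L - real j1" "j1 + (L - j1) = L" using j1 by auto
      have "(\<Sum>j2\<le>R. T (L - j1) j1 j2 (R - j2)) =
        (\<Sum>j2\<le>R. (-1) ^ j1 * (1 / (fact j1 * fact (L - j1))) * t ^ (2 * L) *
          pochhammer (g + real L - real j1) e / fact R *
         ((-1) ^ j2 * real (R choose j2) * pochhammer (g + real L - real j1 + real e) j2 *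
          pochhammer (g + 2 * real (L - j1) + real j1 + real j2) (R - j2)))"
      proof (intro sum.cong refl)
        fix j2 assume "j2 \<in> {..R}"
        then have j2: "j2 \<le> R" by auto
        have "pochhammer (g + real (L - j1)) (e + j2) =
          pochhammer (g + real L - real j1) e * pochhammer (g + real L - real j1 + real e) j2"
          unfolding pochhammer_product' h(1) by (simp add: add_diff_eq)
        moreover have "real (R choose j2) / fact R = 1 / (fact j2 * fact (R - j2))"
          using inverse_fact_diff[OF j2] by simp
        ultimately show "T (L - j1) j1 j2 (R - j2) = (-1) ^ j1 * (1 / (fact j1 * fact (L - j1))) * t ^ (2 * L) *
          pochhammer (g + real L - real j1) e / fact R *
         ((-1) ^ j2 * real (R choose j2) * pochhammer (g + real L - real j1 + real e) j2 *
          pochhammer (g + 2 * real (L - j1) + real j1 + real j2) (R - j2))"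
          unfolding T_def h(2) using j2 by (simp add: field_simps power_add)
      qed
      also have "\<dots> = (-1) ^ j1 * (1 / (fact j1 * fact (L - j1))) * t ^ (2 * L) *
          pochhammer (g + real L - real j1) e / fact R * pochhammer (real L - real e) R"
      proof -
        have "g + 2 * real (L - j1) + real j1 - (g + real L - real j1 + real e) = real L - real e"
          using h(1) by simp
        then show ?thesis
          unfolding sum_distrib_left[symmetric] chu_vandermonde_pochhammer by simp
      qed
      finally show ?thesis unfolding inverse_fact_diff[OF j1] by simp
    qed
    then have "(\<Sum>j1\<le>L. \<Sum>j2\<le>R. T (L - j1) j1 j2 (R - j2)) =
      (\<Sum>j1\<le>L. (-1) ^ j1 * real (L choose j1) * pochhammer (g + real L - real j1) e) *
      (t ^ (2 * L) / fact L * pochhammer (real L - real e) R / fact R)"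
      unfolding sum_distrib_right by (intro sum.cong) auto
    also have "\<dots> = t ^ (2 * L) * real (e choose L) *
     pochhammer (g + real L) (e - L) * pochhammer (real L - real e) R / fact R"
      unfolding alternating_sum_pochhammer
      by (auto simp: binomial_eq_0 binomial_fact mult_ac)
    finally show "(\<Sum>j1\<le>L. \<Sum>j2\<le>M - L. T (L - j1) j1 j2 (M - L - j2)) = t ^ (2 * L) * real (e choose L) *
     pochhammer (g + real L) (e - L) * pochhammer (real L - real e) (M - L) / fact (M - L)"
      unfolding R_def .
  qed
  finally show ?thesis unfolding g_def .
qed

lemma kcoef_parity: "\<not> (m \<le> N \<and> even (N + m)) \<Longrightarrow> kcoef \<gamma> m e t N = 0"
  unfolding kcoef_def by (intro sum.neutral) (auto intro!: sum.neutral)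

text \<open>For \<open>M > e\<close> each summand vanishes: if \<open>L \<le> e\<close>, the symbol
  \<open>pochhammer (- real (e - L)) (M - L)\<close> runs through zero; otherwise
  \<open>e choose L\<close> is zero.\<close>

lemma kcoef_eq_0:
  assumes "N > m + 2 * e"
  shows "kcoef \<gamma> m e t N = 0"
proof (cases "m \<le> N \<and> even (N + m)")
  case True
  then obtain M where N: "N = m + 2 * M"
    by (metis dvd_add_right_iff dvd_def even_add le_Suc_ex)
  then have M: "M > e" using assms by auto
  show ?thesis unfolding N kcoef_eq
  proof (intro sum.neutral ballI)
    fix L assume "L \<in> {..M}"
    show "t ^ (2 * L) * real (e choose L) * pochhammer (\<gamma> + real m + real L) (e - L) *
      pochhammer (real L - real e) (M - L) / fact (M - L) = 0"
    proof (cases "L \<le> e")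
      case True
      then have "pochhammer (- real (e - L)) (M - L) = 0"
        using M by (intro pochhammer_of_nat_eq_0_lemma) auto
      then show ?thesis using True by (simp add: of_nat_diff)
    qed (simp add: binomial_eq_0)
  qed
qed (use kcoef_parity in auto)

text \<open>The kernels up to the degree of the test polynomial restore the factor
  \<open>snd q ^ (2 * e)\<close> at \<open>p\<close>. Summed over \<open>R = M - L\<close>, the last
  factors give the binomial expansion of \<open>(1 - 1) ^ (e - L)\<close>, so only
  \<open>L = e\<close> survives.\<close>

lemma sum_kcoef:
  assumes "n \<ge> m + 2 * e"
  shows "(\<Sum>N\<le>n. kcoef \<gamma> m e t N) = t ^ (2 * e)"
proof -
  have "(\<Sum>N\<le>n. kcoef \<gamma> m e t N) = (\<Sum>N\<in>(\<lambda>M. m + 2 * M) ` {..e}. kcoef \<gamma> m e t N)"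
  proof (rule sum.mono_neutral_right)
    show "\<forall>N\<in>{..n} - (\<lambda>M. m + 2 * M) ` {..e}. kcoef \<gamma> m e t N = 0"
    proof
      fix N assume N: "N \<in> {..n} - (\<lambda>M. m + 2 * M) ` {..e}"
      show "kcoef \<gamma> m e t N = 0"
      proof (cases "m \<le> N \<and> even (N + m)")
        case True
        then obtain M where M: "N = m + 2 * M"
          by (metis dvd_add_right_iff dvd_def even_add le_Suc_ex)
        then have "M > e" using N by (auto simp: not_le)
        then show ?thesis using M by (intro kcoef_eq_0) auto
      qed (use kcoef_parity in auto)
    qed
  qed (use assms in auto)
  also have "\<dots> = (\<Sum>M\<le>e. kcoef \<gamma> m e t (m + 2 * M))"
    by (subst sum.reindex) (auto simp: inj_on_def)
  also have "\<dots> = (\<Sum>L\<le>e. \<Sum>R\<le>e - L. t ^ (2 * L) * real (e choose L) *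
     pochhammer (\<gamma> + real m + real L) (e - L) * pochhammer (real L - real e) R / fact R)"
    unfolding kcoef_eq sum_triangle_diag by simp
  also have "\<dots> = (\<Sum>L\<le>e. t ^ (2 * L) * real (e choose L) *
     pochhammer (\<gamma> + real m + real L) (e - L) * (if L = e then 1 else 0))"
  proof (intro sum.cong refl)
    fix L assume "L \<in> {..e}"
    then obtain n where e: "e = L + n" by (auto simp: le_iff_add)
    have "(\<Sum>R\<le>n. pochhammer (- real n) R / fact R) = (\<Sum>R\<le>n. real (n choose R) * (-1) ^ R * 1 ^ (n - R))"
      by (intro sum.cong refl) (simp add: binomial_gbinomial gbinomial_pochhammer)
    also have "\<dots> = (if L = e then 1 else 0)"
      using binomial_ring[of "-1 :: real" 1 n] by (simp add: e power_0_left)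
    finally show "(\<Sum>R\<le>e - L. t ^ (2 * L) * real (e choose L) *
     pochhammer (\<gamma> + real m + real L) (e - L) * pochhammer (real L - real e) R / fact R) =
      t ^ (2 * L) * real (e choose L) *
     pochhammer (\<gamma> + real m + real L) (e - L) * (if L = e then 1 else 0)"
      by (simp add: e sum_distrib_left[symmetric] flip: times_divide_eq_right)
  qed
  also have "\<dots> = t ^ (2 * e)"
    by (simp add: if_distrib cong: if_cong)
  finally show ?thesis .
qed

lemma Gamma_shift:
  fixes x :: real
  assumes "x > 0"
  shows "Gamma (real n + x) = pochhammer x n * Gamma x"
proof -
  have "x \<notin> \<int>\<^sub>\<le>\<^sub>0" using assms by (auto elim!: nonpos_Ints_cases)
  then show ?thesis
    using pochhammer_Gamma[of x n] Gamma_real_pos[OF assms] by (simp add: add.commute)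
qed

section \<open>Polynomials as spans of monomials, and polarization\<close>

text \<open>An inductive form of \<open>polys_upto n\<close>: closure properties follow by rule
  induction instead of computations with coefficient families on multi-indices.\<close>

inductive_set pspan :: "nat \<Rightarrow> ((real ^ 'd) \<times> real \<Rightarrow> real) set" for n :: nat where
  monom: "(\<Sum>i\<in>UNIV. a i) + k \<le> n \<Longrightarrow> (\<lambda>p. (\<Prod>i\<in>UNIV. (fst p $ i) ^ a i) * snd p ^ k) \<in> pspan n"
| zero: "(\<lambda>p. 0) \<in> pspan n"
| add: "f \<in> pspan n \<Longrightarrow> g \<in> pspan n \<Longrightarrow> (\<lambda>p. f p + g p) \<in> pspan n"
| cmult: "f \<in> pspan n \<Longrightarrow> (\<lambda>p. c * f p) \<in> pspan n"

lemma finite_multi_indices: "finite {(a :: 'd :: finite \<Rightarrow> nat, k). (\<Sum>i\<in>UNIV. a i) + k \<le> n}"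
proof (rule finite_subset)
  show "{(a :: 'd \<Rightarrow> nat, k). (\<Sum>i\<in>UNIV. a i) + k \<le> n} \<subseteq> (UNIV \<rightarrow>\<^sub>E {..n}) \<times> {..n}"
    by (auto intro: order_trans[OF member_le_sum[of _ UNIV]] elim: order_trans[rotated])
  show "finite ((UNIV \<rightarrow>\<^sub>E {..n}) \<times> {..n} :: (('d \<Rightarrow> nat) \<times> nat) set)"
    by (intro finite_cartesian_product finite_PiE) auto
qed

lemma pspan_sum: "(\<And>i. i \<in> I \<Longrightarrow> f i \<in> pspan n) \<Longrightarrow> (\<lambda>p. \<Sum>i\<in>I. f i p) \<in> pspan n"
  by (induction I rule: infinite_finite_induct) (auto intro: pspan.intros)

lemma polys_upto_eq_pspan: "polys_upto n = pspan n"
proof (intro equalityI subsetI)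
  fix f :: "(real ^ 'd) \<times> real \<Rightarrow> real"
  let ?I = "{(a :: 'd \<Rightarrow> nat, k). (\<Sum>i\<in>UNIV. a i) + k \<le> n}"
  {
    assume "f \<in> polys_upto n"
    then obtain c where "\<And>x t. f (x, t) = (\<Sum>(a, k)\<in>?I. c (a, k) * (\<Prod>i\<in>UNIV. (x $ i) ^ a i) * t ^ k)"
      by (auto simp: polys_upto_def)
    then have "f = (\<lambda>p. \<Sum>q\<in>?I. c q * ((\<Prod>i\<in>UNIV. (fst p $ i) ^ fst q i) * snd p ^ snd q))"
      by (auto simp: case_prod_beta' mult.assoc)
    also have "\<dots> \<in> pspan n"
      by (intro pspan_sum pspan.cmult pspan.monom) auto
    finally show "f \<in> pspan n" .
  }
  assume "f \<in> pspan n"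
  then show "f \<in> polys_upto n"
  proof induction
    case (monom a k)
    show ?case unfolding polys_upto_def
    proof (intro CollectI exI allI)
      fix x :: "real ^ 'd" and t :: real
      have "(\<Sum>q\<in>?I. (if q = (a, k) then 1 else 0) * (\<Prod>i\<in>UNIV. (x $ i) ^ fst q i) * t ^ snd q) =
        (\<Sum>q\<in>?I. if q = (a, k) then (\<Prod>i\<in>UNIV. (x $ i) ^ fst q i) * t ^ snd q else 0)"
        by (intro sum.cong) auto
      also have "\<dots> = (\<Prod>i\<in>UNIV. (x $ i) ^ a i) * t ^ k"
        using monom by (subst sum.delta[OF finite_multi_indices]) auto
      finally show "(\<Prod>i\<in>UNIV. (fst (x, t) $ i) ^ a i) * snd (x, t) ^ k =
        (\<Sum>(b, l)\<in>?I. (if (b, l) = (a, k) then 1 else 0) * (\<Prod>i\<in>UNIV. (x $ i) ^ b i) * t ^ l)"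
        by (simp only: case_prod_beta' prod.collapse fst_conv snd_conv)
    qed
  next
    case zero
    show ?case unfolding polys_upto_def by (intro CollectI exI[of _ "\<lambda>_. 0"]) simp
  next
    case (add f g)
    then obtain c d where "\<And>x t. f (x, t) = (\<Sum>(a, k)\<in>?I. c (a, k) * (\<Prod>i\<in>UNIV. (x $ i) ^ a i) * t ^ k)"
      "\<And>x t. g (x, t) = (\<Sum>(a, k)\<in>?I. d (a, k) * (\<Prod>i\<in>UNIV. (x $ i) ^ a i) * t ^ k)"
      by (auto simp: polys_upto_def)
    then show ?case unfolding polys_upto_def
      by (intro CollectI exI[of _ "\<lambda>q. c q + d q"])
        (simp add: sum.distrib[symmetric] distrib_right case_prod_beta')
  next
    case (cmult f e)
    then obtain c where "\<And>x t. f (x, t) = (\<Sum>(a, k)\<in>?I. c (a, k) * (\<Prod>i\<in>UNIV. (x $ i) ^ a i) * t ^ k)"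
      by (auto simp: polys_upto_def)
    then show ?case unfolding polys_upto_def
      by (intro CollectI exI[of _ "\<lambda>q. e * c q"])
        (simp add: sum_distrib_left case_prod_beta' mult.assoc)
  qed
qed

lemma pspan_mono: "f \<in> pspan n \<Longrightarrow> n \<le> m \<Longrightarrow> f \<in> pspan m"
  by (induction rule: pspan.induct) (auto intro: pspan.intros)

lemma pspan_const: "(\<lambda>p. c) \<in> pspan n"
  using pspan.cmult[OF pspan.monom[of "\<lambda>_. 0" 0 n], of c] by simp

lemma pspan_mult:
  assumes "f \<in> pspan n" "g \<in> pspan m"
  shows "(\<lambda>p. f p * g p) \<in> pspan (n + m)"
  using assms
proof (induction rule: pspan.induct)
  case (monom a k)
  note 1 = monom(1)
  show ?case using monom(2)
  proof (induction rule: pspan.induct)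
    case (monom b l)
    have "(\<lambda>p. (\<Prod>i\<in>UNIV. (fst p $ i) ^ (a i + b i)) * snd p ^ (k + l)) \<in> pspan (n + m)"
      using 1 monom by (intro pspan.monom) (simp add: sum.distrib)
    then show ?case by (simp add: power_add prod.distrib mult_ac)
  next
    case (add f g)
    then show ?case by (simp add: distrib_left pspan.add)
  next
    case (cmult f c)
    then show ?case by (simp add: mult.left_commute[of _ c] pspan.cmult)
  qed (auto intro: pspan.zero)
next
  case (add f g')
  then show ?case by (simp add: distrib_right pspan.add)
next
  case (cmult f c)
  then show ?case by (simp add: mult.assoc pspan.cmult)
qed (auto intro: pspan.zero)

lemma pspan_power: "f \<in> pspan n \<Longrightarrow> (\<lambda>p. f p ^ k) \<in> pspan (k * n)"
proof (induction k)
  case (Suc k)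
  then show ?case using pspan_mult[of f n "\<lambda>p. f p ^ k" "k * n"] by simp
qed (simp add: pspan_const)

lemma pspan_snd: "snd \<in> pspan 1"
  using pspan.monom[of "\<lambda>_. 0" 1 1] by simp

lemma pspan_nth: "(\<lambda>p. fst p $ i) \<in> pspan 1"
proof -
  have "(\<Sum>j\<in>UNIV. if j = i then 1 else 0 :: nat) + 0 \<le> 1" by simp
  from pspan.monom[OF this] have "(\<lambda>p. \<Prod>j\<in>UNIV. (fst p $ j) ^ (if j = i then 1 else 0)) \<in> pspan 1"
    by simp
  also have "(\<lambda>p. \<Prod>j\<in>UNIV. (fst p $ j) ^ (if j = i then 1 else 0)) = (\<lambda>p :: (real ^ 'a) \<times> real. fst p $ i)"
    by (simp add: if_distrib[of "\<lambda>k. _ ^ k"] cong: if_cong)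
  finally show ?thesis .
qed

lemma pspan_inner: "(\<lambda>p. \<xi> \<bullet> fst p) \<in> pspan 1"
  unfolding inner_vec_def inner_real_def by (intro pspan_sum pspan.cmult pspan_nth)

lemma pspan_norm_sq: "(\<lambda>p. (norm (fst p))\<^sup>2) \<in> pspan 2"
proof -
  have "(\<lambda>p :: (real ^ 'a) \<times> real. \<Sum>i\<in>UNIV. (fst p $ i)\<^sup>2) \<in> pspan (2 * 1)"
    by (intro pspan_sum pspan_power pspan_nth)
  also have "(\<lambda>p :: (real ^ 'a) \<times> real. \<Sum>i\<in>UNIV. (fst p $ i)\<^sup>2) = (\<lambda>p. (norm (fst p))\<^sup>2)"
    unfolding power2_norm_eq_inner inner_vec_def inner_real_def by (simp add: power2_eq_square)
  finally show ?thesis by simp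
qed

lemma pspan_continuous: "f \<in> pspan n \<Longrightarrow> continuous_on UNIV f"
  by (induction rule: pspan.induct) (auto intro!: continuous_intros)

lemma pspan_borel: "f \<in> pspan n \<Longrightarrow> f \<in> borel_measurable borel"
  by (intro borel_measurable_continuous_onI pspan_continuous)

text \<open>Replacing \<open>c\<close> by \<open>2 c\<close> and subtracting \<open>2\<^sup>n\<close> times the original eliminates the top coefficient.\<close>

lemma coefficients_in_subspace:
  fixes S :: "('a \<Rightarrow> real) set"
  assumes add: "\<And>f g. f \<in> S \<Longrightarrow> g \<in> S \<Longrightarrow> (\<lambda>q. f q + g q) \<in> S"
    and cmult: "\<And>c f. f \<in> S \<Longrightarrow> (\<lambda>q. c * f q) \<in> S"
    and S: "\<And>c. (\<lambda>q. \<Sum>i\<le>n. c ^ i * F i q) \<in> S" and "i \<le> n"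
  shows "F i \<in> S"
  using S \<open>i \<le> n\<close>
proof (induction n arbitrary: F i)
  case 0
  then show ?case using 0(1)[of 0] by simp
next
  case (Suc n)
  have lower: "F j \<in> S" if "j \<le> n" for j
  proof -
    have "(\<lambda>q. (2 ^ j - 2 ^ Suc n) * F j q) \<in> S"
    proof (rule Suc.IH[where F = "\<lambda>j q. (2 ^ j - 2 ^ Suc n) * F j q"])
      fix c :: real
      have "(\<lambda>q. (\<Sum>i\<le>Suc n. (2 * c) ^ i * F i q) + (- (2 ^ Suc n)) * (\<Sum>i\<le>Suc n. c ^ i * F i q)) \<in> S"
        by (intro add cmult Suc.prems)
      also have "(\<lambda>q. (\<Sum>i\<le>Suc n. (2 * c) ^ i * F i q) + (- (2 ^ Suc n)) * (\<Sum>i\<le>Suc n. c ^ i * F i q)) =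
        (\<lambda>q. \<Sum>i\<le>n. c ^ i * ((2 ^ i - 2 ^ Suc n) * F i q))"
      proof
        fix q
        have "(\<Sum>i\<le>Suc n. (2 * c) ^ i * F i q) + (- (2 ^ Suc n)) * (\<Sum>i\<le>Suc n. c ^ i * F i q) =
          (\<Sum>i\<le>Suc n. c ^ i * ((2 ^ i - 2 ^ Suc n) * F i q))"
          unfolding sum_distrib_left sum.distrib[symmetric]
          by (intro sum.cong refl) (simp add: power_mult_distrib algebra_simps)
        then show "(\<Sum>i\<le>Suc n. (2 * c) ^ i * F i q) + (- (2 ^ Suc n)) * (\<Sum>i\<le>Suc n. c ^ i * F i q) =
          (\<Sum>i\<le>n. c ^ i * ((2 ^ i - 2 ^ Suc n) * F i q))"
          by simp
      qed
      finally show "(\<lambda>q. \<Sum>i\<le>n. c ^ i * ((2 ^ i - 2 ^ Suc n) * F i q)) \<in> S" .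
    qed fact
    then have "(\<lambda>q. (1 / (2 ^ j - 2 ^ Suc n)) * ((2 ^ j - 2 ^ Suc n) * F j q)) \<in> S"
      by (rule cmult)
    moreover have "(2 :: real) ^ j \<noteq> 2 ^ Suc n"
      using that by (intro less_imp_neq power_strict_increasing) auto
    ultimately show ?thesis by simp
  qed
  have fin: "(\<lambda>q. \<Sum>i\<le>k. F i q) \<in> S" if "k \<le> n" for k
    using that by (induction k) (auto intro: add lower)
  have "(\<lambda>q. (\<Sum>i\<le>Suc n. 1 ^ i * F i q) + (- 1) * (\<Sum>i\<le>n. F i q)) \<in> S"
    by (intro add cmult Suc.prems fin) auto
  then have "F (Suc n) \<in> S" by simp
  then show ?case using lower Suc.prems(2) by (cases "i = Suc n") auto
qed

text \<open>Coordinates are extracted one at a time. Replacing \<open>\<xi>\<close> by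
  \<open>c *\<^sub>R axis j 1 + \<xi>\<close> makes the power of the linear form a polynomial in
  \<open>c\<close>, whose coefficients stay in \<open>S\<close>; the coefficient of
  \<open>c ^ a j\<close> contributes the next monomial factor. \<open>S\<close> is an arbitrary set
  closed under linear combinations, since it will be the set of functions satisfying the reproducing
  identities.\<close>

lemma polarization:
  fixes S :: "((real ^ 'd) \<times> real \<Rightarrow> real) set"
  assumes add: "\<And>f g. f \<in> S \<Longrightarrow> g \<in> S \<Longrightarrow> (\<lambda>q. f q + g q) \<in> S"
    and cmult: "\<And>c f. f \<in> S \<Longrightarrow> (\<lambda>q. c * f q) \<in> S"
    and S: "\<And>\<xi>. (\<lambda>q. u q * (\<xi> \<bullet> fst q) ^ (\<Sum>i\<in>UNIV. a i)) \<in> S"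
  shows "(\<lambda>q. u q * (\<Prod>i\<in>UNIV. (fst q $ i) ^ a i)) \<in> S"
proof -
  have "\<forall>\<xi>. (\<lambda>q. u q * (\<Prod>i\<in>I. (fst q $ i) ^ a i) * (\<xi> \<bullet> fst q) ^ (\<Sum>i\<in>- I. a i)) \<in> S" for I :: "'d set"
    using finite[of I]
  proof (induction I rule: finite_induct)
    case empty
    then show ?case using S by simp
  next
    case (insert j I)
    define M where "M = (\<Sum>i\<in>- I. a i)"
    have M: "M = a j + (\<Sum>i\<in>- insert j I. a i)"
    proof -
      have "- I = insert j (- insert j I)" using insert by auto
      then show ?thesis unfolding M_def by (metis Compl_iff finite insertI1 sum.insert)
    qed
    show ?case
    proof
      fix \<xi> :: "real ^ 'd"
      define F where "F i q = u q * (\<Prod>i\<in>I. (fst q $ i) ^ a i) * (real (M choose i) * (fst q $ j) ^ i * (\<xi> \<bullet> fst q) ^ (M - i))" for i q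
      have "(\<lambda>q. \<Sum>i\<le>M. c ^ i * F i q) \<in> S" for c
      proof -
        have "(\<lambda>q. u q * (\<Prod>i\<in>I. (fst q $ i) ^ a i) * ((c *\<^sub>R axis j 1 + \<xi>) \<bullet> fst q) ^ M) \<in> S"
          using insert.IH unfolding M_def by blast
        also have "(\<lambda>q. u q * (\<Prod>i\<in>I. (fst q $ i) ^ a i) * ((c *\<^sub>R axis j 1 + \<xi>) \<bullet> fst q) ^ M) =
          (\<lambda>q. \<Sum>i\<le>M. c ^ i * F i q)"
          unfolding inner_add_left inner_scaleR_left binomial_ring sum_distrib_left
          by (intro ext sum.cong refl)
            (simp add: F_def inner_axis inner_commute[of "axis j 1"] power_mult_distrib mult_ac)
        finally show ?thesis .
      qed
      then have "F (a j) \<in> S"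
        using M by (intro coefficients_in_subspace[where F = F and n = M] add cmult) auto
      then have "(\<lambda>q. (1 / real (M choose a j)) * F (a j) q) \<in> S" by (rule cmult)
      moreover have "M choose a j > 0" using M by (simp add: zero_less_binomial)
      moreover have "M - a j = (\<Sum>i\<in>- insert j I. a i)" using M by simp
      ultimately show "(\<lambda>q. u q * (\<Prod>i\<in>insert j I. (fst q $ i) ^ a i) * (\<xi> \<bullet> fst q) ^ (\<Sum>i\<in>- insert j I. a i)) \<in> S"
        using insert by (simp add: F_def mult_ac)
    qed
  qed
  from this[of UNIV] show ?thesis by simp
qed

section \<open>Quadratic substitutions, Gamma integrals and Gaussian integrability\<close>

text \<open>Continuity from below of the measure with density \<open>F\<close>. It carries the
  substitution rule from compact intervals to half-lines.\<close>

lemma nn_integral_Union_Icc: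
  fixes F :: "real \<Rightarrow> ennreal"
  assumes [measurable]: "F \<in> borel_measurable borel"
    and b: "incseq b" "filterlim b at_top sequentially"
  shows "(\<integral>\<^sup>+v. F v * indicator {a..} v \<partial>lborel) = (SUP n. \<integral>\<^sup>+v. F v * indicator {a..b n} v \<partial>lborel)"
proof -
  have U: "{a..} = (\<Union>n. {a..b n})"
  proof (intro equalityI subsetI)
    fix x assume x: "x \<in> {a..}"
    have "eventually (\<lambda>n. b n \<ge> x) sequentially"
      using b(2) by (auto simp: filterlim_at_top)
    then show "x \<in> (\<Union>n. {a..b n})"
      using x by (auto simp: eventually_sequentially)
  qed auto
  have "(\<integral>\<^sup>+v. F v * indicator {a..} v \<partial>lborel) = emeasure (density lborel F) (\<Union>n. {a..b n})"
    unfolding U[symmetric] by (simp add: emeasure_density)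
  also have "\<dots> = (SUP n. emeasure (density lborel F) {a..b n})"
    using b(1) by (intro SUP_emeasure_incseq[symmetric])
      (auto simp: incseq_def intro: order_trans)
  also have "\<dots> = (SUP n. \<integral>\<^sup>+v. F v * indicator {a..b n} v \<partial>lborel)"
    by (simp add: emeasure_density)
  finally show ?thesis .
qed

lemma nn_integral_square_substitution:
  fixes f :: "real \<Rightarrow> real"
  assumes [measurable]: "f \<in> borel_measurable borel" and a: "a \<ge> 0"
  shows "(\<integral>\<^sup>+s. ennreal (f (s\<^sup>2 - a\<^sup>2) * (2 * s)) * indicator {a..} s \<partial>lborel) =
    (\<integral>\<^sup>+v. ennreal (f v) * indicator {0..} v \<partial>lborel)"
proof -
  have step: "(\<integral>\<^sup>+v. ennreal (f v) * indicator {0..(a + real n)\<^sup>2 - a\<^sup>2} v \<partial>lborel) =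
    (\<integral>\<^sup>+s. ennreal (f (s\<^sup>2 - a\<^sup>2) * (2 * s)) * indicator {a..a + real n} s \<partial>lborel)" for n
  proof -
    have "(\<integral>\<^sup>+v. f v * indicator {a\<^sup>2 - a\<^sup>2..(a + real n)\<^sup>2 - a\<^sup>2} v \<partial>lborel) =
      (\<integral>\<^sup>+s. f (s\<^sup>2 - a\<^sup>2) * (2 * s) * indicator {a..a + real n} s \<partial>lborel)"
      using a by (intro nn_integral_substitution)
        (auto intro!: derivative_eq_intros continuous_intros borel_measurable_indicator
          simp: set_borel_measurable_def)
    then show ?thesis by (simp add: ennreal_mult'' ennreal_indicator)
  qed
  have "(\<integral>\<^sup>+v. ennreal (f v) * indicator {0..} v \<partial>lborel) =
    (SUP n. \<integral>\<^sup>+v. ennreal (f v) * indicator {0..(a + real n)\<^sup>2 - a\<^sup>2} v \<partial>lborel)"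
  proof (rule nn_integral_Union_Icc)
    show "incseq (\<lambda>n. (a + real n)\<^sup>2 - a\<^sup>2)"
      using a by (auto simp: incseq_def intro!: power_mono)
    have "filterlim (\<lambda>n. real n) at_top sequentially"
      by (rule filterlim_real_sequentially)
    then show "filterlim (\<lambda>n. (a + real n)\<^sup>2 - a\<^sup>2) at_top sequentially"
    proof (rule filterlim_at_top_mono)
      have "real n \<le> (a + real n)\<^sup>2 - a\<^sup>2" for n
      proof (cases n)
        case (Suc m)
        have "0 \<le> 2 * (a * real n)" using a by simp
        moreover have "real n \<le> real n * real n" using Suc by simp
        ultimately show ?thesis by (simp add: power2_eq_square algebra_simps)
      qed simp
      then show "\<forall>\<^sub>F n in sequentially. real n \<le> (a + real n)\<^sup>2 - a\<^sup>2" by simp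
    qed
  qed measurable
  also have "\<dots> = (SUP n. \<integral>\<^sup>+s. ennreal (f (s\<^sup>2 - a\<^sup>2) * (2 * s)) * indicator {a..a + real n} s \<partial>lborel)"
    unfolding step ..
  also have "\<dots> = (\<integral>\<^sup>+s. ennreal (f (s\<^sup>2 - a\<^sup>2) * (2 * s)) * indicator {a..} s \<partial>lborel)"
    by (rule nn_integral_Union_Icc[symmetric])
      (auto simp: incseq_def intro!: filterlim_tendsto_add_at_top[OF tendsto_const] filterlim_real_sequentially)
  finally show ?thesis ..
qed

text \<open>The half-lines \<open>s \<ge> a\<close> and \<open>s \<le> - a\<close> contribute
  equally, which supplies the \<open>2\<close> in the derivative of
  \<open>v = s\<^sup>2 - a\<^sup>2\<close>. For \<open>a = 0\<close> they share the point
  \<open>0\<close>, where the integrand is zero.\<close>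

lemma nn_integral_abs_square_substitution:
  fixes f :: "real \<Rightarrow> real"
  assumes [measurable]: "f \<in> borel_measurable borel" and f: "\<And>v. f v \<ge> 0" and a: "a \<ge> 0"
  shows "(\<integral>\<^sup>+s. ennreal (\<bar>s\<bar> * f (s\<^sup>2 - a\<^sup>2)) * indicator {s. a \<le> \<bar>s\<bar>} s \<partial>lborel) =
    (\<integral>\<^sup>+v. ennreal (f v) * indicator {0..} v \<partial>lborel)"
proof -
  define F where "F s = ennreal (\<bar>s\<bar> * f (s\<^sup>2 - a\<^sup>2)) * indicator {a..} s" for s
  have [measurable]: "F \<in> borel_measurable borel"
    unfolding F_def by measurable
  have "(\<integral>\<^sup>+s. ennreal (\<bar>s\<bar> * f (s\<^sup>2 - a\<^sup>2)) * indicator {s. a \<le> \<bar>s\<bar>} s \<partial>lborel) =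
    (\<integral>\<^sup>+s. F s + F (- s) \<partial>lborel)"
  proof (intro nn_integral_cong)
    fix s :: real
    show "ennreal (\<bar>s\<bar> * f (s\<^sup>2 - a\<^sup>2)) * indicator {s. a \<le> \<bar>s\<bar>} s = F s + F (- s)"
      using a by (cases "s = 0") (auto simp: F_def split: split_indicator)
  qed
  also have "\<dots> = (\<integral>\<^sup>+s. F s \<partial>lborel) + (\<integral>\<^sup>+s. F (- s) \<partial>lborel)"
    by (rule nn_integral_add) measurable
  also have "(\<integral>\<^sup>+s. F (- s) \<partial>lborel) = (\<integral>\<^sup>+s. F s \<partial>lborel)"
    using nn_integral_real_affine[of F "-1" 0] by simp
  also have "(\<integral>\<^sup>+s. F s \<partial>lborel) + (\<integral>\<^sup>+s. F s \<partial>lborel) = (\<integral>\<^sup>+s. F s + F s \<partial>lborel)"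
    by (rule nn_integral_add[symmetric]) measurable
  also have "\<dots> = (\<integral>\<^sup>+s. ennreal (f (s\<^sup>2 - a\<^sup>2) * (2 * s)) * indicator {a..} s \<partial>lborel)"
  proof (intro nn_integral_cong)
    fix s :: real
    show "F s + F s = ennreal (f (s\<^sup>2 - a\<^sup>2) * (2 * s)) * indicator {a..} s"
    proof (cases "s \<ge> a")
      case True
      then have "\<bar>s\<bar> = s" using a by simp
      have "ennreal (s * f (s\<^sup>2 - a\<^sup>2)) + ennreal (s * f (s\<^sup>2 - a\<^sup>2)) =
        ennreal (s * f (s\<^sup>2 - a\<^sup>2) + s * f (s\<^sup>2 - a\<^sup>2))"
        using True a f by (intro ennreal_plus[symmetric]) auto
      also have "s * f (s\<^sup>2 - a\<^sup>2) + s * f (s\<^sup>2 - a\<^sup>2) = f (s\<^sup>2 - a\<^sup>2) * (2 * s)"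
        by simp
      finally show ?thesis using True a by (simp add: F_def)
    qed (simp add: F_def)
  qed
  finally show ?thesis
    using nn_integral_square_substitution[OF assms(1) a] by simp
qed

lemma nn_integral_Gamma:
  assumes "c > 0"
  shows "(\<integral>\<^sup>+v. ennreal (v powr (c - 1) * exp (- v)) * indicator {0..} v \<partial>lborel) = ennreal (Gamma c)"
  unfolding Gamma_conv_nn_integral_real[OF assms]
  by (intro nn_integral_cong) (auto simp: exp_minus divide_inverse split: split_indicator)

lemma nn_integral_gaussian_moment:
  assumes "c > 0"
  shows "(\<integral>\<^sup>+t. ennreal (\<bar>t\<bar> powr (2 * c - 1) * exp (- t\<^sup>2)) \<partial>lborel) = ennreal (Gamma c)"
proof -
  have "\<bar>t\<bar> powr (2 * c - 1) = \<bar>t\<bar> * (t\<^sup>2) powr (c - 1)" for t :: real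
  proof (cases "t = 0")
    case False
    have "t\<^sup>2 = \<bar>t\<bar> powr 2" by simp
    then have 1: "(t\<^sup>2) powr (c - 1) = \<bar>t\<bar> powr (2 * (c - 1))"
      by (simp only: powr_powr)
    have "2 * c - 1 = 1 + 2 * (c - 1)" by simp
    then have "\<bar>t\<bar> powr (2 * c - 1) = \<bar>t\<bar> powr 1 * \<bar>t\<bar> powr (2 * (c - 1))"
      by (simp only: powr_add)
    then show ?thesis unfolding 1 by simp
  qed simp
  then have "(\<integral>\<^sup>+t. ennreal (\<bar>t\<bar> powr (2 * c - 1) * exp (- t\<^sup>2)) \<partial>lborel) =
    (\<integral>\<^sup>+t. ennreal (\<bar>t\<bar> * ((t\<^sup>2 - 0\<^sup>2) powr (c - 1) * exp (- (t\<^sup>2 - 0\<^sup>2)))) * indicator {t. 0 \<le> \<bar>t\<bar>} t \<partial>lborel)"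
    by (intro nn_integral_cong) (simp add: mult.assoc)
  also have "\<dots> = ennreal (Gamma c)"
    by (subst nn_integral_abs_square_substitution[where f = "\<lambda>v. v powr (c - 1) * exp (- v)"])
      (use nn_integral_Gamma[OF assms] in auto)
  finally show ?thesis .
qed

lemma nn_integral_cone_fibre:
  assumes "c > 0" and a: "a \<ge> 0"
  shows "(\<integral>\<^sup>+t. ennreal (\<bar>t\<bar> * exp (- t\<^sup>2) * (t\<^sup>2 - a\<^sup>2) powr (c - 1)) * indicator {t. a \<le> \<bar>t\<bar>} t \<partial>lborel) =
    ennreal (exp (- a\<^sup>2) * Gamma c)"
proof -
  define f where "f v = exp (- a\<^sup>2) * (v powr (c - 1) * exp (- v))" for v
  have [measurable]: "f \<in> borel_measurable borel" unfolding f_def by measurable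
  have "(\<integral>\<^sup>+t. ennreal (\<bar>t\<bar> * exp (- t\<^sup>2) * (t\<^sup>2 - a\<^sup>2) powr (c - 1)) * indicator {t. a \<le> \<bar>t\<bar>} t \<partial>lborel) =
    (\<integral>\<^sup>+t. ennreal (\<bar>t\<bar> * f (t\<^sup>2 - a\<^sup>2)) * indicator {t. a \<le> \<bar>t\<bar>} t \<partial>lborel)"
  proof (intro nn_integral_cong)
    fix t :: real
    have "exp (- t\<^sup>2) = exp (- a\<^sup>2) * exp (- (t\<^sup>2 - a\<^sup>2))" by (simp flip: exp_add)
    then show "ennreal (\<bar>t\<bar> * exp (- t\<^sup>2) * (t\<^sup>2 - a\<^sup>2) powr (c - 1)) * indicator {t. a \<le> \<bar>t\<bar>} t =
      ennreal (\<bar>t\<bar> * f (t\<^sup>2 - a\<^sup>2)) * indicator {t. a \<le> \<bar>t\<bar>} t"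
      by (simp add: f_def mult_ac)
  qed
  also have "\<dots> = (\<integral>\<^sup>+v. ennreal (f v) * indicator {0..} v \<partial>lborel)"
    by (rule nn_integral_abs_square_substitution) (auto simp: f_def a)
  also have "\<dots> = ennreal (exp (- a\<^sup>2)) * (\<integral>\<^sup>+v. ennreal (v powr (c - 1) * exp (- v)) * indicator {0..} v \<partial>lborel)"
    by (subst nn_integral_cmult[symmetric]) (simp_all add: f_def ennreal_mult' mult.assoc)
  also have "\<dots> = ennreal (exp (- a\<^sup>2) * Gamma c)"
    unfolding nn_integral_Gamma[OF assms(1)] by (simp add: ennreal_mult')
  finally show ?thesis .
qed

lemma nn_integral_exp_neg_sq: "(\<integral>\<^sup>+t. ennreal (exp (- t\<^sup>2)) \<partial>lborel) = ennreal (Gamma (1 / 2))"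
proof -
  have "(\<integral>\<^sup>+t. ennreal (exp (- t\<^sup>2)) \<partial>lborel) =
    (\<integral>\<^sup>+t. ennreal (\<bar>t\<bar> powr (2 * (1 / 2) - 1) * exp (- t\<^sup>2)) \<partial>lborel)"
    \<comment> \<open>The integrands differ at \<open>t = 0\<close>, because
      \<open>0 powr 0 = 0\<close>.\<close>
    by (intro nn_integral_cong_AE eventually_mono[OF AE_lborel_singleton[of 0]]) simp
  also have "\<dots> = ennreal (Gamma (1 / 2))"
    by (rule nn_integral_gaussian_moment) simp
  finally show ?thesis .
qed

lemma integrable_exp_neg_norm_sq:
  assumes c: "c > 0"
  shows "integrable lborel (\<lambda>x :: 'a :: euclidean_space. exp (- c * (norm x)\<^sup>2))"
proof (rule integrableI_bounded)
  have "(\<integral>\<^sup>+t. ennreal (exp (- c * t\<^sup>2)) \<partial>lborel) < \<infinity>"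
  proof -
    have "(\<integral>\<^sup>+t. ennreal (exp (- t\<^sup>2)) \<partial>lborel) =
      ennreal \<bar>sqrt c\<bar> * (\<integral>\<^sup>+t. ennreal (exp (- (0 + sqrt c * t)\<^sup>2)) \<partial>lborel)"
      by (rule nn_integral_real_affine) (use c in auto)
    then have "ennreal (sqrt c) * (\<integral>\<^sup>+t. ennreal (exp (- c * t\<^sup>2)) \<partial>lborel) = ennreal (Gamma (1 / 2))"
      using c unfolding nn_integral_exp_neg_sq by (simp add: power_mult_distrib)
    then have "ennreal (sqrt c) * (\<integral>\<^sup>+t. ennreal (exp (- c * t\<^sup>2)) \<partial>lborel) < \<infinity>"
      by simp
    then show ?thesis
      using c by (auto simp: ennreal_mult_less_top)
  qed
  then have fin: "(\<Prod>b\<in>(Basis :: 'a set). (\<integral>\<^sup>+t. ennreal (exp (- c * t\<^sup>2)) \<partial>lborel)) < \<infinity>"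
    by (simp add: power_less_top_ennreal)
  have "exp (- c * (norm x)\<^sup>2) = (\<Prod>b\<in>Basis. exp (- c * (x \<bullet> b)\<^sup>2))" for x :: 'a
  proof -
    have "(norm x)\<^sup>2 = (\<Sum>b\<in>Basis. (x \<bullet> b)\<^sup>2)"
      unfolding power2_norm_eq_inner euclidean_inner[of x x] by (simp add: power2_eq_square)
    then show ?thesis by (simp add: exp_sum sum_distrib_left)
  qed
  then have "(\<integral>\<^sup>+x. ennreal (norm (exp (- c * (norm x)\<^sup>2))) \<partial>(lborel :: 'a measure)) =
    (\<integral>\<^sup>+x. (\<Prod>b\<in>Basis. ennreal (exp (- c * (x \<bullet> b)\<^sup>2))) \<partial>(lborel :: 'a measure))"
    by (simp add: prod_ennreal abs_prod)
  also have "\<dots> = (\<Prod>b\<in>(Basis :: 'a set). (\<integral>\<^sup>+t. ennreal (exp (- c * t\<^sup>2)) \<partial>lborel))"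
    by (rule nn_integral_lborel_prod) auto
  finally show "(\<integral>\<^sup>+x. ennreal (norm (exp (- c * (norm x)\<^sup>2))) \<partial>(lborel :: 'a measure)) < \<infinity>"
    using fin by simp
qed simp

section \<open>Gaussian moments of powers of linear forms\<close>

lemma powser_eq_0:
  fixes a :: "nat \<Rightarrow> real"
  assumes "\<And>c. (\<lambda>k. a k * c ^ k) sums 0"
  shows "a n = 0"
  using assms
proof (induction n arbitrary: a)
  case 0
  then show ?case using powser_sums_zero_iff[of a 0] by blast
next
  case (Suc n)
  have a0: "a 0 = 0" using Suc.prems[of 0] powser_sums_zero_iff[of a 0] by blast
  have 1: "(\<lambda>k. a (Suc k) * c ^ k) sums 0" if "c \<noteq> 0" for c
  proof -
    have "(\<lambda>k. a (Suc k) * c ^ Suc k) sums 0"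
      using Suc.prems[of c] a0 by (subst sums_Suc_iff) simp
    then have "(\<lambda>k. (a (Suc k) * c ^ Suc k) * inverse c) sums (0 * inverse c)"
      by (rule sums_mult2)
    then show ?thesis using that by (simp add: field_simps)
  qed
  have "((\<lambda>_ :: real. 0 :: real) \<longlongrightarrow> a (Suc 0)) (at 0)"
    using powser_limit_0_strong[where s = 1 and a = "\<lambda>k. a (Suc k)" and f = "\<lambda>_. 0"] 1 by simp
  then have "a (Suc 0) = 0"
    by (simp add: tendsto_const_iff)
  then have "(\<lambda>k. a (Suc k) * c ^ k) sums 0" for c
    using 1[of c] powser_sums_zero_iff[of "\<lambda>k. a (Suc k)" 0] by (cases "c = 0") auto
  then show ?case using Suc.IH[of "\<lambda>k. a (Suc k)"] by simp
qed

lemma powser_unique: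
  fixes a b :: "nat \<Rightarrow> real"
  assumes "\<And>c. (\<lambda>k. a k * c ^ k) sums f c" "\<And>c. (\<lambda>k. b k * c ^ k) sums f c"
  shows "a n = b n"
proof -
  have "(\<lambda>k. (a k - b k) * c ^ k) sums 0" for c
    using sums_diff[OF assms(1)[of c] assms(2)[of c]] by (simp add: algebra_simps)
  then show ?thesis using powser_eq_0[of "\<lambda>k. a k - b k"] by simp
qed

lemma power_div_fact_le_exp:
  fixes u :: real
  assumes "u \<ge> 0"
  shows "u ^ n / fact n \<le> exp u"
proof -
  have "(\<Sum>i\<in>{n}. u ^ i /\<^sub>R fact i) \<le> (\<Sum>i. u ^ i /\<^sub>R fact i)"
    by (rule sum_le_suminf[OF summable_exp_generic]) (use assms in auto)
  then show ?thesis by (simp add: exp_def divide_inverse mult.commute)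
qed

lemma integrable_gaussian_mult:
  fixes Q :: "'a :: euclidean_space \<Rightarrow> real"
  assumes [measurable]: "Q \<in> borel_measurable borel" and Q: "\<And>y. \<bar>Q y\<bar> \<le> exp (c * norm y)"
  shows "integrable lborel (\<lambda>y. Q y * exp (- (norm y)\<^sup>2))"
proof (rule Bochner_Integration.integrable_bound)
  show "integrable lborel (\<lambda>y :: 'a. exp (c\<^sup>2 / 2) * exp (- (1 / 2) * (norm y)\<^sup>2))"
    by (intro integrable_mult_right integrable_exp_neg_norm_sq) simp
  show "AE y in lborel. norm (Q y * exp (- (norm y)\<^sup>2)) \<le> norm (exp (c\<^sup>2 / 2) * exp (- (1 / 2) * (norm y)\<^sup>2))"
  proof (intro AE_I2)
    fix y :: 'a
    have "0 \<le> (c - norm y)\<^sup>2 / 2" by simp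
    then have "c * norm y - (norm y)\<^sup>2 \<le> c\<^sup>2 / 2 - (1 / 2) * (norm y)\<^sup>2"
      by (simp add: power2_eq_square algebra_simps)
    then have "exp (c * norm y) * exp (- (norm y)\<^sup>2) \<le> exp (c\<^sup>2 / 2) * exp (- (1 / 2) * (norm y)\<^sup>2)"
      by (simp flip: exp_add)
    moreover have "\<bar>Q y\<bar> * exp (- (norm y)\<^sup>2) \<le> exp (c * norm y) * exp (- (norm y)\<^sup>2)"
      using Q by (intro mult_right_mono) auto
    ultimately have "\<bar>Q y\<bar> * exp (- (norm y)\<^sup>2) \<le> exp (c\<^sup>2 / 2) * exp (- (1 / 2) * (norm y)\<^sup>2)"
      by (rule order_trans[rotated])
    then show "norm (Q y * exp (- (norm y)\<^sup>2)) \<le> norm (exp (c\<^sup>2 / 2) * exp (- (1 / 2) * (norm y)\<^sup>2))"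
      by (simp add: abs_mult)
  qed
qed simp

text \<open>The degree-\<open>n\<close> term of \<open>exp (2 * (x \<bullet> y))\<close>. The factor
  \<open>2\<close> is the one that completes the square against
  \<open>exp (- (norm y)\<^sup>2)\<close>, and the factorial turns binomial expansions into plain
  convolutions.\<close>

definition lpow :: "'a :: real_inner \<Rightarrow> nat \<Rightarrow> 'a \<Rightarrow> real" where
  "lpow x n y = (2 * (x \<bullet> y)) ^ n / fact n"

definition gauss_moment :: "'a :: euclidean_space \<Rightarrow> nat \<Rightarrow> 'a \<Rightarrow> nat \<Rightarrow> real" where
  "gauss_moment x l \<xi> j = (\<integral>y. lpow x l y * lpow \<xi> j y * exp (- (norm y)\<^sup>2) \<partial>lborel)"

lemma lpow_borel [measurable]: "lpow (x :: 'a :: euclidean_space) n \<in> borel_measurable borel"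
  unfolding lpow_def by measurable

lemma abs_lpow_le: "\<bar>lpow x n y\<bar> \<le> exp (2 * norm x * norm y)"
proof -
  have "\<bar>lpow x n y\<bar> = (2 * \<bar>x \<bullet> y\<bar>) ^ n / fact n"
    by (simp add: lpow_def power_abs abs_mult)
  also have "\<dots> \<le> (2 * (norm x * norm y)) ^ n / fact n"
    by (intro divide_right_mono power_mono mult_left_mono Cauchy_Schwarz_ineq2) auto
  also have "\<dots> \<le> exp (2 * (norm x * norm y))"
    by (rule power_div_fact_le_exp) simp
  finally show ?thesis by (simp add: mult.assoc)
qed

lemma integrable_lpow_lpow_gaussian:
  "integrable lborel (\<lambda>y :: 'a :: euclidean_space. lpow x l y * lpow \<xi> j y * exp (- (norm y)\<^sup>2))"
proof (rule integrable_gaussian_mult[where c = "2 * norm x + 2 * norm \<xi>"])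
  fix y :: 'a
  have "\<bar>lpow x l y * lpow \<xi> j y\<bar> \<le> exp (2 * norm x * norm y) * exp (2 * norm \<xi> * norm y)"
    unfolding abs_mult by (intro mult_mono abs_lpow_le) auto
  then show "\<bar>lpow x l y * lpow \<xi> j y\<bar> \<le> exp ((2 * norm x + 2 * norm \<xi>) * norm y)"
    by (simp add: exp_add[symmetric] distrib_right)
qed measurable

lemma lpow_add: "lpow \<xi> j (u + v) = (\<Sum>k\<le>j. lpow \<xi> k u * lpow \<xi> (j - k) v)"
proof -
  have "lpow \<xi> j (u + v) = (\<Sum>k\<le>j. real (j choose k) * (2 * (\<xi> \<bullet> u)) ^ k * (2 * (\<xi> \<bullet> v)) ^ (j - k)) / fact j"
    unfolding lpow_def inner_add_right distrib_left binomial_ring ..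
  also have "\<dots> = (\<Sum>k\<le>j. lpow \<xi> k u * lpow \<xi> (j - k) v)"
    unfolding sum_divide_distrib
  proof (intro sum.cong refl)
    fix k assume "k \<in> {..j}"
    then have "real (j choose k) / fact j = 1 / (fact k * fact (j - k))"
      by (simp add: binomial_fact)
    then have "real (j choose k) / fact j * ((2 * (\<xi> \<bullet> u)) ^ k * (2 * (\<xi> \<bullet> v)) ^ (j - k)) =
      lpow \<xi> k u * lpow \<xi> (j - k) v"
      by (simp add: lpow_def)
    then show "real (j choose k) * (2 * (\<xi> \<bullet> u)) ^ k * (2 * (\<xi> \<bullet> v)) ^ (j - k) / fact j =
      lpow \<xi> k u * lpow \<xi> (j - k) v"
      by (simp add: mult.assoc)
  qed
  finally show ?thesis .
qed

text \<open>Both sides are the coefficient of \<open>c ^ l\<close> in the Gaussian integral of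
  \<open>exp (2 * c * (x \<bullet> y)) * lpow \<xi> j y\<close>. Expanding the exponential gives the
  left side. The translation \<open>y = c *\<^sub>R x + z\<close> completes the square, leaving
  \<open>exp ((c * norm x)\<^sup>2)\<close> times an expansion of
  \<open>lpow \<xi> j (c *\<^sub>R x + z)\<close>, which gives the right side.\<close>

lemma gauss_moment_rec:
  "gauss_moment x l \<xi> j = (\<Sum>k\<le>j. if k \<le> l \<and> even (l - k)
     then norm x ^ (l - k) / fact ((l - k) div 2) * lpow \<xi> k x * gauss_moment 0 0 \<xi> (j - k) else 0)"
proof (rule powser_unique[where a = "\<lambda>l. gauss_moment x l \<xi> j" and n = l and
    f = "\<lambda>c. \<integral>y. exp (2 * c * (x \<bullet> y)) * lpow \<xi> j y * exp (- (norm y)\<^sup>2) \<partial>lborel"])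
  fix c :: real
  let ?f = "\<lambda>y. exp (2 * c * (x \<bullet> y)) * lpow \<xi> j y * exp (- (norm y)\<^sup>2)"
  define f where "f = ?f"
  have term_eq: "lpow x k y * c ^ k = (2 * c * (x \<bullet> y)) ^ k /\<^sub>R fact k" for k y
    by (simp add: lpow_def power_mult_distrib divide_inverse mult_ac)
  have exp_sums: "(\<lambda>k. lpow x k y * c ^ k) sums exp (2 * c * (x \<bullet> y))" for y
    unfolding term_eq by (rule exp_converges)
  show "(\<lambda>k. gauss_moment x k \<xi> j * c ^ k) sums (\<integral>y. ?f y \<partial>lborel)"
  proof -
    define F where "F k y = lpow x k y * c ^ k * lpow \<xi> j y * exp (- (norm y)\<^sup>2)" for k y
    have int: "integrable lborel (F k)" for k
      using integrable_mult_left[OF integrable_lpow_lpow_gaussian[of x k \<xi> j], of "c ^ k"]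
      unfolding F_def by (simp add: mult_ac)
    have F_sums: "(\<lambda>k. F k y) sums f y" for y
      unfolding F_def f_def by (intro sums_mult2 exp_sums)
    have norm_eq: "norm (F k y) = (2 * \<bar>c\<bar> * \<bar>x \<bullet> y\<bar>) ^ k /\<^sub>R fact k * \<bar>lpow \<xi> j y\<bar> * exp (- (norm y)\<^sup>2)" for k y
      unfolding F_def term_eq by (simp add: abs_mult power_abs power_mult_distrib)
    have norm_sums: "(\<lambda>k. norm (F k y)) sums (exp (2 * \<bar>c\<bar> * \<bar>x \<bullet> y\<bar>) * \<bar>lpow \<xi> j y\<bar> * exp (- (norm y)\<^sup>2))" for y
      unfolding norm_eq by (intro sums_mult2 exp_converges)
    \<comment> \<open>This function dominates all partial sums of the norms, so the series may be
      integrated term by term.\<close>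
    have int_bound: "integrable lborel (\<lambda>y. exp (2 * \<bar>c\<bar> * \<bar>x \<bullet> y\<bar>) * \<bar>lpow \<xi> j y\<bar> * exp (- (norm y)\<^sup>2))"
    proof (rule integrable_gaussian_mult[where c = "2 * \<bar>c\<bar> * norm x + 2 * norm \<xi>"])
      fix y :: 'a
      have "\<bar>exp (2 * \<bar>c\<bar> * \<bar>x \<bullet> y\<bar>) * \<bar>lpow \<xi> j y\<bar>\<bar> \<le>
          exp (2 * \<bar>c\<bar> * (norm x * norm y)) * exp (2 * norm \<xi> * norm y)"
        unfolding abs_mult abs_idempotent
        by (intro mult_mono abs_lpow_le) (auto intro!: mult_left_mono Cauchy_Schwarz_ineq2)
      then show "\<bar>exp (2 * \<bar>c\<bar> * \<bar>x \<bullet> y\<bar>) * \<bar>lpow \<xi> j y\<bar>\<bar> \<le>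
          exp ((2 * \<bar>c\<bar> * norm x + 2 * norm \<xi>) * norm y)"
        by (simp add: exp_add[symmetric] algebra_simps)
    qed measurable
    have "(\<lambda>k. integral\<^sup>L lborel (F k)) sums (\<integral>y. (\<Sum>k. F k y) \<partial>lborel)"
    proof (rule sums_integral[OF int])
      show "AE y in lborel. summable (\<lambda>k. norm (F k y))"
        using norm_sums by (auto simp: sums_iff)
      show "summable (\<lambda>k. \<integral>y. norm (F k y) \<partial>lborel)"
      proof (rule summableI_nonneg_bounded)
        fix n
        have "(\<Sum>k<n. \<integral>y. norm (F k y) \<partial>lborel) = (\<integral>y. (\<Sum>k<n. norm (F k y)) \<partial>lborel)"
          using int by (intro Bochner_Integration.integral_sum[symmetric]) auto
        also have "\<dots> \<le> (\<integral>y. exp (2 * \<bar>c\<bar> * \<bar>x \<bullet> y\<bar>) * \<bar>lpow \<xi> j y\<bar> * exp (- (norm y)\<^sup>2) \<partial>lborel)"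
          using int int_bound norm_sums
          by (intro integral_mono Bochner_Integration.integrable_sum)
            (auto simp: sums_iff intro!: sum_le_suminf[THEN order_trans])
        finally show "(\<Sum>k<n. \<integral>y. norm (F k y) \<partial>lborel) \<le>
          (\<integral>y. exp (2 * \<bar>c\<bar> * \<bar>x \<bullet> y\<bar>) * \<bar>lpow \<xi> j y\<bar> * exp (- (norm y)\<^sup>2) \<partial>lborel)" .
      qed simp
    qed
    also have "(\<lambda>y. \<Sum>k. F k y) = f"
      using F_sums by (auto simp: sums_iff)
    also have "(\<lambda>k. integral\<^sup>L lborel (F k)) = (\<lambda>k. gauss_moment x k \<xi> j * c ^ k)"
      unfolding F_def gauss_moment_def
      by (intro ext, subst integral_mult_left_zero[symmetric]) (simp add: mult_ac)
    finally show ?thesis unfolding f_def .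
  qed
  show "(\<lambda>l. (\<Sum>k\<le>j. if k \<le> l \<and> even (l - k)
     then norm x ^ (l - k) / fact ((l - k) div 2) * lpow \<xi> k x * gauss_moment 0 0 \<xi> (j - k) else 0) * c ^ l)
     sums (\<integral>y. ?f y \<partial>lborel)"
  proof -
    have "(\<lambda>l. \<Sum>k\<le>j. if k \<le> l \<and> even (l - k)
       then norm x ^ (l - k) / fact ((l - k) div 2) * lpow \<xi> k x * gauss_moment 0 0 \<xi> (j - k) * c ^ l else 0)
       sums (\<Sum>k\<le>j. exp ((c * norm x)\<^sup>2) * (c ^ k * lpow \<xi> k x * gauss_moment 0 0 \<xi> (j - k)))"
    proof (rule sums_sum)
      fix k
      \<comment> \<open>The exponents of \<open>c\<close> that occur are \<open>k\<close> plus even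
        numbers, so the exponential series of \<open>(c * norm x)\<^sup>2\<close> is spread over the
        range of \<open>g\<close> and filled with zeros elsewhere.\<close>
      define g where "g i = k + 2 * i" for i :: nat
      have "(\<lambda>i. ((c * norm x)\<^sup>2) ^ i /\<^sub>R fact i * (c ^ k * lpow \<xi> k x * gauss_moment 0 0 \<xi> (j - k)))
        sums (exp ((c * norm x)\<^sup>2) * (c ^ k * lpow \<xi> k x * gauss_moment 0 0 \<xi> (j - k)))"
        by (intro sums_mult2 exp_converges)
      also have "(\<lambda>i. ((c * norm x)\<^sup>2) ^ i /\<^sub>R fact i * (c ^ k * lpow \<xi> k x * gauss_moment 0 0 \<xi> (j - k))) =
        (\<lambda>i. (\<lambda>l. if k \<le> l \<and> even (l - k)
         then norm x ^ (l - k) / fact ((l - k) div 2) * lpow \<xi> k x * gauss_moment 0 0 \<xi> (j - k) * c ^ l else 0) (g i))"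
        by (intro ext) (simp add: g_def power_add power_mult_distrib divide_inverse mult_ac flip: power_mult)
      finally show "(\<lambda>l. if k \<le> l \<and> even (l - k)
         then norm x ^ (l - k) / fact ((l - k) div 2) * lpow \<xi> k x * gauss_moment 0 0 \<xi> (j - k) * c ^ l else 0) sums
         (exp ((c * norm x)\<^sup>2) * (c ^ k * lpow \<xi> k x * gauss_moment 0 0 \<xi> (j - k)))"
      proof (subst (asm) sums_mono_reindex)
        show "strict_mono g" by (auto simp: g_def strict_mono_def)
        fix n assume n: "n \<notin> range g"
        have "\<not> (k \<le> n \<and> even (n - k))"
        proof
          assume a: "k \<le> n \<and> even (n - k)"
          then have "n = g ((n - k) div 2)" by (auto simp: g_def)
          then show False using n by blast
        qed
        then show "(if k \<le> n \<and> even (n - k)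
         then norm x ^ (n - k) / fact ((n - k) div 2) * lpow \<xi> k x * gauss_moment 0 0 \<xi> (j - k) * c ^ n else 0) = 0"
          by auto
      qed
    qed
    moreover have "(\<Sum>k\<le>j. exp ((c * norm x)\<^sup>2) * (c ^ k * lpow \<xi> k x * gauss_moment 0 0 \<xi> (j - k))) =
      (\<integral>y. f y \<partial>lborel)"
    proof -
      have ls: "lpow \<xi> k (c *\<^sub>R x) = c ^ k * lpow \<xi> k x" for k
        by (simp add: lpow_def power_mult_distrib)
      have fe: "f (c *\<^sub>R x + z) = (\<Sum>k\<le>j. exp ((c * norm x)\<^sup>2) * (c ^ k * lpow \<xi> k x) *
        (lpow \<xi> (j - k) z * exp (- (norm z)\<^sup>2)))" for z
      proof -
        have "2 * c * (x \<bullet> (c *\<^sub>R x + z)) - (norm (c *\<^sub>R x + z))\<^sup>2 = (c * norm x)\<^sup>2 - (norm z)\<^sup>2"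
          unfolding power_mult_distrib power2_norm_eq_inner
          by (simp add: inner_add_left inner_add_right inner_commute power2_eq_square algebra_simps)
        then have e: "exp (2 * c * (x \<bullet> (c *\<^sub>R x + z))) * exp (- (norm (c *\<^sub>R x + z))\<^sup>2) =
          exp ((c * norm x)\<^sup>2) * exp (- (norm z)\<^sup>2)"
          by (simp flip: exp_add)
        have "f (c *\<^sub>R x + z) = (exp (2 * c * (x \<bullet> (c *\<^sub>R x + z))) * exp (- (norm (c *\<^sub>R x + z))\<^sup>2)) *
          lpow \<xi> j (c *\<^sub>R x + z)"
          by (simp add: f_def mult_ac)
        also have "\<dots> = (exp ((c * norm x)\<^sup>2) * exp (- (norm z)\<^sup>2)) *
          (\<Sum>k\<le>j. lpow \<xi> k (c *\<^sub>R x) * lpow \<xi> (j - k) z)"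
          unfolding e lpow_add ..
        finally show ?thesis by (simp add: ls sum_distrib_left mult_ac)
      qed
      have [measurable]: "f \<in> borel_measurable borel" unfolding f_def by measurable
      have int1: "integrable lborel (\<lambda>z. lpow \<xi> m z * exp (- (norm z)\<^sup>2))" for m
        using integrable_lpow_lpow_gaussian[of 0 0 \<xi> m] by (simp add: lpow_def[of _ 0])
      have "(\<integral>y. f y \<partial>lborel) = (\<integral>z. f (c *\<^sub>R x + z) \<partial>lborel)"
        by (subst lborel_distr_plus[of "c *\<^sub>R x", symmetric], subst integral_distr) auto
      also have "\<dots> = (\<Sum>k\<le>j. exp ((c * norm x)\<^sup>2) * (c ^ k * lpow \<xi> k x) *
        (\<integral>z. lpow \<xi> (j - k) z * exp (- (norm z)\<^sup>2) \<partial>lborel))"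
        unfolding fe
        by (subst Bochner_Integration.integral_sum) (auto intro!: integrable_mult_right int1)
      finally show ?thesis by (simp add: gauss_moment_def lpow_def mult_ac)
    qed
    moreover have "(\<Sum>k\<le>j. if k \<le> l \<and> even (l - k)
       then norm x ^ (l - k) / fact ((l - k) div 2) * lpow \<xi> k x * gauss_moment 0 0 \<xi> (j - k) else 0) * c ^ l =
      (\<Sum>k\<le>j. if k \<le> l \<and> even (l - k)
       then norm x ^ (l - k) / fact ((l - k) div 2) * lpow \<xi> k x * gauss_moment 0 0 \<xi> (j - k) * c ^ l else 0)" for l
      unfolding sum_distrib_right by (rule sum.cong) auto
    ultimately show ?thesis unfolding f_def by (simp only:)
  qed
qed

definition gauss_total :: "'a :: euclidean_space itself \<Rightarrow> real" where
  "gauss_total _ = (\<integral>y. exp (- (norm (y :: 'a))\<^sup>2) \<partial>lborel)"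

text \<open>\<open>gauss_moment_rec\<close> refers to these moments, yet it also determines them: a
  power of one form may be put in the first slot, and for \<open>j = 0\<close> the recursion
  involves nothing but the total Gaussian mass.\<close>

lemma gauss_moment_0_0:
  "gauss_moment 0 0 (\<xi> :: 'a :: euclidean_space) n =
    (if even n then norm \<xi> ^ n / fact (n div 2) * gauss_total TYPE('a) else 0)"
proof -
  have "gauss_moment 0 0 \<xi> n = gauss_moment \<xi> n \<xi> 0"
    unfolding gauss_moment_def lpow_def by simp
  also have "\<dots> = (if even n then norm \<xi> ^ n / fact (n div 2) * gauss_total TYPE('a) else 0)"
    by (subst gauss_moment_rec) (simp add: gauss_moment_def lpow_def gauss_total_def)
  finally show ?thesis .
qed

lemma gauss_total_pos: "gauss_total TYPE('a :: euclidean_space) > 0"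
proof -
  have int: "integrable lborel (\<lambda>y :: 'a. exp (- (norm y)\<^sup>2))"
    using integrable_exp_neg_norm_sq[of 1] by simp
  have "\<not> (AE y in (lborel :: 'a measure). exp (- (norm y)\<^sup>2) = 0)"
  proof
    assume "AE y in (lborel :: 'a measure). exp (- (norm y)\<^sup>2) = 0"
    then have "AE y in (lborel :: 'a measure). False" by simp
    then show False by (simp add: AE_iff_measurable[OF _ refl])
  qed
  then show ?thesis
    unfolding gauss_total_def
    using integral_nonneg_eq_0_iff_AE[OF int] Bochner_Integration.integral_nonneg[of lborel "\<lambda>y :: 'a. exp (- (norm y)\<^sup>2)"]
    by (metis (no_types, lifting) AE_I2 exp_ge_zero less_eq_real_def)
qed

section \<open>Integration over the cone: fibres and polar decomposition\<close>

definition cw :: "real \<Rightarrow> real \<Rightarrow> (real ^ 'd) \<times> real \<Rightarrow> real" where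
  "cw \<beta> \<mu> p = indicator double_cone p * cone_weight \<beta> \<mu> p"

definition h2 :: "(real ^ 'd) \<times> real \<Rightarrow> real" where
  "h2 p = (snd p)\<^sup>2 - (norm (fst p))\<^sup>2"

definition bw :: "real \<Rightarrow> real ^ 'd \<Rightarrow> real" where
  "bw \<mu> x = indicator (cball 0 1) x * (1 - (norm x)\<^sup>2) powr (\<mu> - 1 / 2)"

lemma fst_borel [measurable]: "(fst :: (real ^ 'd) \<times> real \<Rightarrow> _) \<in> borel_measurable borel"
  by (intro borel_measurable_continuous_onI continuous_intros)

lemma snd_borel [measurable]: "(snd :: (real ^ 'd) \<times> real \<Rightarrow> _) \<in> borel_measurable borel"
  by (intro borel_measurable_continuous_onI continuous_intros)

lemma double_cone_borel [measurable]: "(double_cone :: ((real ^ 'd) \<times> real) set) \<in> sets borel"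
proof -
  have "closed {p :: (real ^ 'd) \<times> real. norm (fst p) \<le> \<bar>snd p\<bar>}"
    by (intro closed_Collect_le continuous_intros)
  then have "{p :: (real ^ 'd) \<times> real. norm (fst p) \<le> \<bar>snd p\<bar>} \<in> sets borel"
    by (rule borel_closed)
  then show ?thesis by (simp add: double_cone_def case_prod_beta')
qed

lemma cw_nonneg: "cw \<beta> \<mu> p \<ge> 0"
  by (auto simp: cw_def cone_weight_def case_prod_beta split: split_indicator)

lemma bw_nonneg: "bw \<mu> x \<ge> 0"
  by (auto simp: bw_def split: split_indicator)

lemma cw_borel [measurable]: "(cw \<beta> \<mu> :: (real ^ 'd) \<times> real \<Rightarrow> real) \<in> borel_measurable borel"
proof -
  have "(\<lambda>p :: (real ^ 'd) \<times> real. indicator double_cone p * (\<bar>snd p\<bar> powr (2 * \<beta>) * exp (- (snd p)\<^sup>2) *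
    ((snd p)\<^sup>2 - (norm (fst p))\<^sup>2) powr (\<mu> - 1/2)) :: real) \<in> borel_measurable borel"
    by measurable
  then show ?thesis
    by (simp add: cw_def[abs_def] cone_weight_def case_prod_beta')
qed

lemma bw_borel [measurable]: "(bw \<mu> :: real ^ 'd \<Rightarrow> real) \<in> borel_measurable borel"
proof -
  have [measurable]: "cball 0 1 \<in> sets (borel :: (real ^ 'd) measure)"
    by (intro borel_closed closed_cball)
  show ?thesis unfolding bw_def[abs_def] by measurable
qed

lemma h2_borel [measurable]: "(h2 :: (real ^ 'd) \<times> real \<Rightarrow> real) \<in> borel_measurable borel"
  unfolding h2_def[abs_def] by measurable

lemma h2_power_cw:
  assumes "\<mu> \<ge> 0"
  shows "h2 (x, t) ^ i * cw (1 / 2) \<mu> (x, t) =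
    \<bar>t\<bar> * exp (- t\<^sup>2) * (t\<^sup>2 - (norm x)\<^sup>2) powr (real i + \<mu> + 1 / 2 - 1) * indicator {t. norm x \<le> \<bar>t\<bar>} t"
proof (cases "norm x \<le> \<bar>t\<bar>")
  case True
  then have le: "(norm x)\<^sup>2 \<le> t\<^sup>2"
    by (metis abs_ge_zero norm_ge_zero power2_abs power_mono)
  have "(t\<^sup>2 - (norm x)\<^sup>2) ^ i * (t\<^sup>2 - (norm x)\<^sup>2) powr (\<mu> - 1 / 2) =
    (t\<^sup>2 - (norm x)\<^sup>2) powr (real i + \<mu> + 1 / 2 - 1)"
  proof (cases "t\<^sup>2 - (norm x)\<^sup>2 = 0")
    case False
    then have "t\<^sup>2 - (norm x)\<^sup>2 > 0" using le by simp
    then show ?thesis by (simp add: powr_realpow[symmetric] powr_add[symmetric] add_diff_eq)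
  qed (simp add: power_0_left)
  moreover have "\<bar>t\<bar> powr (2 * (1 / 2)) = \<bar>t\<bar>" by simp
  ultimately show ?thesis
    using True by (simp add: cw_def cone_weight_def double_cone_def h2_def)
qed (simp add: cw_def double_cone_def)

lemma cone_fibre:
  fixes x :: "real ^ 'd"
  assumes "\<mu> \<ge> 0"
  shows "integrable lborel (\<lambda>t. h2 (x, t) ^ i * cw (1 / 2) \<mu> (x, t))"
    and "(\<integral>t. h2 (x, t) ^ i * cw (1 / 2) \<mu> (x, t) \<partial>lborel) = exp (- (norm x)\<^sup>2) * Gamma (real i + \<mu> + 1 / 2)"
proof -
  define F where "F t = h2 (x, t) ^ i * cw (1 / 2) \<mu> (x, t)" for t
  have F: "F t = \<bar>t\<bar> * exp (- t\<^sup>2) * (t\<^sup>2 - (norm x)\<^sup>2) powr (real i + \<mu> + 1 / 2 - 1) *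
      indicator {t. norm x \<le> \<bar>t\<bar>} t" for t
    unfolding F_def using h2_power_cw[OF assms] .
  have [measurable]: "F \<in> borel_measurable borel"
    unfolding F[abs_def] by measurable
  have nn: "F t \<ge> 0" for t unfolding F by simp
  have c: "real i + \<mu> + 1 / 2 > 0" using assms by simp
  then have G: "Gamma (real i + \<mu> + 1 / 2) > 0" by (rule Gamma_real_pos)
  have I: "(\<integral>\<^sup>+t. ennreal (F t) \<partial>lborel) = ennreal (exp (- (norm x)\<^sup>2) * Gamma (real i + \<mu> + 1 / 2))"
    unfolding nn_integral_cone_fibre[OF c norm_ge_zero, symmetric] F
    by (intro nn_integral_cong) (auto split: split_indicator)
  have "has_bochner_integral lborel F (exp (- (norm x)\<^sup>2) * Gamma (real i + \<mu> + 1 / 2))"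
    using I G nn by (intro has_bochner_integral_nn_integral) auto
  then show "integrable lborel (\<lambda>t. h2 (x, t) ^ i * cw (1 / 2) \<mu> (x, t))"
    "(\<integral>t. h2 (x, t) ^ i * cw (1 / 2) \<mu> (x, t) \<partial>lborel) = exp (- (norm x)\<^sup>2) * Gamma (real i + \<mu> + 1 / 2)"
    unfolding F_def by (auto simp: has_bochner_integral_iff)
qed

lemma h2_cw_nonneg: "\<mu> \<ge> 0 \<Longrightarrow> h2 p ^ i * cw (1 / 2) \<mu> p \<ge> 0"
  by (cases p) (simp only: h2_power_cw, simp)

text \<open>A power of \<open>h2\<close> enters only through the Gamma argument of the fibre
  integral, so polynomials in \<open>fst p\<close> and \<open>h2 p\<close> are integrated by
  Gaussian moments alone.\<close>

lemma cone_integral_half: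
  fixes g :: "real ^ 'd \<Rightarrow> real"
  assumes \<mu>: "\<mu> \<ge> 0" and [measurable]: "g \<in> borel_measurable borel"
    and g: "integrable lborel (\<lambda>x. g x * exp (- (norm x)\<^sup>2))"
  shows "integrable lborel (\<lambda>p. g (fst p) * (h2 p ^ i * cw (1 / 2) \<mu> p))"
    and "(\<integral>p. g (fst p) * (h2 p ^ i * cw (1 / 2) \<mu> p) \<partial>lborel) =
      Gamma (real i + \<mu> + 1 / 2) * (\<integral>x. g x * exp (- (norm x)\<^sup>2) \<partial>lborel)"
proof -
  define F where "F p = g (fst p) * (h2 p ^ i * cw (1 / 2) \<mu> p)" for p
  have FM: "F \<in> borel_measurable (lborel \<Otimes>\<^sub>M lborel)"
    unfolding F_def[abs_def] lborel_prod by measurable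
  have G: "Gamma (real i + \<mu> + 1 / 2) > 0" using \<mu> by (intro Gamma_real_pos) simp
  have int: "integrable (lborel \<Otimes>\<^sub>M lborel) F"
  proof (rule lborel_pair.Fubini_integrable[OF FM])
    have "(\<integral>t. norm (F (x, t)) \<partial>lborel) = Gamma (real i + \<mu> + 1 / 2) * \<bar>g x * exp (- (norm x)\<^sup>2)\<bar>" for x
    proof -
      have "norm (F (x, t)) = \<bar>g x\<bar> * (h2 (x, t) ^ i * cw (1 / 2) \<mu> (x, t))" for t
        unfolding F_def using h2_cw_nonneg[OF \<mu>, of "(x, t)" i]
        by (simp only: fst_conv real_norm_def abs_mult[of "g x"] abs_of_nonneg)
      then show ?thesis using cone_fibre[OF \<mu>, of x i] by (simp add: abs_mult)
    qed
    then show "integrable lborel (\<lambda>x. \<integral>t. norm (F (x, t)) \<partial>lborel)"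
      using g by simp
    show "AE x in lborel. integrable lborel (\<lambda>t. F (x, t))"
      using cone_fibre(1)[OF \<mu>] by (auto simp: F_def)
  qed
  have "(\<integral>x. (\<integral>t. F (x, t) \<partial>lborel) \<partial>lborel) = integral\<^sup>L (lborel \<Otimes>\<^sub>M lborel) F"
    by (rule lborel_pair.integral_fst'[OF int])
  moreover have "(\<integral>t. F (x, t) \<partial>lborel) = Gamma (real i + \<mu> + 1 / 2) * (g x * exp (- (norm x)\<^sup>2))" for x
    unfolding F_def fst_conv integral_mult_right_zero cone_fibre(2)[OF \<mu>] by simp
  ultimately have "integral\<^sup>L lborel F =
      Gamma (real i + \<mu> + 1 / 2) * (\<integral>x. g x * exp (- (norm x)\<^sup>2) \<partial>lborel)"
    by (simp add: lborel_prod)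
  then show "(\<integral>p. g (fst p) * (h2 p ^ i * cw (1 / 2) \<mu> p) \<partial>lborel) =
      Gamma (real i + \<mu> + 1 / 2) * (\<integral>x. g x * exp (- (norm x)\<^sup>2) \<partial>lborel)"
    unfolding F_def .
  show "integrable lborel (\<lambda>p. g (fst p) * (h2 p ^ i * cw (1 / 2) \<mu> p))"
    using int unfolding F_def lborel_prod .
qed

lemma nn_integral_lborel_scale:
  fixes f :: "'a :: euclidean_space \<Rightarrow> ennreal"
  assumes [measurable]: "f \<in> borel_measurable borel" and c: "c > 0"
  shows "(\<integral>\<^sup>+x. f x \<partial>lborel) = ennreal (c ^ DIM('a)) * (\<integral>\<^sup>+x. f (c *\<^sub>R x) \<partial>lborel)"
  by (subst lborel_affine[of c 0]) (use c in \<open>simp_all add: nn_integral_density nn_integral_distr nn_integral_cmult\<close>)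

lemma integral_lborel_scale:
  fixes f :: "'a :: euclidean_space \<Rightarrow> real"
  assumes [measurable]: "f \<in> borel_measurable borel" and c: "c > 0"
  shows "(\<integral>x. f x \<partial>lborel) = c ^ DIM('a) * (\<integral>x. f (c *\<^sub>R x) \<partial>lborel)"
  by (subst lborel_affine[of c 0]) (use c in \<open>simp_all add: integral_density integral_distr\<close>)

text \<open>The Jacobian of \<open>x \<mapsto> \<bar>t\<bar> *\<^sub>R x\<close>, the degree
  \<open>n\<close> and the homogeneity of the weight are collected in one exponent. It is written as
  \<open>2 * v - 1\<close> to fit the radial integral, whose value is then
  \<open>Gamma v\<close>.\<close>

lemma cw_scale:
  fixes x :: "real ^ 'd"
  assumes t: "t \<noteq> 0"
  shows "\<bar>t\<bar> ^ CARD('d) * (\<bar>t\<bar> ^ n * cw \<beta> \<mu> (\<bar>t\<bar> *\<^sub>R x, t)) =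
    \<bar>t\<bar> powr (2 * (real n / 2 + \<beta> + \<mu> + real CARD('d) / 2) - 1) * exp (- t\<^sup>2) * bw \<mu> x"
proof (cases "norm x \<le> 1")
  case True
  have "t\<^sup>2 - (norm (\<bar>t\<bar> *\<^sub>R x))\<^sup>2 = t\<^sup>2 * (1 - (norm x)\<^sup>2)"
    by (simp add: power_mult_distrib algebra_simps)
  moreover have "(norm x)\<^sup>2 \<le> 1" using True by (simp add: abs_square_le_1)
  moreover have "t\<^sup>2 = \<bar>t\<bar> powr 2" using t by simp
  then have "(t\<^sup>2) powr (\<mu> - 1 / 2) = \<bar>t\<bar> powr (2 * (\<mu> - 1 / 2))"
    by (simp only: powr_powr)
  ultimately have 1: "(t\<^sup>2 - (norm (\<bar>t\<bar> *\<^sub>R x))\<^sup>2) powr (\<mu> - 1 / 2) =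
      \<bar>t\<bar> powr (2 * (\<mu> - 1 / 2)) * (1 - (norm x)\<^sup>2) powr (\<mu> - 1 / 2)"
    by (simp add: powr_mult)
  have p: "\<bar>t\<bar> > 0" using t by simp
  have "2 * (real n / 2 + \<beta> + \<mu> + real CARD('d) / 2) - 1 =
      real CARD('d) + (real n + (2 * \<beta> + 2 * (\<mu> - 1 / 2)))"
    by (simp add: field_simps)
  then have 2: "\<bar>t\<bar> powr (2 * (real n / 2 + \<beta> + \<mu> + real CARD('d) / 2) - 1) =
      \<bar>t\<bar> ^ CARD('d) * (\<bar>t\<bar> ^ n * (\<bar>t\<bar> powr (2 * \<beta>) * \<bar>t\<bar> powr (2 * (\<mu> - 1 / 2))))"
    by (simp only: powr_add powr_realpow[OF p])
  have "norm (\<bar>t\<bar> *\<^sub>R x) \<le> \<bar>t\<bar>" using True by (simp add: mult_left_le)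
  then have "cw \<beta> \<mu> (\<bar>t\<bar> *\<^sub>R x, t) =
      \<bar>t\<bar> powr (2 * \<beta>) * exp (- t\<^sup>2) * (\<bar>t\<bar> powr (2 * (\<mu> - 1 / 2)) * (1 - (norm x)\<^sup>2) powr (\<mu> - 1 / 2))"
    unfolding cw_def cone_weight_def prod.case 1 by (simp add: double_cone_def)
  then show ?thesis unfolding 2 using True by (simp add: bw_def)
next
  case False
  then have "\<not> norm (\<bar>t\<bar> *\<^sub>R x) \<le> \<bar>t\<bar>" using t by (simp add: mult_le_cancel_left2)
  then show ?thesis using False by (simp add: cw_def bw_def double_cone_def)
qed

lemma nn_integral_cone_polar:
  assumes v: "real n / 2 + \<beta> + \<mu> + real CARD('d) / 2 > 0"
  shows "(\<integral>\<^sup>+p. ennreal (\<bar>snd p\<bar> ^ n * cw \<beta> \<mu> p) \<partial>(lborel :: ((real ^ 'd) \<times> real) measure)) =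
    ennreal (Gamma (real n / 2 + \<beta> + \<mu> + real CARD('d) / 2)) *
    (\<integral>\<^sup>+x. ennreal (bw \<mu> x) \<partial>(lborel :: (real ^ 'd) measure))"
proof -
  define v where "v = real n / 2 + \<beta> + \<mu> + real CARD('d) / 2"
  have M: "(\<lambda>p :: (real ^ 'd) \<times> real. ennreal (\<bar>snd p\<bar> ^ n * cw \<beta> \<mu> p)) \<in> borel_measurable (lborel \<Otimes>\<^sub>M lborel)"
    unfolding lborel_prod by simp
  have "(\<integral>\<^sup>+p. ennreal (\<bar>snd p\<bar> ^ n * cw \<beta> \<mu> p) \<partial>(lborel :: ((real ^ 'd) \<times> real) measure)) =
    (\<integral>\<^sup>+t. (\<integral>\<^sup>+x. ennreal (\<bar>t\<bar> ^ n * cw \<beta> \<mu> (x, t)) \<partial>(lborel :: (real ^ 'd) measure)) \<partial>lborel)"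
    using lborel_pair.nn_integral_snd[OF M] by (simp add: lborel_prod)
  also have "\<dots> = (\<integral>\<^sup>+t. ennreal (\<bar>t\<bar> powr (2 * v - 1) * exp (- t\<^sup>2)) *
      (\<integral>\<^sup>+x. ennreal (bw \<mu> x) \<partial>(lborel :: (real ^ 'd) measure)) \<partial>lborel)"
  proof (intro nn_integral_cong_AE eventually_mono[OF AE_lborel_singleton[of 0]])
    fix t :: real assume t: "t \<noteq> 0"
    have "(\<lambda>x :: real ^ 'd. cw \<beta> \<mu> (x, t)) \<in> borel_measurable borel"
      by (rule measurable_compose[OF _ cw_borel]) (simp add: borel_prod[symmetric])
    then have "(\<lambda>x :: real ^ 'd. ennreal (\<bar>t\<bar> ^ n * cw \<beta> \<mu> (x, t))) \<in> borel_measurable borel"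
      by measurable
    then have "(\<integral>\<^sup>+x. ennreal (\<bar>t\<bar> ^ n * cw \<beta> \<mu> (x, t)) \<partial>(lborel :: (real ^ 'd) measure)) =
      ennreal (\<bar>t\<bar> ^ CARD('d)) * (\<integral>\<^sup>+x. ennreal (\<bar>t\<bar> ^ n * cw \<beta> \<mu> (\<bar>t\<bar> *\<^sub>R x, t)) \<partial>(lborel :: (real ^ 'd) measure))"
      using nn_integral_lborel_scale[of "\<lambda>x :: real ^ 'd. ennreal (\<bar>t\<bar> ^ n * cw \<beta> \<mu> (x, t))" "\<bar>t\<bar>"] t by simp
    also have "\<dots> = (\<integral>\<^sup>+x. ennreal (\<bar>t\<bar> ^ CARD('d)) * ennreal (\<bar>t\<bar> ^ n * cw \<beta> \<mu> (\<bar>t\<bar> *\<^sub>R x, t)) \<partial>(lborel :: (real ^ 'd) measure))"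
    proof (rule nn_integral_cmult[symmetric])
      have "(\<lambda>x :: real ^ 'd. cw \<beta> \<mu> (\<bar>t\<bar> *\<^sub>R x, t)) \<in> borel_measurable borel"
        by (rule measurable_compose[OF _ cw_borel]) (simp add: borel_prod[symmetric])
      then show "(\<lambda>x :: real ^ 'd. ennreal (\<bar>t\<bar> ^ n * cw \<beta> \<mu> (\<bar>t\<bar> *\<^sub>R x, t))) \<in> borel_measurable lborel"
        by measurable
    qed
    also have "\<dots> = (\<integral>\<^sup>+x. ennreal (\<bar>t\<bar> powr (2 * v - 1) * exp (- t\<^sup>2)) * ennreal (bw \<mu> x) \<partial>(lborel :: (real ^ 'd) measure))"
      by (intro nn_integral_cong)
        (simp add: cw_scale[OF t] v_def cw_nonneg bw_nonneg flip: ennreal_mult'')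
    also have "\<dots> = ennreal (\<bar>t\<bar> powr (2 * v - 1) * exp (- t\<^sup>2)) *
      (\<integral>\<^sup>+x. ennreal (bw \<mu> x) \<partial>(lborel :: (real ^ 'd) measure))"
      by (rule nn_integral_cmult) simp
    finally show "(\<integral>\<^sup>+x. ennreal (\<bar>t\<bar> ^ n * cw \<beta> \<mu> (x, t)) \<partial>(lborel :: (real ^ 'd) measure)) =
      ennreal (\<bar>t\<bar> powr (2 * v - 1) * exp (- t\<^sup>2)) *
      (\<integral>\<^sup>+x. ennreal (bw \<mu> x) \<partial>(lborel :: (real ^ 'd) measure))" .
  qed
  also have "\<dots> = (\<integral>\<^sup>+t. ennreal (\<bar>t\<bar> powr (2 * v - 1) * exp (- t\<^sup>2)) \<partial>lborel) *
      (\<integral>\<^sup>+x. ennreal (bw \<mu> x) \<partial>(lborel :: (real ^ 'd) measure))"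
    by (rule nn_integral_multc) simp
  also have "(\<integral>\<^sup>+t. ennreal (\<bar>t\<bar> powr (2 * v - 1) * exp (- t\<^sup>2)) \<partial>lborel) = ennreal (Gamma v)"
    by (rule nn_integral_gaussian_moment) (use v in \<open>simp add: v_def\<close>)
  finally show ?thesis unfolding v_def .
qed

text \<open>Finiteness on the ball is read off backwards: for \<open>\<beta> = 1 / 2\<close> the
  cone weight is integrable by the Gaussian reduction, and in the polar decomposition the radial
  factor is a positive Gamma value, so the ball factor must be finite.\<close>

lemma integrable_bw:
  assumes \<mu>: "\<mu> \<ge> 0"
  shows "integrable lborel (bw \<mu> :: real ^ 'd \<Rightarrow> real)"
proof (rule integrableI_nonneg)
  have int: "integrable lborel (\<lambda>p :: (real ^ 'd) \<times> real. cw (1 / 2) \<mu> p)"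
    using cone_integral_half(1)[OF \<mu>, of "\<lambda>_ :: real ^ 'd. 1" 0] integrable_exp_neg_norm_sq[of 1] by simp
  have v: "real 0 / 2 + 1 / 2 + \<mu> + real CARD('d) / 2 > 0" using \<mu> by simp
  have "ennreal (Gamma (real 0 / 2 + 1 / 2 + \<mu> + real CARD('d) / 2)) *
    (\<integral>\<^sup>+x. ennreal (bw \<mu> x) \<partial>(lborel :: (real ^ 'd) measure)) =
    (\<integral>\<^sup>+p. ennreal (cw (1 / 2) \<mu> p) \<partial>(lborel :: ((real ^ 'd) \<times> real) measure))"
    using nn_integral_cone_polar[OF v] by simp
  also have "\<dots> < \<infinity>"
    using int by (simp add: integrable_iff_bounded cw_nonneg)
  finally show "(\<integral>\<^sup>+x. ennreal (bw \<mu> x) \<partial>(lborel :: (real ^ 'd) measure)) < \<infinity>"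
    using Gamma_real_pos[OF v] by (auto simp: ennreal_mult_less_top)
qed (auto simp: bw_nonneg)

lemma cone_integrable:
  fixes f :: "(real ^ 'd) \<times> real \<Rightarrow> real"
  assumes \<beta>: "\<beta> \<ge> 1 / 2" and \<mu>: "\<mu> \<ge> 0" and [measurable]: "f \<in> borel_measurable borel"
    and f: "\<And>p. p \<in> double_cone \<Longrightarrow> \<bar>f p\<bar> \<le> C * \<bar>snd p\<bar> ^ n"
  shows "integrable lborel (\<lambda>p. f p * cw \<beta> \<mu> p)"
proof (rule Bochner_Integration.integrable_bound)
  have v: "real n / 2 + \<beta> + \<mu> + real CARD('d) / 2 > 0" using \<mu> \<beta> by simp
  have "(\<integral>\<^sup>+x. ennreal (bw \<mu> x) \<partial>(lborel :: (real ^ 'd) measure)) < \<infinity>"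
    using integrable_bw[OF \<mu>] by (simp add: integrable_iff_bounded bw_nonneg)
  then have "integrable lborel (\<lambda>p :: (real ^ 'd) \<times> real. \<bar>snd p\<bar> ^ n * cw \<beta> \<mu> p)"
    using nn_integral_cone_polar[OF v] by (intro integrableI_nonneg) (auto simp: cw_nonneg ennreal_mult_less_top)
  then show "integrable lborel (\<lambda>p :: (real ^ 'd) \<times> real. C * (\<bar>snd p\<bar> ^ n * cw \<beta> \<mu> p))"
    by (rule integrable_mult_right)
  show "AE p in lborel. norm (f p * cw \<beta> \<mu> p) \<le> norm (C * (\<bar>snd p\<bar> ^ n * cw \<beta> \<mu> p))"
  proof (intro AE_I2)
    fix p :: "(real ^ 'd) \<times> real"
    show "norm (f p * cw \<beta> \<mu> p) \<le> norm (C * (\<bar>snd p\<bar> ^ n * cw \<beta> \<mu> p))"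
    proof (cases "p \<in> double_cone")
      case True
      have "\<bar>f p\<bar> * cw \<beta> \<mu> p \<le> C * \<bar>snd p\<bar> ^ n * cw \<beta> \<mu> p"
        by (intro mult_right_mono f True cw_nonneg)
      also have "\<dots> \<le> \<bar>C * (\<bar>snd p\<bar> ^ n * cw \<beta> \<mu> p)\<bar>" by (simp add: mult.assoc)
      finally show ?thesis by (simp add: abs_mult cw_nonneg)
    qed (simp add: cw_def)
  qed
qed measurable

lemma cone_integral_polar:
  fixes f :: "(real ^ 'd) \<times> real \<Rightarrow> real"
  assumes \<beta>: "\<beta> \<ge> 1 / 2" and \<mu>: "\<mu> \<ge> 0" and [measurable]: "f \<in> borel_measurable borel"
    and f: "\<And>p. p \<in> double_cone \<Longrightarrow> \<bar>f p\<bar> \<le> C * \<bar>snd p\<bar> ^ n"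
    and hom: "\<And>x t. t \<noteq> 0 \<Longrightarrow> f (\<bar>t\<bar> *\<^sub>R x, t) = \<bar>t\<bar> ^ n * f (x, 1)"
  shows "(\<integral>p. f p * cw \<beta> \<mu> p \<partial>lborel) =
    Gamma (real n / 2 + \<beta> + \<mu> + real CARD('d) / 2) * (\<integral>x. f (x, 1) * bw \<mu> x \<partial>lborel)"
proof -
  define v where "v = real n / 2 + \<beta> + \<mu> + real CARD('d) / 2"
  have v: "v > 0" using \<mu> \<beta> by (simp add: v_def)
  define B where "B = (\<integral>x. f (x, 1) * bw \<mu> x \<partial>lborel)"
  have int: "integrable (lborel \<Otimes>\<^sub>M lborel) (\<lambda>p. f p * cw \<beta> \<mu> p)"
    using cone_integrable[OF \<beta> \<mu> assms(3) f] by (simp add: lborel_prod)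
  have eq: "(\<lambda>(x, t). f (x, t) * cw \<beta> \<mu> (x, t)) = (\<lambda>p. f p * cw \<beta> \<mu> p)"
    by auto
  have "(\<integral>p. f p * cw \<beta> \<mu> p \<partial>lborel) = (\<integral>t. (\<integral>x. f (x, t) * cw \<beta> \<mu> (x, t) \<partial>lborel) \<partial>lborel)"
    using lborel_pair.integral_snd[of "\<lambda>x t. f (x, t) * cw \<beta> \<mu> (x, t)"] int
    by (simp add: lborel_prod eq)
  also have "\<dots> = (\<integral>t. (\<bar>t\<bar> powr (2 * v - 1) * exp (- t\<^sup>2)) * B \<partial>lborel)"
  proof (rule integral_cong_AE)
    show "(\<lambda>t. \<integral>x. f (x, t) * cw \<beta> \<mu> (x, t) \<partial>lborel) \<in> borel_measurable lborel"
      using lborel_pair.integrable_snd[of "\<lambda>x t. f (x, t) * cw \<beta> \<mu> (x, t)"] int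
      by (intro borel_measurable_integrable) (simp add: lborel_prod eq)
    show "AE t in lborel. (\<integral>x. f (x, t) * cw \<beta> \<mu> (x, t) \<partial>lborel) = (\<bar>t\<bar> powr (2 * v - 1) * exp (- t\<^sup>2)) * B"
    proof (intro eventually_mono[OF AE_lborel_singleton[of 0]])
      fix t :: real assume t: "t \<noteq> 0"
      have "(\<lambda>x :: real ^ 'd. f (x, t) * cw \<beta> \<mu> (x, t)) \<in> borel_measurable borel"
        by (intro borel_measurable_times measurable_compose[OF _ cw_borel] measurable_compose[OF _ assms(3)])
          (simp_all add: borel_prod[symmetric])
      then have "(\<integral>x. f (x, t) * cw \<beta> \<mu> (x, t) \<partial>lborel) =
        \<bar>t\<bar> ^ CARD('d) * (\<integral>x. f (\<bar>t\<bar> *\<^sub>R x, t) * cw \<beta> \<mu> (\<bar>t\<bar> *\<^sub>R x, t) \<partial>lborel)"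
        using integral_lborel_scale[of "\<lambda>x :: real ^ 'd. f (x, t) * cw \<beta> \<mu> (x, t)" "\<bar>t\<bar>"] t by simp
      also have "\<dots> = (\<integral>x. (\<bar>t\<bar> powr (2 * v - 1) * exp (- t\<^sup>2)) * (f (x, 1) * bw \<mu> x) \<partial>lborel)"
      proof (subst integral_mult_right_zero[symmetric], intro Bochner_Integration.integral_cong refl)
        fix x :: "real ^ 'd"
        have "\<bar>t\<bar> ^ CARD('d) * (f (\<bar>t\<bar> *\<^sub>R x, t) * cw \<beta> \<mu> (\<bar>t\<bar> *\<^sub>R x, t)) =
          (\<bar>t\<bar> ^ CARD('d) * (\<bar>t\<bar> ^ n * cw \<beta> \<mu> (\<bar>t\<bar> *\<^sub>R x, t))) * f (x, 1)"
          unfolding hom[OF t] by (simp add: mult_ac)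
        then show "\<bar>t\<bar> ^ CARD('d) * (f (\<bar>t\<bar> *\<^sub>R x, t) * cw \<beta> \<mu> (\<bar>t\<bar> *\<^sub>R x, t)) =
          (\<bar>t\<bar> powr (2 * v - 1) * exp (- t\<^sup>2)) * (f (x, 1) * bw \<mu> x)"
          unfolding cw_scale[OF t] v_def by (simp add: mult_ac)
      qed
      also have "\<dots> = (\<bar>t\<bar> powr (2 * v - 1) * exp (- t\<^sup>2)) * B"
        unfolding B_def by (rule integral_mult_right_zero)
      finally show "(\<integral>x. f (x, t) * cw \<beta> \<mu> (x, t) \<partial>lborel) = (\<bar>t\<bar> powr (2 * v - 1) * exp (- t\<^sup>2)) * B" .
    qed
  qed measurable
  also have "\<dots> = (\<integral>t. \<bar>t\<bar> powr (2 * v - 1) * exp (- t\<^sup>2) \<partial>lborel) * B"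
    by (rule integral_mult_left_zero)
  also have "(\<integral>t. \<bar>t\<bar> powr (2 * v - 1) * exp (- t\<^sup>2) \<partial>lborel) = Gamma v"
    using nn_integral_gaussian_moment[OF v] Gamma_real_pos[OF v]
    by (subst integral_eq_nn_integral) auto
  finally show ?thesis unfolding v_def B_def .
qed

section \<open>Means of the ball kernels against powers of linear forms\<close>

text \<open>For \<open>\<mu> > 0\<close> and \<open>p\<close>, \<open>q\<close> in the cone, this is
  the average over \<open>u\<close>, with the normalized weight
  \<open>(1 - u\<^sup>2) powr (\<mu> - 1)\<close>, of the degree-\<open>l\<close> term of the
  exponential of \<open>2 * (fst p \<bullet> fst q + u * sqrt (h2 p) * sqrt (h2 q))\<close>. The
  closed form is a polynomial and persists at \<open>\<mu> = 0\<close>.\<close>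

definition hexp :: "real \<Rightarrow> nat \<Rightarrow> (real ^ 'd) \<times> real \<Rightarrow> (real ^ 'd) \<times> real \<Rightarrow> real" where
  "hexp \<mu> l p q = (\<Sum>i\<le>l div 2. h2 p ^ i / (fact i * pochhammer (\<mu> + 1 / 2) i) *
     (lpow (fst p) (l - 2 * i) (fst q) * h2 q ^ i))"

definition cone_mean :: "real \<Rightarrow> real \<Rightarrow> ((real ^ 'd) \<times> real \<Rightarrow> real) \<Rightarrow> real" where
  "cone_mean \<beta> \<mu> f = (\<integral>p. f p * cw \<beta> \<mu> p \<partial>lborel) / (\<integral>p. cw \<beta> \<mu> (p :: (real ^ 'd) \<times> real) \<partial>lborel)"

lemma cone_inner_eq_mean: "cone_inner \<beta> \<mu> f g = cone_mean \<beta> \<mu> (\<lambda>p. f p * g p)"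
  by (simp add: cone_inner_def cone_mean_def set_lebesgue_integral_def cw_def mult_ac)

definition even_hom :: "nat \<Rightarrow> ((real ^ 'd) \<times> real \<Rightarrow> real) \<Rightarrow> bool" where
  "even_hom n f \<longleftrightarrow> (\<forall>c\<ge>0. \<forall>x t. f (c *\<^sub>R x, c * t) = c ^ n * f (x, t)) \<and> (\<forall>x t. f (x, - t) = f (x, t))"

lemma even_hom_scale:
  assumes "even_hom n f"
  shows "f (\<bar>t\<bar> *\<^sub>R x, t) = \<bar>t\<bar> ^ n * f (x, 1)"
proof -
  have "f (\<bar>t\<bar> *\<^sub>R x, t) = f (\<bar>t\<bar> *\<^sub>R x, \<bar>t\<bar> * 1)"
    using assms by (cases "t \<ge> 0") (auto simp: even_hom_def)
  then show ?thesis using assms by (simp only: even_hom_def abs_ge_zero)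
qed

lemma even_hom_bound:
  fixes f :: "(real ^ 'd) \<times> real \<Rightarrow> real"
  assumes f: "continuous_on UNIV f" "even_hom n f"
  shows "\<exists>C. \<forall>p\<in>double_cone. \<bar>f p\<bar> \<le> C * \<bar>snd p\<bar> ^ n"
proof -
  have "compact ((\<lambda>x. f (x, 1)) ` cball 0 1)"
    by (intro compact_continuous_image continuous_on_compose2[OF f(1)] continuous_intros) auto
  then have "bounded ((\<lambda>x. f (x, 1)) ` cball 0 1)"
    by (rule compact_imp_bounded)
  then obtain C where C: "\<And>x. norm x \<le> 1 \<Longrightarrow> \<bar>f (x, 1)\<bar> \<le> C"
    by (force simp: bounded_iff)
  show ?thesis
  proof (intro exI ballI)
    fix p :: "(real ^ 'd) \<times> real" assume "p \<in> double_cone"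
    then obtain x t where p: "p = (x, t)" "norm x \<le> \<bar>t\<bar>" by (auto simp: double_cone_def)
    \<comment> \<open>At the vertex \<open>t = 0\<close> both \<open>x\<close> and \<open>z\<close>
      are zero, so \<open>x = \<bar>t\<bar> *\<^sub>R z\<close> holds there too.\<close>
    define z where "z = (1 / \<bar>t\<bar>) *\<^sub>R x"
    have z: "norm z \<le> 1" "x = \<bar>t\<bar> *\<^sub>R z"
      using p(2) by (cases "t = 0"; simp add: z_def divide_simps)+
    have "\<bar>f p\<bar> = \<bar>t\<bar> ^ n * \<bar>f (z, 1)\<bar>"
      unfolding p(1) z(2) even_hom_scale[OF f(2)] by (simp add: abs_mult power_abs)
    also have "\<dots> \<le> \<bar>t\<bar> ^ n * C" by (intro mult_left_mono C z) auto
    finally show "\<bar>f p\<bar> \<le> C * \<bar>snd p\<bar> ^ n" by (simp add: p mult.commute)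
  qed
qed

text \<open>On the slice \<open>t = 1\<close> the factor \<open>snd p ^ (2 * i)\<close> is
  \<open>1\<close>, so both integrals share the same ball factor and differ in the radial Gamma
  value only. This reduces every weight to \<open>\<beta> = 1 / 2\<close>.\<close>

lemma even_hom_integral:
  fixes f :: "(real ^ 'd) \<times> real \<Rightarrow> real"
  assumes \<beta>: "\<beta> \<ge> 1 / 2" and \<mu>: "\<mu> \<ge> 0" and f: "continuous_on UNIV f" "even_hom n f"
  shows "(\<integral>p. snd p ^ (2 * i) * f p * cw \<beta> \<mu> p \<partial>lborel) =
    Gamma (real n / 2 + real i + (\<beta> + \<mu> + real CARD('d) / 2)) / Gamma (real n / 2 + (\<mu> + (real CARD('d) + 1) / 2)) *
    (\<integral>p. f p * cw (1 / 2) \<mu> p \<partial>lborel)"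
proof -
  define g where "g p = snd p ^ (2 * i) * f p" for p
  have g: "continuous_on UNIV g" unfolding g_def by (intro continuous_intros f)
  have g2: "even_hom (n + 2 * i) g"
    using f(2) by (auto simp: even_hom_def g_def power_mult_distrib power_add)
  have [measurable]: "f \<in> borel_measurable borel" "g \<in> borel_measurable borel"
    using f g by (auto intro: borel_measurable_continuous_onI)
  obtain C where C: "\<And>p. p \<in> double_cone \<Longrightarrow> \<bar>f p\<bar> \<le> C * \<bar>snd p\<bar> ^ n"
    using even_hom_bound[OF f] by blast
  obtain D where D: "\<And>p. p \<in> double_cone \<Longrightarrow> \<bar>g p\<bar> \<le> D * \<bar>snd p\<bar> ^ (n + 2 * i)"
    using even_hom_bound[OF g g2] by blast
  define B where "B = (\<integral>x. f (x, 1) * bw \<mu> x \<partial>lborel)"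
  have 1: "(\<integral>p. g p * cw \<beta> \<mu> p \<partial>lborel) =
    Gamma (real (n + 2 * i) / 2 + \<beta> + \<mu> + real CARD('d) / 2) * (\<integral>x. g (x, 1) * bw \<mu> x \<partial>lborel)"
    by (rule cone_integral_polar[OF \<beta> \<mu> _ D]) (auto simp: even_hom_scale[OF g2])
  have 2: "(\<integral>p. f p * cw (1 / 2) \<mu> p \<partial>lborel) = Gamma (real n / 2 + 1 / 2 + \<mu> + real CARD('d) / 2) * B"
    unfolding B_def by (rule cone_integral_polar[OF _ \<mu> _ C]) (auto simp: even_hom_scale[OF f(2)])
  have 3: "(\<integral>x. g (x, 1) * bw \<mu> x \<partial>lborel) = B" by (simp add: g_def B_def)
  have 4: "real n / 2 + (\<mu> + (real CARD('d) + 1) / 2) = real n / 2 + 1 / 2 + \<mu> + real CARD('d) / 2"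
    by (simp add: field_simps)
  have 5: "real n / 2 + real i + (\<beta> + \<mu> + real CARD('d) / 2) = real (n + 2 * i) / 2 + \<beta> + \<mu> + real CARD('d) / 2"
    by (simp add: field_simps)
  have "Gamma (real n / 2 + 1 / 2 + \<mu> + real CARD('d) / 2) > 0"
    using \<mu> by (intro Gamma_real_pos add_nonneg_pos) auto
  then show ?thesis using 1 unfolding 3 4 5 2 by (simp add: g_def)
qed

lemma lpow_scale: "lpow x n (c *\<^sub>R y) = c ^ n * lpow x n y"
  by (simp add: lpow_def power_mult_distrib)

lemma h2_scale: "h2 (c *\<^sub>R x, c * t) = c\<^sup>2 * h2 (x, t)"
  by (simp add: h2_def power_mult_distrib algebra_simps)

lemma even_hom_hexp:
  fixes p :: "(real ^ 'd) \<times> real"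
  shows "even_hom l (hexp \<mu> l p)"
  unfolding even_hom_def
proof (intro conjI allI impI)
  fix c :: real and x :: "real ^ 'd" and t :: real
  have "lpow (fst p) (l - 2 * i) (c *\<^sub>R x) * h2 (c *\<^sub>R x, c * t) ^ i =
    c ^ l * (lpow (fst p) (l - 2 * i) x * h2 (x, t) ^ i)" if "i \<in> {..l div 2}" for i
  proof -
    have "c ^ l = c ^ (l - 2 * i) * (c\<^sup>2) ^ i"
      using that by (simp flip: power_mult power_add)
    then show ?thesis by (simp add: lpow_scale h2_scale power_mult_distrib)
  qed
  note eq = this
  show "hexp \<mu> l p (c *\<^sub>R x, c * t) = c ^ l * hexp \<mu> l p (x, t)"
    unfolding hexp_def sum_distrib_left fst_conv
    by (intro sum.cong refl) (simp only: eq mult.left_commute)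
  show "hexp \<mu> l p (x, - t) = hexp \<mu> l p (x, t)"
    by (simp add: hexp_def h2_def)
qed

lemma even_hom_mult: "even_hom n f \<Longrightarrow> even_hom m g \<Longrightarrow> even_hom (n + m) (\<lambda>p. f p * g p)"
  by (simp add: even_hom_def power_add)

lemma even_hom_lpow: "even_hom j (\<lambda>q. lpow \<xi> j (fst q))"
  by (simp add: even_hom_def lpow_scale)

lemma pspan_lpow: "(\<lambda>q. lpow \<xi> j (fst q)) \<in> pspan j"
proof -
  have "(\<lambda>q. (2 ^ j / fact j) * (\<xi> \<bullet> fst q) ^ j) \<in> pspan (j * 1)"
    by (intro pspan.cmult pspan_power pspan_inner)
  then show ?thesis by (simp add: lpow_def power_mult_distrib)
qed

lemma pspan_h2: "h2 \<in> pspan 2"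
proof -
  have "(\<lambda>q. snd q ^ 2 + (- 1) * (norm (fst q))\<^sup>2) \<in> pspan 2"
    using pspan_power[OF pspan_snd, of 2] by (intro pspan.add pspan.cmult pspan_norm_sq) simp
  then show ?thesis by (simp add: h2_def[abs_def])
qed

lemma pspan_hexp: "hexp \<mu> l p \<in> pspan l"
  unfolding hexp_def
proof (intro pspan_sum pspan.cmult)
  fix i assume "i \<in> {..l div 2}"
  then have l: "l - 2 * i + i * 2 = l" by auto
  show "(\<lambda>q. lpow (fst p) (l - 2 * i) (fst q) * h2 q ^ i) \<in> pspan l"
    using pspan_mult[OF pspan_lpow[of "fst p" "l - 2 * i"] pspan_power[OF pspan_h2, of i]] unfolding l .
qed

lemma sum_even_offset:
  fixes f :: "nat \<Rightarrow> real"
  assumes "\<And>k. k \<le> j \<Longrightarrow> odd (j - k) \<Longrightarrow> f k = 0"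
  shows "(\<Sum>k\<le>j. f k) = (\<Sum>g\<le>j div 2. f (j - 2 * g))"
proof -
  have "(\<Sum>g\<le>j div 2. f (j - 2 * g)) = sum f ((\<lambda>g. j - 2 * g) ` {..j div 2})"
    by (subst sum.reindex) (auto simp: inj_on_def)
  also have "\<dots> = (\<Sum>k\<le>j. f k)"
  proof (rule sum.mono_neutral_left)
    show "\<forall>k\<in>{..j} - (\<lambda>g. j - 2 * g) ` {..j div 2}. f k = 0"
    proof
      fix k assume k: "k \<in> {..j} - (\<lambda>g. j - 2 * g) ` {..j div 2}"
      have "odd (j - k)"
      proof
        assume "even (j - k)"
        then have "k = j - 2 * ((j - k) div 2)" using k by auto
        then show False using k by (metis DiffE atMost_iff diff_le_self div_le_mono imageI)
      qed
      then show "f k = 0" using assms k by auto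
    qed
  qed auto
  finally show ?thesis ..
qed

text \<open>The binomial theorem for \<open>t\<^sup>2 = h2 p + (norm x)\<^sup>2\<close>. It merges
  the powers of \<open>h2 p\<close> from \<open>hexp\<close> with the powers of
  \<open>norm x\<close> from the Gaussian moments into a power of \<open>t\<close>.\<close>

lemma sum_h2_norm_powers:
  "(\<Sum>i\<le>M. h2 p ^ i / fact i * (norm (fst p) ^ (2 * (M - i)) / fact (M - i))) = snd p ^ (2 * M) / fact M"
proof -
  have "snd p ^ (2 * M) = (h2 p + (norm (fst p))\<^sup>2) ^ M"
    by (simp add: h2_def power_mult)
  also have "\<dots> / fact M = (\<Sum>i\<le>M. real (M choose i) / fact M * (h2 p ^ i * ((norm (fst p))\<^sup>2) ^ (M - i)))"
    unfolding binomial_ring sum_divide_distrib by (intro sum.cong refl) simp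
  also have "\<dots> = (\<Sum>i\<le>M. h2 p ^ i / fact i * (norm (fst p) ^ (2 * (M - i)) / fact (M - i)))"
    by (intro sum.cong refl) (simp add: inverse_fact_diff[symmetric] power_mult)
  finally show ?thesis ..
qed

text \<open>The Gamma value \<open>Gamma (i + \<mu> + 1 / 2)\<close> of the fibre cancels the symbol
  \<open>pochhammer (\<mu> + 1 / 2) i\<close> in \<open>hexp\<close>. The shifted Gaussian moments
  then combine with the powers of \<open>h2 p\<close> by \<open>sum_h2_norm_powers\<close>, so that
  \<open>p\<close> enters through \<open>snd p\<close> and its pairings with \<open>\<xi>\<close>
  only.\<close>

lemma hexp_lpow_integral_half:
  fixes p :: "(real ^ 'd) \<times> real"
  assumes \<mu>: "\<mu> \<ge> 0"
  defines "\<delta> \<equiv> \<mu> + (real CARD('d) + 1) / 2"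
  shows "(\<integral>q. hexp \<mu> l p q * lpow \<xi> j (fst q) * cw (1 / 2) \<mu> q \<partial>lborel) =
    Gamma (\<mu> + 1 / 2) * gauss_total TYPE(real ^ 'd) *
      (apair \<delta> (snd p) (norm \<xi>) (\<lambda>k. lpow \<xi> k (fst p)) l j * pochhammer \<delta> ((l + j) div 2))"
proof -
  define x where "x = fst p"
  define C where "C = gauss_total TYPE(real ^ 'd)"
  have G0: "Gamma (\<mu> + 1 / 2) > 0" using \<mu> by (intro Gamma_real_pos) simp
  have \<delta>: "\<delta> > 0" using \<mu> unfolding \<delta>_def by (intro add_nonneg_pos) auto
  have half: "integrable lborel (\<lambda>q. (lpow x k (fst q) * lpow \<xi> j (fst q)) * (h2 q ^ i * cw (1 / 2) \<mu> q))"
    "(\<integral>q. (lpow x k (fst q) * lpow \<xi> j (fst q)) * (h2 q ^ i * cw (1 / 2) \<mu> q) \<partial>lborel) =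
      Gamma (real i + \<mu> + 1 / 2) * gauss_moment x k \<xi> j" for k i
    using cone_integral_half[OF \<mu>, of "\<lambda>y. lpow x k y * lpow \<xi> j y" i] integrable_lpow_lpow_gaussian[of x k \<xi> j]
    unfolding gauss_moment_def by auto
  have "(\<integral>q. hexp \<mu> l p q * lpow \<xi> j (fst q) * cw (1 / 2) \<mu> q \<partial>lborel) =
    (\<integral>q. (\<Sum>i\<le>l div 2. h2 p ^ i / (fact i * pochhammer (\<mu> + 1 / 2) i) *
     ((lpow x (l - 2 * i) (fst q) * lpow \<xi> j (fst q)) * (h2 q ^ i * cw (1 / 2) \<mu> q))) \<partial>lborel)"
    unfolding hexp_def sum_distrib_right x_def
    by (intro Bochner_Integration.integral_cong sum.cong refl) (simp add: mult_ac)
  also have "\<dots> = (\<Sum>i\<le>l div 2. h2 p ^ i / (fact i * pochhammer (\<mu> + 1 / 2) i) *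
     (Gamma (real i + \<mu> + 1 / 2) * gauss_moment x (l - 2 * i) \<xi> j))"
    using half by (subst Bochner_Integration.integral_sum) auto
  also have "\<dots> = (\<Sum>i\<le>l div 2. Gamma (\<mu> + 1 / 2) * (h2 p ^ i / fact i * gauss_moment x (l - 2 * i) \<xi> j))"
  proof (intro sum.cong refl)
    fix i
    have "pochhammer (\<mu> + 1 / 2) i = Gamma (\<mu> + 1 / 2 + real i) / Gamma (\<mu> + 1 / 2)"
      using \<mu> by (intro pochhammer_Gamma) (auto simp: nonpos_Ints_def)
    then have "Gamma (real i + \<mu> + 1 / 2) = pochhammer (\<mu> + 1 / 2) i * Gamma (\<mu> + 1 / 2)"
      using G0 by (simp add: add_ac)
    moreover have "pochhammer (\<mu> + 1 / 2) i > 0" using \<mu> by (intro pochhammer_pos) simp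
    ultimately show "h2 p ^ i / (fact i * pochhammer (\<mu> + 1 / 2) i) *
     (Gamma (real i + \<mu> + 1 / 2) * gauss_moment x (l - 2 * i) \<xi> j) =
     Gamma (\<mu> + 1 / 2) * (h2 p ^ i / fact i * gauss_moment x (l - 2 * i) \<xi> j)"
      by simp
  qed
  also have "\<dots> = Gamma (\<mu> + 1 / 2) * (\<Sum>k\<le>j. \<Sum>i\<le>l div 2. h2 p ^ i / fact i *
      (if k \<le> l - 2 * i \<and> even (l - 2 * i - k)
       then norm x ^ (l - 2 * i - k) / fact ((l - 2 * i - k) div 2) * lpow \<xi> k x * gauss_moment 0 0 \<xi> (j - k) else 0))"
  proof -
    have "h2 p ^ i / fact i * gauss_moment x (l - 2 * i) \<xi> j = (\<Sum>k\<le>j. h2 p ^ i / fact i *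
      (if k \<le> l - 2 * i \<and> even (l - 2 * i - k)
       then norm x ^ (l - 2 * i - k) / fact ((l - 2 * i - k) div 2) * lpow \<xi> k x * gauss_moment 0 0 \<xi> (j - k) else 0))" for i
      by (subst gauss_moment_rec[of x]) (rule sum_distrib_left)
    then have eq: "(\<Sum>i\<le>l div 2. h2 p ^ i / fact i * gauss_moment x (l - 2 * i) \<xi> j) =
      (\<Sum>i\<le>l div 2. \<Sum>k\<le>j. h2 p ^ i / fact i *
      (if k \<le> l - 2 * i \<and> even (l - 2 * i - k)
       then norm x ^ (l - 2 * i - k) / fact ((l - 2 * i - k) div 2) * lpow \<xi> k x * gauss_moment 0 0 \<xi> (j - k) else 0))"
      by (simp only:)
    have "(\<Sum>i\<le>l div 2. Gamma (\<mu> + 1 / 2) * (h2 p ^ i / fact i * gauss_moment x (l - 2 * i) \<xi> j)) =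
      Gamma (\<mu> + 1 / 2) * (\<Sum>i\<le>l div 2. h2 p ^ i / fact i * gauss_moment x (l - 2 * i) \<xi> j)"
      by (rule sum_distrib_left[symmetric])
    moreover have "(\<Sum>i\<le>l div 2. \<Sum>k\<le>j. f i k) = (\<Sum>k\<le>j. \<Sum>i\<le>l div 2. f i k)" for f :: "nat \<Rightarrow> nat \<Rightarrow> real"
      by (rule sum.swap)
    ultimately show ?thesis unfolding eq by (simp only:)
  qed
  also have "(\<Sum>k\<le>j. \<Sum>i\<le>l div 2. h2 p ^ i / fact i *
      (if k \<le> l - 2 * i \<and> even (l - 2 * i - k)
       then norm x ^ (l - 2 * i - k) / fact ((l - 2 * i - k) div 2) * lpow \<xi> k x * gauss_moment 0 0 \<xi> (j - k) else 0)) =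
    (\<Sum>k\<le>j. if k \<le> l \<and> even (l - k) \<and> even (j - k)
      then snd p ^ (l - k) / fact ((l - k) div 2) * lpow \<xi> k x * (norm \<xi> ^ (j - k) / fact ((j - k) div 2) * C) else 0)"
  proof (intro sum.cong refl)
    fix k
    define R where "R = lpow \<xi> k x * gauss_moment 0 0 \<xi> (j - k)"
    define T where "T i = h2 p ^ i / fact i * (if k \<le> l - 2 * i \<and> even (l - 2 * i - k)
       then norm x ^ (l - 2 * i - k) / fact ((l - 2 * i - k) div 2) * lpow \<xi> k x * gauss_moment 0 0 \<xi> (j - k) else 0)" for i
    have "(\<Sum>i\<le>l div 2. T i) = (if k \<le> l \<and> even (l - k) then snd p ^ (l - k) / fact ((l - k) div 2) * R else 0)"
    proof (cases "k \<le> l \<and> even (l - k)")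
      case False
      then have "T i = 0" if "i \<le> l div 2" for i
        using that by (auto simp: T_def)
      then show ?thesis using False by auto
    next
      case True
      then obtain M where l: "l = k + 2 * M"
        by (metis dvd_def le_add_diff_inverse)
      have "(\<Sum>i\<le>l div 2. T i) = (\<Sum>i\<le>M. T i)"
        by (rule sum.mono_neutral_right) (auto simp: l T_def)
      also have "\<dots> = (\<Sum>i\<le>M. h2 p ^ i / fact i * (norm (fst p) ^ (2 * (M - i)) / fact (M - i))) * R"
        unfolding sum_distrib_right
      proof (intro sum.cong refl)
        fix i assume "i \<in> {..M}"
        then have e: "l - 2 * i - k = 2 * (M - i)" "k \<le> l - 2 * i" by (auto simp: l)
        show "T i = h2 p ^ i / fact i * (norm (fst p) ^ (2 * (M - i)) / fact (M - i)) * R"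
          unfolding T_def e(1) using e(2) by (simp add: x_def R_def)
      qed
      also have "\<dots> = snd p ^ (2 * M) / fact M * R" unfolding sum_h2_norm_powers ..
      finally show ?thesis by (simp add: l)
    qed
    then show "(\<Sum>i\<le>l div 2. h2 p ^ i / fact i * (if k \<le> l - 2 * i \<and> even (l - 2 * i - k)
       then norm x ^ (l - 2 * i - k) / fact ((l - 2 * i - k) div 2) * lpow \<xi> k x * gauss_moment 0 0 \<xi> (j - k) else 0)) =
      (if k \<le> l \<and> even (l - k) \<and> even (j - k)
      then snd p ^ (l - k) / fact ((l - k) div 2) * lpow \<xi> k x * (norm \<xi> ^ (j - k) / fact ((j - k) div 2) * C) else 0)"
      unfolding T_def R_def gauss_moment_0_0 C_def by auto
  qed
  also have "\<dots> = C * (apair \<delta> (snd p) (norm \<xi>) (\<lambda>k. lpow \<xi> k (fst p)) l j * pochhammer \<delta> ((l + j) div 2))"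
  proof (cases "even (l + j)")
    case False
    then have "(\<Sum>k\<le>j. if k \<le> l \<and> even (l - k) \<and> even (j - k)
      then snd p ^ (l - k) / fact ((l - k) div 2) * lpow \<xi> k x * (norm \<xi> ^ (j - k) / fact ((j - k) div 2) * C) else 0) = 0"
      by (intro sum.neutral) auto
    then show ?thesis using False by (simp add: apair_def)
  next
    case True
    have pp: "pochhammer \<delta> ((l + j) div 2) > 0" using \<delta> by (rule pochhammer_pos)
    have "(\<Sum>k\<le>j. if k \<le> l \<and> even (l - k) \<and> even (j - k)
      then snd p ^ (l - k) / fact ((l - k) div 2) * lpow \<xi> k x * (norm \<xi> ^ (j - k) / fact ((j - k) div 2) * C) else 0) =
      (\<Sum>g\<le>j div 2. C * (if j - 2 * g \<le> l
        then snd p ^ (l + 2 * g - j) * norm \<xi> ^ (2 * g) / (fact ((l + 2 * g - j) div 2) * fact g) * lpow \<xi> (j - 2 * g) (fst p)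
        else 0))"
    proof (subst sum_even_offset, (auto)[1], intro sum.cong refl)
      fix g assume "g \<in> {..j div 2}"
      then have g: "2 * g \<le> j" by auto
      have e: "j - (j - 2 * g) = 2 * g" "l - (j - 2 * g) = l + 2 * g - j" using g by auto
      show "(if j - 2 * g \<le> l \<and> even (l - (j - 2 * g)) \<and> even (j - (j - 2 * g))
        then snd p ^ (l - (j - 2 * g)) / fact ((l - (j - 2 * g)) div 2) * lpow \<xi> (j - 2 * g) x *
          (norm \<xi> ^ (j - (j - 2 * g)) / fact ((j - (j - 2 * g)) div 2) * C) else 0) =
        C * (if j - 2 * g \<le> l
        then snd p ^ (l + 2 * g - j) * norm \<xi> ^ (2 * g) / (fact ((l + 2 * g - j) div 2) * fact g) * lpow \<xi> (j - 2 * g) (fst p)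
        else 0)"
        unfolding e
      proof (cases "j - 2 * g \<le> l")
        case le: True
        have "even (l + 2 * g - j)" "even (2 * g)" using True le g by (auto simp: even_diff_nat)
        then show "(if j - 2 * g \<le> l \<and> even (l + 2 * g - j) \<and> even (2 * g)
          then snd p ^ (l + 2 * g - j) / fact ((l + 2 * g - j) div 2) * lpow \<xi> (j - 2 * g) x *
            (norm \<xi> ^ (2 * g) / fact (2 * g div 2) * C) else 0) =
          C * (if j - 2 * g \<le> l
          then snd p ^ (l + 2 * g - j) * norm \<xi> ^ (2 * g) / (fact ((l + 2 * g - j) div 2) * fact g) * lpow \<xi> (j - 2 * g) (fst p)
          else 0)"
          using le by (simp only: if_True simp_thms) (simp add: x_def mult_ac)
      qed simp
    qed
    then show ?thesis using True pp unfolding apair_def sum_distrib_left[symmetric] by simp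
  qed
  finally show ?thesis unfolding C_def by (simp add: mult.assoc)
qed

lemma pspan_cone_integrable:
  assumes \<beta>: "\<beta> \<ge> 1 / 2" and \<mu>: "\<mu> \<ge> 0" and "f \<in> pspan n"
  shows "integrable lborel (\<lambda>p. f p * cw \<beta> \<mu> p)"
  using assms(3)
proof (induction rule: pspan.induct)
  case (monom a k)
  let ?f = "\<lambda>p :: (real ^ 'a) \<times> real. (\<Prod>i\<in>UNIV. (fst p $ i) ^ a i) * snd p ^ k"
  show ?case
  proof (rule cone_integrable[OF \<beta> \<mu>, where C = 1])
    show "?f \<in> borel_measurable borel"
      by (rule pspan_borel[OF pspan.monom[OF order_refl]])
    fix p :: "(real ^ 'a) \<times> real" assume "p \<in> double_cone"
    then have p: "norm (fst p) \<le> \<bar>snd p\<bar>" by (auto simp: double_cone_def)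
    have "\<bar>fst p $ i\<bar> \<le> \<bar>snd p\<bar>" for i
      using component_le_norm_cart[of "fst p" i] p by simp
    then have "(\<Prod>i\<in>UNIV. \<bar>fst p $ i\<bar> ^ a i) \<le> (\<Prod>i\<in>UNIV. \<bar>snd p\<bar> ^ a i)"
      by (intro prod_mono conjI power_mono) auto
    then have "\<bar>?f p\<bar> \<le> \<bar>snd p\<bar> ^ (\<Sum>i\<in>UNIV. a i) * \<bar>snd p\<bar> ^ k"
      unfolding abs_mult abs_prod power_abs power_sum by (intro mult_right_mono) auto
    then show "\<bar>?f p\<bar> \<le> 1 * \<bar>snd p\<bar> ^ ((\<Sum>i\<in>UNIV. a i) + k)"
      by (simp add: power_add)
  qed
qed (auto simp: distrib_right mult.assoc)

lemma cone_mean_sum: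
  assumes \<beta>: "\<beta> \<ge> 1 / 2" and \<mu>: "\<mu> \<ge> 0" and f: "\<And>i. i \<in> I \<Longrightarrow> f i \<in> pspan n"
  shows "cone_mean \<beta> \<mu> (\<lambda>p. \<Sum>i\<in>I. c i * f i p) = (\<Sum>i\<in>I. c i * cone_mean \<beta> \<mu> (f i))"
proof -
  have "(\<integral>p. (\<Sum>i\<in>I. c i * f i p) * cw \<beta> \<mu> p \<partial>lborel) = (\<integral>p. (\<Sum>i\<in>I. c i * (f i p * cw \<beta> \<mu> p)) \<partial>lborel)"
    by (simp add: sum_distrib_right mult.assoc)
  also have "\<dots> = (\<Sum>i\<in>I. c i * (\<integral>p. f i p * cw \<beta> \<mu> p \<partial>lborel))"
    using pspan_cone_integrable[OF \<beta> \<mu> f] by (subst Bochner_Integration.integral_sum) auto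
  finally show ?thesis by (simp add: cone_mean_def sum_divide_distrib)
qed

lemma cone_mean_add:
  assumes "\<beta> \<ge> 1 / 2" "\<mu> \<ge> 0" "f \<in> pspan n" "g \<in> pspan n"
  shows "cone_mean \<beta> \<mu> (\<lambda>p. f p + g p) = cone_mean \<beta> \<mu> f + cone_mean \<beta> \<mu> g"
  using pspan_cone_integrable[OF assms(1,2,3)] pspan_cone_integrable[OF assms(1,2,4)]
  by (simp add: cone_mean_def distrib_right add_divide_distrib)

lemma cone_mean_cmult: "cone_mean \<beta> \<mu> (\<lambda>p. c * f p) = c * cone_mean \<beta> \<mu> f"
  by (simp add: cone_mean_def mult.assoc)

lemma apair_0_0: "apair \<delta> t b A 0 0 = A 0"
  by (simp add: apair_def)

lemma cone_total:
  assumes \<beta>: "\<beta> \<ge> 1 / 2" and \<mu>: "\<mu> \<ge> 0"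
  shows "(\<integral>p. cw \<beta> \<mu> (p :: (real ^ 'd) \<times> real) \<partial>lborel) =
    Gamma (\<beta> + \<mu> + real CARD('d) / 2) / Gamma (\<mu> + (real CARD('d) + 1) / 2) *
      (Gamma (\<mu> + 1 / 2) * gauss_total TYPE(real ^ 'd))"
proof -
  have "(\<integral>p. cw (1 / 2) \<mu> (p :: (real ^ 'd) \<times> real) \<partial>lborel) = Gamma (\<mu> + 1 / 2) * gauss_total TYPE(real ^ 'd)"
    using hexp_lpow_integral_half[OF \<mu>, of 0 "0 :: (real ^ 'd) \<times> real" 0 0]
    by (simp add: apair_0_0 hexp_def lpow_def)
  then show ?thesis
    using even_hom_integral[OF \<beta> \<mu>, of "\<lambda>_ :: (real ^ 'd) \<times> real. 1" 0 0] by (simp add: even_hom_def)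
qed

text \<open>Normalization removes \<open>Gamma (\<mu> + 1 / 2)\<close> and the Gaussian mass. If
  \<open>l + j\<close> is even, the Gamma arguments differ from \<open>\<gamma>\<close> and
  \<open>\<delta>\<close> by integers, and the symbol in \<open>\<delta>\<close> cancels; if it is
  odd, both sides are zero.\<close>

lemma cone_mean_hexp_lpow:
  fixes p :: "(real ^ 'd) \<times> real"
  assumes \<beta>: "\<beta> \<ge> 1 / 2" and \<mu>: "\<mu> \<ge> 0"
  defines "\<delta> \<equiv> \<mu> + (real CARD('d) + 1) / 2" and "\<gamma> \<equiv> \<beta> + \<mu> + real CARD('d) / 2"
  shows "cone_mean \<beta> \<mu> (\<lambda>q. snd q ^ (2 * i) * (hexp \<mu> l p q * lpow \<xi> j (fst q))) =
    pochhammer \<gamma> (i + (l + j) div 2) * apair \<delta> (snd p) (norm \<xi>) (\<lambda>k. lpow \<xi> k (fst p)) l j"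
proof -
  define A where "A = apair \<delta> (snd p) (norm \<xi>) (\<lambda>k. lpow \<xi> k (fst p)) l j"
  define h where "h = (l + j) div 2"
  define c where "c = Gamma (\<mu> + 1 / 2) * gauss_total TYPE(real ^ 'd)"
  have \<delta>: "\<delta> > 0" using \<mu> unfolding \<delta>_def by (intro add_nonneg_pos) auto
  have \<gamma>: "\<gamma> > 0" using \<mu> \<beta> unfolding \<gamma>_def by (intro add_nonneg_pos) auto
  have c: "c > 0" unfolding c_def using \<mu> by (intro mult_pos_pos Gamma_real_pos gauss_total_pos) auto
  have half: "(\<integral>q. hexp \<mu> l p q * lpow \<xi> j (fst q) * cw (1 / 2) \<mu> q \<partial>lborel) = c * (A * pochhammer \<delta> h)"
    unfolding hexp_lpow_integral_half[OF \<mu>] c_def A_def h_def \<delta>_def ..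
  have "continuous_on UNIV (\<lambda>q. hexp \<mu> l p q * lpow \<xi> j (fst q))"
    by (intro pspan_continuous[OF pspan_mult[OF pspan_hexp pspan_lpow]])
  from even_hom_integral[OF \<beta> \<mu> this even_hom_mult[OF even_hom_hexp even_hom_lpow], of i]
  have full: "(\<integral>q. snd q ^ (2 * i) * (hexp \<mu> l p q * lpow \<xi> j (fst q)) * cw \<beta> \<mu> q \<partial>lborel) =
    Gamma (real (l + j) / 2 + real i + \<gamma>) / Gamma (real (l + j) / 2 + \<delta>) * (c * (A * pochhammer \<delta> h))"
    unfolding half \<gamma>_def \<delta>_def .
  show ?thesis
  proof (cases "even (l + j)")
    case False
    then have "A = 0" by (simp add: A_def apair_def)
    then show ?thesis using full unfolding A_def[symmetric] by (simp add: cone_mean_def)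
  next
    case True
    then have "real (l + j) / 2 = real h" by (simp add: h_def real_of_nat_div del: of_nat_add)
    then have 1: "Gamma (real (l + j) / 2 + real i + \<gamma>) = pochhammer \<gamma> (i + h) * Gamma \<gamma>"
      "Gamma (real (l + j) / 2 + \<delta>) = pochhammer \<delta> h * Gamma \<delta>"
      using Gamma_shift[OF \<gamma>, of "i + h"] Gamma_shift[OF \<delta>, of h] by (simp_all add: add.commute)
    have 2: "(\<integral>q. cw \<beta> \<mu> (q :: (real ^ 'd) \<times> real) \<partial>lborel) = Gamma \<gamma> / Gamma \<delta> * c"
      unfolding cone_total[OF \<beta> \<mu>] \<gamma>_def \<delta>_def c_def ..
    have "Gamma \<gamma> > 0" "Gamma \<delta> > 0" "pochhammer \<delta> h > 0"
      using \<gamma> \<delta> by (auto intro: Gamma_real_pos pochhammer_pos)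
    then show ?thesis
      unfolding cone_mean_def full 1 2 A_def[symmetric] h_def[symmetric] using c by simp
  qed
qed

section \<open>Zonal test polynomials and the candidate kernels\<close>

text \<open>The Gegenbauer polynomial behind \<open>zc\<close>, taken at the quotient of
  \<open>\<xi> \<bullet> x\<close> and \<open>t * norm \<xi>\<close> and homogenized to degree
  \<open>m\<close>. Since \<open>t\<close> occurs in even powers, it is a polynomial even in
  \<open>t\<close>.\<close>

definition zonal :: "real \<Rightarrow> nat \<Rightarrow> real ^ 'd \<Rightarrow> (real ^ 'd) \<times> real \<Rightarrow> real" where
  "zonal \<delta> m \<xi> q = (\<Sum>i\<le>m div 2. zc \<delta> m i * (snd q * norm \<xi>) ^ (2 * i) * lpow \<xi> (m - 2 * i) (fst q))"

lemma pspan_snd_power_mult: "f \<in> pspan n \<Longrightarrow> n + k \<le> m \<Longrightarrow> (\<lambda>q. snd q ^ k * f q) \<in> pspan m"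
  using pspan_mono[OF pspan_mult[OF pspan_power[OF pspan_snd, of k], of f n]] by simp

lemma pspan_zonal: "zonal \<delta> m \<xi> \<in> pspan m"
proof -
  have "(\<lambda>q. \<Sum>i\<le>m div 2. (zc \<delta> m i * norm \<xi> ^ (2 * i)) * (snd q ^ (2 * i) * lpow \<xi> (m - 2 * i) (fst q))) \<in> pspan m"
    by (intro pspan_sum pspan.cmult pspan_snd_power_mult[OF pspan_lpow]) auto
  then show ?thesis by (simp add: zonal_def[abs_def] power_mult_distrib mult_ac)
qed

text \<open>In the \<open>i\<close>-th term of \<open>zonal\<close> the power of
  \<open>snd q\<close> rises by \<open>2 * i\<close> while the degree in
  \<open>\<xi> \<bullet> x\<close> drops by \<open>2 * i\<close>. The index of the symbol in
  \<open>\<gamma>\<close> is therefore common to all terms and factors out, leaving the sum of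
  \<open>apair_zonal\<close>.\<close>

lemma cone_mean_hexp_zonal:
  fixes p :: "(real ^ 'd) \<times> real"
  assumes \<beta>: "\<beta> \<ge> 1 / 2" and \<mu>: "\<mu> \<ge> 0"
  defines "\<delta> \<equiv> \<mu> + (real CARD('d) + 1) / 2" and "\<gamma> \<equiv> \<beta> + \<mu> + real CARD('d) / 2"
  shows "cone_mean \<beta> \<mu> (\<lambda>q. snd q ^ (2 * w) * (hexp \<mu> l p q * zonal \<delta> m \<xi> q)) =
    pochhammer \<gamma> (w + (l + m) div 2) * ((if m \<le> l \<and> even (l + m)
      then snd p ^ (l - m) / (fact ((l - m) div 2) * pochhammer \<delta> ((l + m) div 2)) else 0) * zonal \<delta> m \<xi> p)"
proof -
  have \<delta>: "\<delta> > 0" using \<mu> unfolding \<delta>_def by (intro add_nonneg_pos) auto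
  have eq: "(\<lambda>q. snd q ^ (2 * w) * (hexp \<mu> l p q * zonal \<delta> m \<xi> q)) =
    (\<lambda>q. \<Sum>i\<le>m div 2. (zc \<delta> m i * norm \<xi> ^ (2 * i)) *
      (snd q ^ (2 * (w + i)) * (hexp \<mu> l p q * lpow \<xi> (m - 2 * i) (fst q))))"
    unfolding zonal_def sum_distrib_left
    by (intro ext sum.cong refl) (simp add: power_mult_distrib power_add mult_ac)
  have "cone_mean \<beta> \<mu> (\<lambda>q. snd q ^ (2 * w) * (hexp \<mu> l p q * zonal \<delta> m \<xi> q)) = (\<Sum>i\<le>m div 2. (zc \<delta> m i * norm \<xi> ^ (2 * i)) *
      cone_mean \<beta> \<mu> (\<lambda>q. snd q ^ (2 * (w + i)) * (hexp \<mu> l p q * lpow \<xi> (m - 2 * i) (fst q))))"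
    unfolding eq
    by (intro cone_mean_sum[OF \<beta> \<mu>, where n = "2 * w + l + m"] pspan_snd_power_mult[OF pspan_mult[OF pspan_hexp pspan_lpow]]) auto
  also have "\<dots> = (\<Sum>i\<le>m div 2. pochhammer \<gamma> (w + (l + m) div 2) *
      (zc \<delta> m i * norm \<xi> ^ (2 * i) * apair \<delta> (snd p) (norm \<xi>) (\<lambda>k. lpow \<xi> k (fst p)) l (m - 2 * i)))"
  proof (intro sum.cong refl)
    fix i assume "i \<in> {..m div 2}"
    then have e: "w + i + (l + (m - 2 * i)) div 2 = w + (l + m) div 2" by auto
    show "(zc \<delta> m i * norm \<xi> ^ (2 * i)) *
      cone_mean \<beta> \<mu> (\<lambda>q. snd q ^ (2 * (w + i)) * (hexp \<mu> l p q * lpow \<xi> (m - 2 * i) (fst q))) =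
      pochhammer \<gamma> (w + (l + m) div 2) *
      (zc \<delta> m i * norm \<xi> ^ (2 * i) * apair \<delta> (snd p) (norm \<xi>) (\<lambda>k. lpow \<xi> k (fst p)) l (m - 2 * i))"
      unfolding cone_mean_hexp_lpow[OF \<beta> \<mu>] e \<delta>_def \<gamma>_def by simp
  qed
  also have "\<dots> = pochhammer \<gamma> (w + (l + m) div 2) * ((if m \<le> l \<and> even (l + m)
      then snd p ^ (l - m) / (fact ((l - m) div 2) * pochhammer \<delta> ((l + m) div 2)) else 0) * zonal \<delta> m \<xi> p)"
    unfolding sum_distrib_left[symmetric] apair_zonal[OF \<delta>] zonal_def by simp
  finally show ?thesis .
qed

text \<open>For \<open>\<beta> > 1 / 2\<close> and \<open>\<mu> > 0\<close>, on the cone, this is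
  the average of \<open>(2 * \<phi>) ^ n / fact n\<close> over the cube; \<open>2 * k\<close> is the
  number of factors taken from the summand with \<open>z2\<close>. At \<open>\<beta> = 1 / 2\<close>
  only \<open>k = 0\<close> survives, as \<open>rothe 0 k = 0\<close> for \<open>k > 0\<close>, and
  \<open>gexp\<close> reduces to \<open>hexp\<close>.\<close>

definition gexp :: "real \<Rightarrow> real \<Rightarrow> nat \<Rightarrow> (real ^ 'd) \<times> real \<Rightarrow> (real ^ 'd) \<times> real \<Rightarrow> real" where
  "gexp \<beta> \<mu> n p q = (\<Sum>k\<le>n div 2. pochhammer (\<mu> + (real CARD('d) + 1) / 2) (n - 2 * k) * rothe (\<beta> - 1 / 2) k /
     pochhammer (\<beta> + \<mu> + real CARD('d) / 2) n * (snd p * snd q) ^ (2 * k) * hexp \<mu> (n - 2 * k) p q)"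

lemma pspan_gexp: "gexp \<beta> \<mu> n p \<in> pspan n"
proof -
  have "(\<lambda>q. \<Sum>k\<le>n div 2. (pochhammer (\<mu> + (real CARD('a) + 1) / 2) (n - 2 * k) * rothe (\<beta> - 1 / 2) k /
     pochhammer (\<beta> + \<mu> + real CARD('a) / 2) n * snd p ^ (2 * k)) * (snd q ^ (2 * k) * hexp \<mu> (n - 2 * k) p q)) \<in> pspan n"
    by (intro pspan_sum pspan.cmult pspan_snd_power_mult[OF pspan_hexp]) auto
  then show ?thesis by (simp add: gexp_def[abs_def] power_mult_distrib mult_ac)
qed

text \<open>\<open>sum_rothe_pair\<close> leaves only symbols in \<open>\<gamma>\<close>, of lengths
  \<open>w + (n + m) div 2\<close> and \<open>(n + m) div 2\<close>. Their quotient is the symbol of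
  length \<open>w\<close> on the right.\<close>

lemma cone_mean_gexp_zonal:
  fixes p :: "(real ^ 'd) \<times> real"
  assumes \<beta>: "\<beta> \<ge> 1 / 2" and \<mu>: "\<mu> \<ge> 0"
  defines "\<delta> \<equiv> \<mu> + (real CARD('d) + 1) / 2" and "\<gamma> \<equiv> \<beta> + \<mu> + real CARD('d) / 2"
  shows "cone_mean \<beta> \<mu> (\<lambda>q. snd q ^ (2 * w) * (gexp \<beta> \<mu> n p q * zonal \<delta> m \<xi> q)) =
    (if m \<le> n \<and> even (n + m)
     then pochhammer (\<gamma> + (real n + real m) / 2) w * snd p ^ (n - m) / fact ((n - m) div 2) else 0) * zonal \<delta> m \<xi> p"
proof -
  have \<delta>: "\<delta> > 0" using \<mu> unfolding \<delta>_def by (intro add_nonneg_pos) auto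
  have \<gamma>: "\<gamma> > 0" using \<mu> \<beta> unfolding \<gamma>_def by (intro add_nonneg_pos) auto
  have \<kappa>: "\<beta> - 1 / 2 \<ge> 0" using \<beta> by simp
  have \<gamma>\<delta>: "\<delta> + (\<beta> - 1 / 2) = \<gamma>" by (simp add: \<delta>_def \<gamma>_def field_simps)
  define c where "c k = pochhammer \<delta> (n - 2 * k) * rothe (\<beta> - 1 / 2) k / pochhammer \<gamma> n * snd p ^ (2 * k)" for k
  have eq: "(\<lambda>q. snd q ^ (2 * w) * (gexp \<beta> \<mu> n p q * zonal \<delta> m \<xi> q)) =
    (\<lambda>q. \<Sum>k\<le>n div 2. c k * (snd q ^ (2 * (w + k)) * (hexp \<mu> (n - 2 * k) p q * zonal \<delta> m \<xi> q)))"
    unfolding gexp_def sum_distrib_left sum_distrib_right c_def \<delta>_def[symmetric] \<gamma>_def[symmetric]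
    by (intro ext sum.cong refl) (simp add: power_mult_distrib power_add mult_ac)
  have "cone_mean \<beta> \<mu> (\<lambda>q. snd q ^ (2 * w) * (gexp \<beta> \<mu> n p q * zonal \<delta> m \<xi> q)) = (\<Sum>k\<le>n div 2. c k *
      cone_mean \<beta> \<mu> (\<lambda>q. snd q ^ (2 * (w + k)) * (hexp \<mu> (n - 2 * k) p q * zonal \<delta> m \<xi> q)))"
    unfolding eq
    by (intro cone_mean_sum[OF \<beta> \<mu>, where n = "2 * w + n + m"] pspan_snd_power_mult[OF pspan_mult[OF pspan_hexp pspan_zonal]]) auto
  also have "\<dots> = (\<Sum>k\<le>n div 2. pochhammer \<gamma> (w + (n + m) div 2) * zonal \<delta> m \<xi> p *
     (c k * (if m \<le> n - 2 * k \<and> even (n - 2 * k + m)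
       then snd p ^ (n - 2 * k - m) / (fact ((n - 2 * k - m) div 2) * pochhammer \<delta> ((n - 2 * k + m) div 2)) else 0)))"
  proof (intro sum.cong refl)
    fix k assume "k \<in> {..n div 2}"
    then have e: "w + k + (n - 2 * k + m) div 2 = w + (n + m) div 2" by auto
    show "c k * cone_mean \<beta> \<mu> (\<lambda>q. snd q ^ (2 * (w + k)) * (hexp \<mu> (n - 2 * k) p q * zonal \<delta> m \<xi> q)) =
      pochhammer \<gamma> (w + (n + m) div 2) * zonal \<delta> m \<xi> p *
     (c k * (if m \<le> n - 2 * k \<and> even (n - 2 * k + m)
       then snd p ^ (n - 2 * k - m) / (fact ((n - 2 * k - m) div 2) * pochhammer \<delta> ((n - 2 * k + m) div 2)) else 0))"
      using cone_mean_hexp_zonal[OF \<beta> \<mu>, of "w + k" "n - 2 * k" p m \<xi>]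
      unfolding e \<delta>_def[symmetric] \<gamma>_def[symmetric] by simp
  qed
  also have "\<dots> = pochhammer \<gamma> (w + (n + m) div 2) * zonal \<delta> m \<xi> p *
     (if m \<le> n \<and> even (n + m)
     then snd p ^ (n - m) / (fact ((n - m) div 2) * pochhammer \<gamma> ((n + m) div 2)) else 0)"
    unfolding sum_distrib_left[symmetric] c_def
    using sum_rothe_pair[OF \<delta> \<kappa>, of n "snd p" m] unfolding \<gamma>\<delta> by (simp only:)
  also have "\<dots> = (if m \<le> n \<and> even (n + m)
     then pochhammer (\<gamma> + (real n + real m) / 2) w * snd p ^ (n - m) / fact ((n - m) div 2) else 0) * zonal \<delta> m \<xi> p"
  proof (cases "m \<le> n \<and> even (n + m)")
    case True
    then have r: "real ((n + m) div 2) = (real n + real m) / 2" by (simp add: real_of_nat_div)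
    have "pochhammer \<gamma> (w + (n + m) div 2) = pochhammer \<gamma> ((n + m) div 2) * pochhammer (\<gamma> + (real n + real m) / 2) w"
      unfolding r[symmetric] add.commute[of w] by (rule pochhammer_product')
    moreover have "pochhammer \<gamma> ((n + m) div 2) > 0" using \<gamma> by (rule pochhammer_pos)
    ultimately show ?thesis using True by simp
  qed auto
  finally show ?thesis .
qed

text \<open>The coefficient of \<open>r ^ N\<close> after re-expansion: \<open>n = N - 2 * i\<close>
  is the index of \<open>gexp\<close>, \<open>j\<close> the order in the exponential series, and
  \<open>i - j\<close> the order in the binomial series of \<open>1 - r\<^sup>2\<close> to the power
  \<open>- (\<gamma> + n + j)\<close>.\<close>

definition kern :: "real \<Rightarrow> real \<Rightarrow> nat \<Rightarrow> (real ^ 'd) \<times> real \<Rightarrow> (real ^ 'd) \<times> real \<Rightarrow> real" where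
  "kern \<beta> \<mu> N p q = (\<Sum>i\<le>N div 2. \<Sum>j\<le>i. (-1) ^ j / fact j *
     (pochhammer (\<beta> + \<mu> + real CARD('d) / 2 + real (N - 2 * i) + real j) (i - j) / fact (i - j)) *
     (((snd p)\<^sup>2 + (snd q)\<^sup>2) ^ j * gexp \<beta> \<mu> (N - 2 * i) p q))"

lemma pspan_sq_sum_power: "(\<lambda>q. (c + (snd q)\<^sup>2) ^ j) \<in> pspan (j * 2)"
  using pspan_power[OF pspan_snd, of 2] by (intro pspan_power pspan.add pspan_const) simp

lemma pspan_kern: "kern \<beta> \<mu> N p \<in> pspan N"
  unfolding kern_def
proof (intro pspan_sum pspan.cmult)
  fix i j assume "i \<in> {..N div 2}" "j \<in> {..i}"
  then have "j * 2 + (N - 2 * i) \<le> N" by auto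
  then show "(\<lambda>q. ((snd p)\<^sup>2 + (snd q)\<^sup>2) ^ j * gexp \<beta> \<mu> (N - 2 * i) p q) \<in> pspan N"
    by (rule pspan_mono[OF pspan_mult[OF pspan_sq_sum_power pspan_gexp]])
qed

lemma kern_even: "kern \<beta> \<mu> N p (x, - t) = kern \<beta> \<mu> N p (x, t)"
  by (simp add: kern_def gexp_def hexp_def h2_def power_mult_distrib)

lemma cone_mean_kern_zonal:
  fixes p :: "(real ^ 'd) \<times> real"
  assumes \<beta>: "\<beta> \<ge> 1 / 2" and \<mu>: "\<mu> \<ge> 0"
  defines "\<delta> \<equiv> \<mu> + (real CARD('d) + 1) / 2" and "\<gamma> \<equiv> \<beta> + \<mu> + real CARD('d) / 2"
  shows "cone_mean \<beta> \<mu> (\<lambda>q. kern \<beta> \<mu> N p q * (snd q ^ (2 * e) * zonal \<delta> m \<xi> q)) =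
    kcoef \<gamma> m e (snd p) N * zonal \<delta> m \<xi> p"
proof -
  define a where "a i j = (-1) ^ j / fact j * (pochhammer (\<gamma> + real (N - 2 * i) + real j) (i - j) / fact (i - j))" for i j
  define F where "F i j k q = snd q ^ (2 * (e + (j - k))) * (gexp \<beta> \<mu> (N - 2 * i) p q * zonal \<delta> m \<xi> q)" for i j k :: nat and q
  have F: "F i j k \<in> pspan (2 * e + 2 * N + m)" if "i \<le> N div 2" "j \<le> i" for i j k
    unfolding F_def using that
    by (intro pspan_snd_power_mult[OF pspan_mult[OF pspan_gexp pspan_zonal]]) auto
  have pw: "((snd p)\<^sup>2 + (snd q)\<^sup>2) ^ j = (\<Sum>k\<le>j. real (j choose k) * snd p ^ (2 * k) * snd q ^ (2 * (j - k)))" for j and q :: "(real ^ 'd) \<times> real"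
    unfolding binomial_ring by (simp add: power_mult)
  have eq: "(\<lambda>q. kern \<beta> \<mu> N p q * (snd q ^ (2 * e) * zonal \<delta> m \<xi> q)) =
    (\<lambda>q. \<Sum>i\<le>N div 2. 1 * (\<Sum>j\<le>i. a i j * (\<Sum>k\<le>j. (real (j choose k) * snd p ^ (2 * k)) * F i j k q)))"
    unfolding kern_def pw a_def F_def \<gamma>_def[symmetric] distrib_left[of "2 :: nat"] power_add
    by (intro ext) (simp add: sum_distrib_left sum_distrib_right mult_ac)
  have "cone_mean \<beta> \<mu> (\<lambda>q. kern \<beta> \<mu> N p q * (snd q ^ (2 * e) * zonal \<delta> m \<xi> q)) = (\<Sum>i\<le>N div 2. 1 * cone_mean \<beta> \<mu> (\<lambda>q. \<Sum>j\<le>i. a i j *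
      (\<Sum>k\<le>j. (real (j choose k) * snd p ^ (2 * k)) * F i j k q)))"
    unfolding eq
    by (intro cone_mean_sum[OF \<beta> \<mu>, where n = "2 * e + 2 * N + m"] pspan_sum pspan.cmult F) auto
  also have "\<dots> = (\<Sum>i\<le>N div 2. 1 * (\<Sum>j\<le>i. a i j * cone_mean \<beta> \<mu>
      (\<lambda>q. \<Sum>k\<le>j. (real (j choose k) * snd p ^ (2 * k)) * F i j k q)))"
    by (intro sum.cong refl arg_cong2[of _ _ _ _ "(*)"] cone_mean_sum[OF \<beta> \<mu>, where n = "2 * e + 2 * N + m"] pspan_sum pspan.cmult F) auto
  also have "\<dots> = (\<Sum>i\<le>N div 2. 1 * (\<Sum>j\<le>i. a i j * (\<Sum>k\<le>j. (real (j choose k) * snd p ^ (2 * k)) *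
      cone_mean \<beta> \<mu> (F i j k))))"
    by (intro sum.cong refl arg_cong2[of _ _ _ _ "(*)"] cone_mean_sum[OF \<beta> \<mu>, where n = "2 * e + 2 * N + m"] F) auto
  also have "\<dots> = kcoef \<gamma> m e (snd p) N * zonal \<delta> m \<xi> p"
    unfolding F_def \<delta>_def cone_mean_gexp_zonal[OF \<beta> \<mu>]
    unfolding \<delta>_def[symmetric] \<gamma>_def[symmetric] kcoef_def a_def
    by (simp add: sum_distrib_right mult.assoc)
  finally show ?thesis .
qed

section \<open>The reproducing property\<close>

text \<open>The claim about \<open>kern\<close>, packaged as a set of test functions closed under
  linear combinations, the form required by \<open>polarization\<close>. The first clause gives
  orthogonality of the kernels to lower degrees, the second reproduction by their sum.\<close>

definition reproduced :: "real \<Rightarrow> real \<Rightarrow> nat \<Rightarrow> ((real ^ 'd) \<times> real \<Rightarrow> real) set" where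
  "reproduced \<beta> \<mu> n = {f \<in> pspan n. \<forall>p. (\<forall>N>n. cone_mean \<beta> \<mu> (\<lambda>q. kern \<beta> \<mu> N p q * f q) = 0) \<and>
     (\<Sum>N\<le>n. cone_mean \<beta> \<mu> (\<lambda>q. kern \<beta> \<mu> N p q * f q)) = f p}"

lemma reproduced_lower: "f \<in> reproduced \<beta> \<mu> n \<Longrightarrow> n < N \<Longrightarrow> cone_mean \<beta> \<mu> (\<lambda>q. kern \<beta> \<mu> N p q * f q) = 0"
  unfolding reproduced_def by blast

lemma reproduced_total: "f \<in> reproduced \<beta> \<mu> n \<Longrightarrow> (\<Sum>N\<le>n. cone_mean \<beta> \<mu> (\<lambda>q. kern \<beta> \<mu> N p q * f q)) = f p"
  unfolding reproduced_def by blast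

lemma pspan_reflect:
  assumes "f \<in> pspan n"
  shows "(\<lambda>q. f (fst q, - snd q)) \<in> pspan n"
  using assms
proof (induction rule: pspan.induct)
  case (monom a k)
  have "(\<lambda>p :: (real ^ 'a) \<times> real. (-1) ^ k * ((\<Prod>i\<in>UNIV. (fst p $ i) ^ a i) * snd p ^ k)) \<in> pspan n"
    by (intro pspan.cmult pspan.monom monom)
  then show ?case by (simp add: power_minus[of "snd _"] mult_ac)
qed (auto intro: pspan.intros)

text \<open>The pairing of \<open>K q\<close> with \<open>L p\<close> equals \<open>K q p\<close>
  when \<open>L\<close> reproduces and \<open>L p q\<close> when \<open>K\<close> does; and
  \<open>K\<close> itself is symmetric, because \<open>ip\<close> is.\<close>

lemma reproducing_kernel_unique:
  assumes sym: "\<And>f g. ip f g = ip g f"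
    and K: "is_reproducing_kernel ip V K" and L: "is_reproducing_kernel ip V L"
  shows "K = L"
proof (intro ext)
  fix p q
  have "K p q = ip (K p) (K q)" "K q p = ip (K q) (K p)" "K q p = ip (K q) (L p)" "L p q = ip (L p) (K q)"
    using K L unfolding is_reproducing_kernel_def by metis+
  then show "K p q = L p q" using sym by metis
qed

context
  fixes \<beta> \<mu> :: real
  assumes \<beta>: "\<beta> \<ge> 1 / 2" and \<mu>: "\<mu> \<ge> 0"
begin

lemma reproduced_add:
  assumes "f \<in> reproduced \<beta> \<mu> n" "g \<in> reproduced \<beta> \<mu> n"
  shows "(\<lambda>q. f q + g q) \<in> reproduced \<beta> \<mu> n"
proof -
  have fg: "f \<in> pspan n" "g \<in> pspan n" using assms by (auto simp: reproduced_def)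
  have "cone_mean \<beta> \<mu> (\<lambda>q. kern \<beta> \<mu> N p q * (f q + g q)) =
    cone_mean \<beta> \<mu> (\<lambda>q. kern \<beta> \<mu> N p q * f q) + cone_mean \<beta> \<mu> (\<lambda>q. kern \<beta> \<mu> N p q * g q)" for N p
    unfolding distrib_left
    by (intro cone_mean_add[OF \<beta> \<mu>, where n = "N + n"] pspan_mult[OF pspan_kern] fg)
  then show ?thesis using assms by (simp add: reproduced_def sum.distrib pspan.add)
qed

lemma reproduced_cmult:
  assumes "f \<in> reproduced \<beta> \<mu> n"
  shows "(\<lambda>q. c * f q) \<in> reproduced \<beta> \<mu> n"
proof -
  have "cone_mean \<beta> \<mu> (\<lambda>q. kern \<beta> \<mu> N p q * (c * f q)) = c * cone_mean \<beta> \<mu> (\<lambda>q. kern \<beta> \<mu> N p q * f q)" for N p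
    unfolding mult.left_commute[of _ c] by (rule cone_mean_cmult)
  then show ?thesis using assms by (simp add: reproduced_def pspan.cmult sum_distrib_left[symmetric])
qed

lemma reproduced_0: "(\<lambda>q. 0) \<in> reproduced \<beta> \<mu> n"
  by (simp add: reproduced_def pspan.zero cone_mean_def)

lemma reproduced_sum:
  "(\<And>i. i \<in> I \<Longrightarrow> f i \<in> reproduced \<beta> \<mu> n) \<Longrightarrow> (\<lambda>q. \<Sum>i\<in>I. f i q) \<in> reproduced \<beta> \<mu> n"
  by (induction I rule: infinite_finite_induct) (auto intro: reproduced_add reproduced_0)

lemma reproduced_zonal:
  fixes \<xi> :: "real ^ 'd"
  assumes "m + 2 * e \<le> n"
  shows "(\<lambda>q. snd q ^ (2 * e) * zonal (\<mu> + (real CARD('d) + 1) / 2) m \<xi> q) \<in> reproduced \<beta> \<mu> n"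
proof -
  have "kcoef (\<beta> + \<mu> + real CARD('d) / 2) m e t N = 0" if "N > n" for t N
    using that assms by (intro kcoef_eq_0) auto
  then show ?thesis
    unfolding reproduced_def using assms
    by (auto simp: cone_mean_kern_zonal[OF \<beta> \<mu>] sum_distrib_right[symmetric] sum_kcoef
      intro!: pspan_snd_power_mult[OF pspan_zonal])
qed

text \<open>The zonal polynomial of degree \<open>m\<close> is monic in \<open>lpow \<xi> m\<close>.\<close>

lemma reproduced_lpow:
  fixes \<xi> :: "real ^ 'd"
  assumes "m + 2 * e \<le> n"
  shows "(\<lambda>q. snd q ^ (2 * e) * lpow \<xi> m (fst q)) \<in> reproduced \<beta> \<mu> n"
  using assms
proof (induction m arbitrary: e rule: less_induct)
  case (less m)
  define \<delta> where "\<delta> = \<mu> + (real CARD('d) + 1) / 2"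
  define T where "T i q = snd q ^ (2 * (e + i)) * lpow \<xi> (m - 2 * i) (fst q)" for i :: nat and q
  have split: "{..m div 2} = insert 0 {1..m div 2}" by auto
  have "zonal \<delta> m \<xi> q = lpow \<xi> m (fst q) +
    (\<Sum>i\<in>{1..m div 2}. zc \<delta> m i * (snd q * norm \<xi>) ^ (2 * i) * lpow \<xi> (m - 2 * i) (fst q))" for q
    unfolding zonal_def split by (subst sum.insert) (auto simp: zc_def)
  then have "snd q ^ (2 * e) * lpow \<xi> m (fst q) = snd q ^ (2 * e) * zonal \<delta> m \<xi> q +
    (-1) * (snd q ^ (2 * e) * (\<Sum>i\<in>{1..m div 2}. zc \<delta> m i * (snd q * norm \<xi>) ^ (2 * i) * lpow \<xi> (m - 2 * i) (fst q)))" for q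
    by (simp add: algebra_simps)
  moreover have "snd q ^ (2 * e) * (\<Sum>i\<in>{1..m div 2}. zc \<delta> m i * (snd q * norm \<xi>) ^ (2 * i) * lpow \<xi> (m - 2 * i) (fst q)) =
    (\<Sum>i\<in>{1..m div 2}. (zc \<delta> m i * norm \<xi> ^ (2 * i)) * T i q)" for q
    unfolding sum_distrib_left T_def
    by (intro sum.cong refl) (simp add: power_mult_distrib power_add mult_ac)
  ultimately have eq: "(\<lambda>q. snd q ^ (2 * e) * lpow \<xi> m (fst q)) = (\<lambda>q. snd q ^ (2 * e) * zonal \<delta> m \<xi> q +
    (-1) * (\<Sum>i\<in>{1..m div 2}. (zc \<delta> m i * norm \<xi> ^ (2 * i)) * T i q))"
    by (intro ext) (simp only:)
  \<comment> \<open>Here \<open>m\<close> drops by \<open>2 * i\<close> while \<open>e\<close> grows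
    by \<open>i\<close>; the total degree is unchanged, so the induction hypothesis applies for the
    new \<open>e\<close>.\<close>
  have "T i \<in> reproduced \<beta> \<mu> n" if "i \<in> {1..m div 2}" for i
    unfolding T_def using that less.prems by (intro less.IH) auto
  then show ?case
    unfolding eq \<delta>_def by (intro reproduced_add reproduced_cmult reproduced_sum reproduced_zonal less.prems)
qed

lemma reproduced_monom:
  fixes a :: "'d :: finite \<Rightarrow> nat"
  assumes "(\<Sum>i\<in>UNIV. a i) + 2 * e \<le> n"
  shows "(\<lambda>q :: (real ^ 'd) \<times> real. (\<Prod>i\<in>UNIV. (fst q $ i) ^ a i) * snd q ^ (2 * e)) \<in> reproduced \<beta> \<mu> n"
proof -
  define m where "m = (\<Sum>i\<in>UNIV. a i)"
  have "(\<lambda>q :: (real ^ 'd) \<times> real. snd q ^ (2 * e) * (\<xi> \<bullet> fst q) ^ m) \<in> reproduced \<beta> \<mu> n" for \<xi>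
  proof -
    have "(\<lambda>q :: (real ^ 'd) \<times> real. (fact m / 2 ^ m) * (snd q ^ (2 * e) * lpow \<xi> m (fst q))) \<in> reproduced \<beta> \<mu> n"
      using assms by (intro reproduced_cmult reproduced_lpow) (simp add: m_def)
    then show ?thesis by (simp add: lpow_def power_mult_distrib)
  qed
  then have "(\<lambda>q :: (real ^ 'd) \<times> real. snd q ^ (2 * e) * (\<Prod>i\<in>UNIV. (fst q $ i) ^ a i)) \<in> reproduced \<beta> \<mu> n"
    unfolding m_def by (intro polarization[OF reproduced_add reproduced_cmult])
  then show ?thesis by (simp add: mult.commute)
qed

lemma reproduced_even_part:
  assumes "f \<in> pspan n"
  shows "(\<lambda>q. (f q + f (fst q, - snd q)) / 2) \<in> reproduced \<beta> \<mu> n"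
  using assms
proof (induction rule: pspan.induct)
  case (monom a k)
  show ?case
  proof (cases "even k")
    case True
    then obtain e where "k = 2 * e" by (auto elim: evenE)
    then show ?thesis using reproduced_monom[of a e] monom by (simp add: mult.commute)
  next
    case False
    then show ?thesis using reproduced_0 by simp
  qed
next
  case zero
  then show ?case using reproduced_0 by simp
next
  case (add f g)
  have "(\<lambda>q. (f q + g q + (f (fst q, - snd q) + g (fst q, - snd q))) / 2) =
    (\<lambda>q. (f q + f (fst q, - snd q)) / 2 + (g q + g (fst q, - snd q)) / 2)"
    by (auto simp: field_simps)
  then show ?case using reproduced_add[OF add.IH] by simp
next
  case (cmult f c)
  have "(\<lambda>q. (c * f q + c * f (fst q, - snd q)) / 2) = (\<lambda>q. c * ((f q + f (fst q, - snd q)) / 2))"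
    by (auto simp: field_simps)
  then show ?case using reproduced_cmult[OF cmult.IH] by simp
qed

lemma cw_reflect: "cw \<beta> \<mu> (x, - t) = cw \<beta> \<mu> (x, t)"
  by (simp add: cw_def cone_weight_def double_cone_def indicator_def)

lemma cone_mean_reflect:
  assumes "f \<in> pspan n"
  shows "cone_mean \<beta> \<mu> (\<lambda>q. f (fst q, - snd q)) = cone_mean \<beta> \<mu> f"
proof -
  note refl = pspan_reflect[OF assms]
  have swap: "(\<integral>q. g q * cw \<beta> \<mu> q \<partial>lborel) = (\<integral>x. (\<integral>t. g (x, t) * cw \<beta> \<mu> (x, t) \<partial>lborel) \<partial>lborel)"
    if "g \<in> pspan n" for g
    using lborel_pair.integral_fst'[of "\<lambda>q. g q * cw \<beta> \<mu> q"] pspan_cone_integrable[OF \<beta> \<mu> that]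
    by (simp add: lborel_prod)
  have "(\<integral>t. f (x, t) * cw \<beta> \<mu> (x, t) \<partial>lborel) = (\<integral>t. f (x, - t) * cw \<beta> \<mu> (x, t) \<partial>lborel)" for x
    using lborel_integral_real_affine[of "-1" "\<lambda>t. f (x, t) * cw \<beta> \<mu> (x, t)" 0] by (simp add: cw_reflect)
  then show ?thesis
    unfolding cone_mean_def swap[OF assms] swap[OF refl] by simp
qed

text \<open>Weight and kernel are even in \<open>t\<close>, so the odd part of \<open>f\<close>
  contributes nothing. This is needed because membership in \<open>V_even\<close> asks for
  orthogonality to all polynomials of lower degree, not just to the even ones.\<close>

lemma cone_mean_kern_even_part:
  assumes "f \<in> pspan n"
  shows "cone_mean \<beta> \<mu> (\<lambda>q. kern \<beta> \<mu> N p q * ((f q + f (fst q, - snd q)) / 2)) =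
    cone_mean \<beta> \<mu> (\<lambda>q. kern \<beta> \<mu> N p q * f q)"
proof -
  let ?h = "\<lambda>q. kern \<beta> \<mu> N p q * f q"
  have h: "?h \<in> pspan (N + n)" by (intro pspan_mult pspan_kern assms)
  have e: "kern \<beta> \<mu> N p (fst q, - snd q) = kern \<beta> \<mu> N p q" for q
    using kern_even[of \<beta> \<mu> N p "fst q" "snd q"] by simp
  have i: "integrable lborel (\<lambda>q. ?h q * cw \<beta> \<mu> q)"
    by (rule pspan_cone_integrable[OF \<beta> \<mu> h])
  have "(\<lambda>q. kern \<beta> \<mu> N p q * f (fst q, - snd q)) \<in> pspan (N + n)"
    by (intro pspan_mult pspan_kern pspan_reflect assms)
  then have "cone_mean \<beta> \<mu> (\<lambda>q. ?h q + kern \<beta> \<mu> N p q * f (fst q, - snd q)) =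
    cone_mean \<beta> \<mu> ?h + cone_mean \<beta> \<mu> (\<lambda>q. kern \<beta> \<mu> N p q * f (fst q, - snd q))"
    by (intro cone_mean_add[OF \<beta> \<mu> h])
  also have "cone_mean \<beta> \<mu> (\<lambda>q. kern \<beta> \<mu> N p q * f (fst q, - snd q)) = cone_mean \<beta> \<mu> ?h"
    using cone_mean_reflect[OF h] by (simp add: e)
  finally have "2 * cone_mean \<beta> \<mu> ?h = cone_mean \<beta> \<mu> (\<lambda>q. ?h q + kern \<beta> \<mu> N p q * f (fst q, - snd q))"
    by simp
  moreover have "(\<lambda>q. kern \<beta> \<mu> N p q * ((f q + f (fst q, - snd q)) / 2)) =
    (\<lambda>q. (1 / 2) * (?h q + kern \<beta> \<mu> N p q * f (fst q, - snd q)))"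
    by (auto simp: field_simps)
  ultimately show ?thesis by (simp only: cone_mean_cmult)
qed

lemma cone_mean_kern_lower:
  assumes "f \<in> pspan n" "n < N"
  shows "cone_mean \<beta> \<mu> (\<lambda>q. kern \<beta> \<mu> N p q * f q) = 0"
  using reproduced_lower[OF reproduced_even_part[OF assms(1)] assms(2)]
  unfolding cone_mean_kern_even_part[OF assms(1)] .

text \<open>An element of \<open>V_even \<beta> \<mu> n\<close> is even and orthogonal to each
  \<open>kern \<beta> \<mu> N p\<close> with \<open>N < n\<close>, a polynomial of degree at most
  \<open>N\<close>. Hence in its reproduction by the sum over \<open>N \<le> n\<close> only the term
  \<open>N = n\<close> remains.\<close>

lemma kern_reproducing:
  "is_reproducing_kernel (cone_inner \<beta> \<mu>) (V_even \<beta> \<mu> n) (kern \<beta> \<mu> n)"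
  unfolding is_reproducing_kernel_def
proof (intro allI conjI ballI)
  fix p :: "(real ^ 'd) \<times> real"
  show "kern \<beta> \<mu> n p \<in> V_even \<beta> \<mu> n"
    by (auto simp: V_even_def polys_upto_eq_pspan pspan_kern kern_even cone_inner_eq_mean
      intro: cone_mean_kern_lower)
  fix f :: "(real ^ 'd) \<times> real \<Rightarrow> real"
  assume "f \<in> V_even \<beta> \<mu> n"
  then have f: "f \<in> pspan n" "\<And>x t. f (x, - t) = f (x, t)"
      "\<And>m g. m < n \<Longrightarrow> g \<in> pspan m \<Longrightarrow> cone_mean \<beta> \<mu> (\<lambda>q. f q * g q) = 0"
    by (auto simp: V_even_def polys_upto_eq_pspan cone_inner_eq_mean)
  have "(\<lambda>q. (f q + f (fst q, - snd q)) / 2) = f"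
    using f(2) by (intro ext) (simp add: prod_eq_iff)
  then have "f \<in> reproduced \<beta> \<mu> n" using reproduced_even_part[OF f(1)] by simp
  then have "f p = (\<Sum>N\<le>n. cone_mean \<beta> \<mu> (\<lambda>q. kern \<beta> \<mu> N p q * f q))"
    by (rule reproduced_total[symmetric])
  also have "\<dots> = (\<Sum>N\<in>{n}. cone_mean \<beta> \<mu> (\<lambda>q. kern \<beta> \<mu> N p q * f q))"
    using f(3)[OF _ pspan_kern] by (intro sum.mono_neutral_right) (auto simp: mult.commute)
  finally show "cone_inner \<beta> \<mu> f (kern \<beta> \<mu> n p) = f p"
    by (simp add: cone_inner_eq_mean mult.commute)
qed

lemma P_even_eq_kern: "P_even \<beta> \<mu> n = kern \<beta> \<mu> n"
  unfolding P_even_def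
  by (intro the_equality kern_reproducing reproducing_kernel_unique[OF _ _ kern_reproducing])
    (auto simp: cone_inner_eq_mean mult.commute)

end

section \<open>Moments of the three one-dimensional weights\<close>

text \<open>Parametrized by the arguments of the Beta function: \<open>\<delta>\<close> and
  \<open>\<kappa>\<close> are the exponents plus one, so the hypotheses become positivity and the
  moments become Pochhammer quotients.\<close>

definition jacobi_density :: "real \<Rightarrow> real \<Rightarrow> real \<Rightarrow> real" where
  "jacobi_density \<delta> \<kappa> z = indicator {-1..1} z * (2 powr (- (\<delta> - 1 + (\<kappa> - 1) + 1)) * c_jacobi (\<delta> - 1) (\<kappa> - 1) *
     ((1 - z) powr (\<delta> - 1) * (1 + z) powr (\<kappa> - 1)))"

definition gegenbauer_density :: "real \<Rightarrow> real \<Rightarrow> real" where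
  "gegenbauer_density c z = indicator {-1..1} z * (c_gegenbauer c * (1 - z\<^sup>2) powr (c - 1 / 2))"

lemma jacobi_density_borel [measurable]: "jacobi_density \<delta> \<kappa> \<in> borel_measurable borel"
  unfolding jacobi_density_def by measurable

lemma gegenbauer_density_borel [measurable]: "gegenbauer_density c \<in> borel_measurable borel"
  unfolding gegenbauer_density_def by measurable

lemma has_bochner_integral_Beta:
  assumes "a > 0" "b > (0 :: real)"
  shows "has_bochner_integral lborel (\<lambda>t. indicator {0..1} t * (t powr (a - 1) * (1 - t) powr (b - 1))) (Beta a b)"
proof -
  have int: "set_integrable lborel {0..1} (\<lambda>t. t powr (a - 1) * (1 - t) powr (b - 1))"
    using assms by (rule integrable_Beta)
  have "(LINT t:{0..1}|lborel. t powr (a - 1) * (1 - t) powr (b - 1)) = integral {0..1} (\<lambda>t. t powr (a - 1) * (1 - t) powr (b - 1))"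
    using int by (rule set_borel_integral_eq_integral)
  also have "\<dots> = Beta a b"
    using has_integral_Beta_real[OF assms] by (rule integral_unique)
  finally show ?thesis using int
    by (simp add: has_bochner_integral_iff set_integrable_def set_lebesgue_integral_def)
qed

lemma power_mult_powr:
  fixes x :: real
  assumes "x \<ge> 0"
  shows "x ^ k * x powr c = x powr (real k + c)"
proof (cases "x = 0")
  case False
  then show ?thesis using assms by (simp add: powr_add powr_realpow)
qed (simp add: power_0_left)

lemma has_bochner_integral_real_affine:
  fixes f :: "real \<Rightarrow> real"
  assumes "has_bochner_integral lborel f x" "c \<noteq> 0"
  shows "has_bochner_integral lborel (\<lambda>z. f (t + c * z)) (x / \<bar>c\<bar>)"
  using assms lborel_integrable_real_affine[of f c t] lborel_integral_real_affine[of c f t]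
  by (auto simp: has_bochner_integral_iff eq_divide_eq mult.commute)

lemma jacobi_moment:
  assumes \<delta>: "\<delta> > 0" and \<kappa>: "\<kappa> > 0"
  shows "has_bochner_integral lborel (\<lambda>z. ((1 - z) / 2) ^ l * ((1 + z) / 2) ^ k * jacobi_density \<delta> \<kappa> z)
    (pochhammer \<delta> l * pochhammer \<kappa> k / pochhammer (\<delta> + \<kappa>) (l + k))"
proof -
  define f where "f t = indicator {0..1} t * (t powr (real k + \<kappa> - 1) * (1 - t) powr (real l + \<delta> - 1))" for t :: real
  have "has_bochner_integral lborel f (Beta (real k + \<kappa>) (real l + \<delta>))"
    unfolding f_def using \<delta> \<kappa> by (intro has_bochner_integral_Beta) auto
  from has_bochner_integral_real_affine[OF this, of "1 / 2" "1 / 2"]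
  have 1: "has_bochner_integral lborel (\<lambda>z. f (1 / 2 + 1 / 2 * z)) (2 * Beta (real k + \<kappa>) (real l + \<delta>))"
    by (simp add: mult.commute)
  define C where "C = 2 powr (- (\<delta> - 1 + (\<kappa> - 1) + 1)) * c_jacobi (\<delta> - 1) (\<kappa> - 1) * 2 powr (\<delta> - 1) * 2 powr (\<kappa> - 1)"
  \<comment> \<open>Of all the powers of two only \<open>1 / 2\<close> is left, and the Jacobian of
    \<open>z \<mapsto> (1 + z) / 2\<close> cancels it.\<close>
  have C: "C = c_jacobi (\<delta> - 1) (\<kappa> - 1) / 2"
  proof -
    have "2 powr (- (\<delta> - 1 + (\<kappa> - 1) + 1)) * 2 powr (\<delta> - 1) * 2 powr (\<kappa> - 1) = (2 :: real) powr (-1)"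
      by (simp flip: powr_add)
    then show ?thesis by (simp add: C_def powr_minus mult_ac)
  qed
  have "((1 - z) / 2) ^ l * ((1 + z) / 2) ^ k * jacobi_density \<delta> \<kappa> z = C * f (1 / 2 + 1 / 2 * z)" for z
  proof (cases "z \<in> {-1..1}")
    case True
    then have z: "(1 - z) / 2 \<ge> 0" "(1 + z) / 2 \<ge> 0" by auto
    have a: "(1 - z) powr (\<delta> - 1) = 2 powr (\<delta> - 1) * ((1 - z) / 2) powr (\<delta> - 1)"
      "(1 + z) powr (\<kappa> - 1) = 2 powr (\<kappa> - 1) * ((1 + z) / 2) powr (\<kappa> - 1)"
      using True by (simp_all add: powr_divide)
    have b: "1 / 2 + 1 / 2 * z = (1 + z) / 2" "1 - (1 + z) / 2 = (1 - z) / 2" by (auto simp: field_simps)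
    have "((1 - z) / 2) ^ l * ((1 + z) / 2) ^ k * jacobi_density \<delta> \<kappa> z = C *
      ((((1 + z) / 2) ^ k * ((1 + z) / 2) powr (\<kappa> - 1)) * (((1 - z) / 2) ^ l * ((1 - z) / 2) powr (\<delta> - 1)))"
      unfolding jacobi_density_def a C_def using True by (simp only: indicator_simps) (simp add: mult_ac)
    also have "\<dots> = C * f (1 / 2 + 1 / 2 * z)"
      unfolding power_mult_powr[OF z(1)] power_mult_powr[OF z(2)] b f_def
      using True by (simp add: add_diff_eq)
    finally show ?thesis .
  qed (auto simp: jacobi_density_def f_def)
  then have "has_bochner_integral lborel (\<lambda>z. ((1 - z) / 2) ^ l * ((1 + z) / 2) ^ k * jacobi_density \<delta> \<kappa> z)
    (C * (2 * Beta (real k + \<kappa>) (real l + \<delta>)))"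
    using has_bochner_integral_mult_right[OF 1, of C] by simp
  moreover have "C * (2 * Beta (real k + \<kappa>) (real l + \<delta>)) =
    pochhammer \<delta> l * pochhammer \<kappa> k / pochhammer (\<delta> + \<kappa>) (l + k)"
  proof -
    have G: "Gamma \<delta> > 0" "Gamma \<kappa> > 0" "Gamma (\<delta> + \<kappa>) > 0" using \<delta> \<kappa> by (auto intro: Gamma_real_pos)
    have "Gamma (real k + \<kappa> + (real l + \<delta>)) = pochhammer (\<delta> + \<kappa>) (l + k) * Gamma (\<delta> + \<kappa>)"
      using Gamma_shift[of "\<delta> + \<kappa>" "l + k"] \<delta> \<kappa> by (simp add: add_ac)
    moreover have "Gamma \<delta> \<noteq> 0" "Gamma \<kappa> \<noteq> 0" "Gamma (\<delta> + \<kappa>) \<noteq> 0" using G by auto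
    ultimately show ?thesis using \<delta> \<kappa>
      by (simp add: C c_jacobi_def Beta_def Gamma_shift)
  qed
  ultimately show ?thesis by simp
qed

text \<open>The substitution \<open>v = z\<^sup>2\<close> on both halves of the interval gives
  \<open>Beta (k + 1 / 2) (c + 1 / 2)\<close>. It is carried out for nonnegative integrals, so
  integrability comes with the value.\<close>

lemma gegenbauer_even_moment:
  assumes c: "c > - (1 / 2)"
  shows "has_bochner_integral lborel (\<lambda>z. z ^ (2 * k) * gegenbauer_density c z)
    (pochhammer (1 / 2) k / pochhammer (c + 1) k)"
proof -
  define f where "f v = indicator {0..1} v * (v powr (real k + 1 / 2 - 1) * (1 - v) powr (c + 1 / 2 - 1))" for v :: real
  have [measurable]: "f \<in> borel_measurable borel" unfolding f_def by measurable
  have f0: "f v \<ge> 0" for v by (auto simp: f_def split: split_indicator)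
  have B: "has_bochner_integral lborel f (Beta (real k + 1 / 2) (c + 1 / 2))"
    unfolding f_def using c by (intro has_bochner_integral_Beta) auto
  have Bpos: "Beta (real k + 1 / 2) (c + 1 / 2) \<ge> 0"
  proof -
    have "integral\<^sup>L lborel f \<ge> 0" by (rule Bochner_Integration.integral_nonneg) (rule f0)
    then show ?thesis using B by (simp add: has_bochner_integral_iff)
  qed
  have cg: "c_gegenbauer c > 0"
    unfolding c_gegenbauer_def using c by (intro divide_pos_pos mult_pos_pos Gamma_real_pos) auto
  have eq: "ennreal (\<bar>s\<bar> * f (s\<^sup>2 - 0\<^sup>2)) * indicator {s. 0 \<le> \<bar>s\<bar>} s =
     ennreal (indicator {-1..1} s * (s ^ (2 * k) * (1 - s\<^sup>2) powr (c - 1 / 2)))" if s: "s \<noteq> 0" for s :: real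
  proof (cases "s \<in> {-1..1}")
    case True
    then have "s\<^sup>2 \<le> 1" by (auto simp: abs_square_le_1 abs_le_iff)
    have "s\<^sup>2 = \<bar>s\<bar> powr 2" using s by simp
    then have "(s\<^sup>2) powr (real k + 1 / 2 - 1) = \<bar>s\<bar> powr (2 * (real k + 1 / 2 - 1))"
      by (simp only: powr_powr)
    also have "2 * (real k + 1 / 2 - 1) = real (2 * k) - 1" by (simp add: algebra_simps)
    also have "\<bar>s\<bar> powr (real (2 * k) - 1) = \<bar>s\<bar> ^ (2 * k) / \<bar>s\<bar>"
      using s by (subst powr_diff) (simp add: powr_realpow del: of_nat_mult)
    finally have "\<bar>s\<bar> * (s\<^sup>2) powr (real k + 1 / 2 - 1) = s ^ (2 * k)" using s by (simp add: power_even_abs)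
    then have "\<bar>s\<bar> * f (s\<^sup>2 - 0\<^sup>2) = s ^ (2 * k) * (1 - s\<^sup>2) powr (c - 1 / 2)"
      using \<open>s\<^sup>2 \<le> 1\<close> by (simp add: f_def mult.assoc[symmetric])
    then show ?thesis using True by simp
  next
    case False
    then have "s\<^sup>2 > 1" by (auto simp: abs_square_less_1 not_le[symmetric] abs_square_le_1 abs_le_iff)
    then show ?thesis using False by (simp add: f_def)
  qed
  have "(\<integral>\<^sup>+z. ennreal (indicator {-1..1} z * (z ^ (2 * k) * (1 - z\<^sup>2) powr (c - 1 / 2))) \<partial>lborel) =
    (\<integral>\<^sup>+s. ennreal (\<bar>s\<bar> * f (s\<^sup>2 - 0\<^sup>2)) * indicator {s. 0 \<le> \<bar>s\<bar>} s \<partial>lborel)"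
    using eq by (intro nn_integral_cong_AE eventually_mono[OF AE_lborel_singleton[of 0]]) (simp only: not_False_eq_True)
  also have "\<dots> = (\<integral>\<^sup>+v. ennreal (f v) * indicator {0..} v \<partial>lborel)"
    by (rule nn_integral_abs_square_substitution) (auto simp: f0)
  also have "\<dots> = (\<integral>\<^sup>+v. ennreal (f v) \<partial>lborel)"
    by (intro nn_integral_cong) (auto simp: f_def split: split_indicator)
  also have "\<dots> = ennreal (Beta (real k + 1 / 2) (c + 1 / 2))"
    using B f0 by (auto simp: has_bochner_integral_iff nn_integral_eq_integral)
  finally have "has_bochner_integral lborel (\<lambda>z. indicator {-1..1} z * (z ^ (2 * k) * (1 - z\<^sup>2) powr (c - 1 / 2)))
    (Beta (real k + 1 / 2) (c + 1 / 2))"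
    using Bpos by (intro has_bochner_integral_nn_integral) auto
  from has_bochner_integral_mult_right[OF this, of "c_gegenbauer c"]
  have "has_bochner_integral lborel (\<lambda>z. z ^ (2 * k) * gegenbauer_density c z)
    (c_gegenbauer c * Beta (real k + 1 / 2) (c + 1 / 2))"
    by (simp add: gegenbauer_density_def mult_ac)
  moreover have "c_gegenbauer c * Beta (real k + 1 / 2) (c + 1 / 2) = pochhammer (1 / 2) k / pochhammer (c + 1) k"
  proof -
    have G: "Gamma (1 / 2 :: real) > 0" "Gamma (c + 1 / 2) > 0" "Gamma (c + 1) > 0" using c by (auto intro: Gamma_real_pos)
    have "real k + 1 / 2 + (c + 1 / 2) = real k + (c + 1)" by simp
    moreover have "Gamma (1 / 2 :: real) \<noteq> 0" "Gamma (c + 1 / 2) \<noteq> 0" "Gamma (c + 1) \<noteq> 0" using G by (metis less_irrefl)+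
    ultimately show ?thesis using c
      by (simp only: c_gegenbauer_def Beta_def) (simp add: Gamma_shift)
  qed
  ultimately show ?thesis by simp
qed

lemma gegenbauer_moment:
  assumes c: "c > - (1 / 2)"
  shows "has_bochner_integral lborel (\<lambda>z. z ^ n * gegenbauer_density c z)
    (if even n then pochhammer (1 / 2) (n div 2) / pochhammer (c + 1) (n div 2) else 0)"
proof (cases "even n")
  case True
  then show ?thesis using gegenbauer_even_moment[OF c, of "n div 2"] by simp
next
  case False
  have int: "integrable lborel (\<lambda>z. z ^ n * gegenbauer_density c z)"
  proof (rule Bochner_Integration.integrable_bound)
    show "integrable lborel (gegenbauer_density c)"
      using gegenbauer_even_moment[OF c, of 0] by (simp add: has_bochner_integral_iff)
    have "\<bar>z\<bar> ^ n * \<bar>gegenbauer_density c z\<bar> \<le> 1 * \<bar>gegenbauer_density c z\<bar>" for z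
    proof (cases "z \<in> {-1..1}")
      case True
      then show ?thesis by (intro mult_right_mono power_le_one) auto
    qed (simp add: gegenbauer_density_def)
    then show "AE z in lborel. norm (z ^ n * gegenbauer_density c z) \<le> norm (gegenbauer_density c z)"
      by (simp add: abs_mult power_abs)
  qed measurable
  have sym: "gegenbauer_density c (- z) = gegenbauer_density c z" for z
    by (auto simp: gegenbauer_density_def split: split_indicator)
  have "(\<integral>z. z ^ n * gegenbauer_density c z \<partial>lborel) = - (\<integral>z. z ^ n * gegenbauer_density c z \<partial>lborel)"
    using lborel_integral_real_affine[of "-1" "\<lambda>z. z ^ n * gegenbauer_density c z" 0] False
    by (simp add: sym power_minus_odd)
  then show ?thesis using int False by (simp add: has_bochner_integral_iff)
qed

lemma has_bochner_integral_pair_mult: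
  fixes f g :: "_ \<Rightarrow> real"
  assumes f: "has_bochner_integral lborel f a" and g: "has_bochner_integral lborel g b"
  shows "has_bochner_integral lborel (\<lambda>(x :: 'a :: euclidean_space, y :: 'b :: euclidean_space). f x * g y) (a * b)"
proof -
  have if': "integrable lborel f" "integral\<^sup>L lborel f = a" and ig: "integrable lborel g" "integral\<^sup>L lborel g = b"
    using f g by (auto simp: has_bochner_integral_iff)
  have [measurable]: "f \<in> borel_measurable borel" "g \<in> borel_measurable borel"
    using if' ig by (auto dest: borel_measurable_integrable)
  have int: "integrable (lborel \<Otimes>\<^sub>M lborel) (\<lambda>(x, y). f x * g y)"
  proof (rule lborel_pair.Fubini_integrable)
    show "(\<lambda>(x, y). f x * g y) \<in> borel_measurable (lborel \<Otimes>\<^sub>M lborel)" by measurable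
    show "integrable lborel (\<lambda>x. \<integral>y. norm ((\<lambda>(x, y). f x * g y) (x, y)) \<partial>lborel)"
      using if' by (simp add: abs_mult)
    show "AE x in lborel. integrable lborel (\<lambda>y. (\<lambda>(x, y). f x * g y) (x, y))"
      using ig by simp
  qed
  have "(\<integral>x. (\<integral>y. f x * g y \<partial>lborel) \<partial>lborel) = integral\<^sup>L (lborel \<Otimes>\<^sub>M lborel) (\<lambda>(x, y). f x * g y)"
    using lborel_pair.integral_fst'[OF int] by simp
  then show ?thesis using int if' ig by (simp add: has_bochner_integral_iff lborel_prod)
qed

text \<open>Termwise integration of the exponential series, dominated by
  \<open>exp \<bar>B\<bar> * \<bar>w x\<bar>\<close>. The bound on \<open>\<phi>\<close> is asked
  only where \<open>w\<close> is nonzero, since \<open>cone_phi\<close> is bounded on the cube and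
  not on the whole space.\<close>

lemma integral_exp_series:
  fixes w \<phi> :: "'a \<Rightarrow> real"
  assumes w: "integrable M w" and [measurable]: "\<phi> \<in> borel_measurable M"
    and \<phi>: "\<And>x. w x \<noteq> 0 \<Longrightarrow> \<bar>\<phi> x\<bar> \<le> B"
  shows "integrable M (\<lambda>x. exp (\<phi> x) * w x)"
    and "(\<lambda>n. (\<integral>x. \<phi> x ^ n * w x \<partial>M) / fact n) sums (\<integral>x. exp (\<phi> x) * w x \<partial>M)"
    and "integrable M (\<lambda>x. \<phi> x ^ n * w x)"
    and "\<bar>\<integral>x. \<phi> x ^ n * w x \<partial>M\<bar> \<le> \<bar>B\<bar> ^ n * (\<integral>x. \<bar>w x\<bar> \<partial>M)"
proof -
  have [measurable]: "w \<in> borel_measurable M" using w by simp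
  have bound: "\<bar>\<phi> x ^ n * w x\<bar> \<le> \<bar>B\<bar> ^ n * \<bar>w x\<bar>" for n x
  proof (cases "w x = 0")
    case False
    then have "\<bar>\<phi> x\<bar> ^ n \<le> \<bar>B\<bar> ^ n" using \<phi>[of x] by (intro power_mono) auto
    then show ?thesis by (simp add: abs_mult power_abs mult_right_mono)
  qed simp
  have int: "integrable M (\<lambda>x. \<phi> x ^ n * w x)" for n
  proof (rule Bochner_Integration.integrable_bound)
    show "integrable M (\<lambda>x. \<bar>B\<bar> ^ n * \<bar>w x\<bar>)" using w by simp
    show "AE x in M. norm (\<phi> x ^ n * w x) \<le> norm (\<bar>B\<bar> ^ n * \<bar>w x\<bar>)"
      using bound by (simp add: abs_mult)
  qed measurable
  then show "integrable M (\<lambda>x. \<phi> x ^ n * w x)" .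
  have nb: "(\<integral>x. \<bar>\<phi> x ^ n * w x\<bar> \<partial>M) \<le> \<bar>B\<bar> ^ n * (\<integral>x. \<bar>w x\<bar> \<partial>M)" for n
  proof -
    have "(\<integral>x. \<bar>\<phi> x ^ n * w x\<bar> \<partial>M) \<le> (\<integral>x. \<bar>B\<bar> ^ n * \<bar>w x\<bar> \<partial>M)"
      using w by (intro integral_mono bound integrable_abs int) auto
    then show ?thesis by simp
  qed
  show "\<bar>\<integral>x. \<phi> x ^ n * w x \<partial>M\<bar> \<le> \<bar>B\<bar> ^ n * (\<integral>x. \<bar>w x\<bar> \<partial>M)"
    using nb[of n] integral_abs_bound[of M "\<lambda>x. \<phi> x ^ n * w x"] by linarith
  define f where "f n x = \<phi> x ^ n * w x / fact n" for n x
  have f_sums: "(\<lambda>n. f n x) sums (exp (\<phi> x) * w x)" for x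
  proof -
    have "(\<lambda>n. (\<phi> x ^ n /\<^sub>R fact n) * w x) sums (exp (\<phi> x) * w x)"
      by (intro sums_mult2 exp_converges)
    then show ?thesis by (simp add: f_def divide_inverse mult_ac)
  qed
  have f_int: "integrable M (f n)" for n unfolding f_def using int by simp
  have f_abs: "summable (\<lambda>n. norm (f n x))" for x
  proof (rule summable_comparison_test')
    show "summable (\<lambda>n. (\<bar>B\<bar> ^ n /\<^sub>R fact n) * \<bar>w x\<bar>)"
      by (intro summable_mult2 summable_exp_generic)
    show "norm (norm (f n x)) \<le> (\<bar>B\<bar> ^ n /\<^sub>R fact n) * \<bar>w x\<bar>" for n
    proof -
      have "\<bar>\<phi> x ^ n * w x\<bar> / fact n \<le> \<bar>B\<bar> ^ n * \<bar>w x\<bar> / fact n"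
        by (intro divide_right_mono bound) simp
      moreover have "norm (norm (f n x)) = \<bar>\<phi> x ^ n * w x\<bar> / fact n" by (simp add: f_def)
      ultimately show ?thesis by (simp add: divide_inverse mult_ac)
    qed
  qed
  have f_sum: "summable (\<lambda>n. \<integral>x. norm (f n x) \<partial>M)"
  proof (rule summable_comparison_test')
    show "summable (\<lambda>n. (\<bar>B\<bar> ^ n /\<^sub>R fact n) * (\<integral>x. \<bar>w x\<bar> \<partial>M))"
      by (intro summable_mult2 summable_exp_generic)
    show "norm (\<integral>x. norm (f n x) \<partial>M) \<le> (\<bar>B\<bar> ^ n /\<^sub>R fact n) * (\<integral>x. \<bar>w x\<bar> \<partial>M)" for n
    proof -
      have "(\<integral>x. \<bar>f n x\<bar> \<partial>M) = (\<integral>x. \<bar>\<phi> x ^ n * w x\<bar> \<partial>M) / fact n"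
        by (simp add: f_def)
      also have "\<dots> \<le> \<bar>B\<bar> ^ n * (\<integral>x. \<bar>w x\<bar> \<partial>M) / fact n"
        by (intro divide_right_mono nb) simp
      finally show ?thesis by (simp add: divide_inverse mult_ac Bochner_Integration.integral_nonneg)
    qed
  qed
  have suminf: "(\<lambda>x. \<Sum>n. f n x) = (\<lambda>x. exp (\<phi> x) * w x)"
    using f_sums by (auto simp: sums_iff)
  show "integrable M (\<lambda>x. exp (\<phi> x) * w x)"
    using integrable_suminf[OF f_int _ f_sum] f_abs unfolding suminf by simp
  show "(\<lambda>n. (\<integral>x. \<phi> x ^ n * w x \<partial>M) / fact n) sums (\<integral>x. exp (\<phi> x) * w x \<partial>M)"
    using sums_integral[OF f_int _ f_sum] f_abs unfolding suminf by (simp add: f_def)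
qed

lemma power_add_div_fact:
  fixes a b :: real
  shows "(a + b) ^ n / fact n = (\<Sum>k\<le>n. a ^ k / fact k * (b ^ (n - k) / fact (n - k)))"
  unfolding binomial_ring sum_divide_distrib
  by (intro sum.cong refl) (simp add: binomial_fact)

lemma fact_double_pochhammer: "fact (2 * k) = (4 :: real) ^ k * (fact k * pochhammer (1 / 2) k)"
proof (induction k)
  case (Suc k)
  have "fact (2 * Suc k) = (2 * real k + 2) * ((2 * real k + 1) * fact (2 * k))"
    by (simp add: algebra_simps)
  then show ?case unfolding Suc.IH
    by (simp add: pochhammer_Suc algebra_simps)
qed simp

section \<open>Integral representation of the coefficients\<close>

text \<open>Odd powers of \<open>u\<close> integrate to zero; for the even ones the numerator
  \<open>pochhammer (1 / 2) k\<close> of the moment cancels against \<open>fact (2 * k)\<close>.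
  Only \<open>Y\<^sup>2\<close> matters, so either sign of \<open>Y\<close> is allowed, which
  accommodates the factor \<open>sgn (s * t)\<close> in \<open>cone_phi\<close>.\<close>

lemma hexp_integral:
  assumes \<mu>: "\<mu> > 0" and Y: "Y\<^sup>2 = h2 p * h2 q"
  shows "has_bochner_integral lborel
    (\<lambda>u. (2 * (fst p \<bullet> fst q + u * Y)) ^ l / fact l * gegenbauer_density (\<mu> - 1 / 2) u) (hexp \<mu> l p q)"
proof -
  define X where "X = 2 * (fst p \<bullet> fst q)"
  define M where "M n = (if even n then pochhammer (1 / 2) (n div 2) / pochhammer (\<mu> + 1 / 2) (n div 2) else 0)" for n
  define f where "f k = X ^ k / fact k * ((2 * Y) ^ (l - k) / fact (l - k)) * M (l - k)" for k
  have "has_bochner_integral lborel (\<lambda>u. u ^ n * gegenbauer_density (\<mu> - 1 / 2) u) (M n)" for n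
  proof -
    have "\<mu> - 1 / 2 + 1 = \<mu> + 1 / 2" by simp
    then show ?thesis using gegenbauer_moment[of "\<mu> - 1 / 2" n] \<mu> by (simp only: M_def)
  qed
  then have "has_bochner_integral lborel (\<lambda>u. \<Sum>k\<le>l. X ^ k / fact k * ((2 * Y) ^ (l - k) / fact (l - k)) *
    (u ^ (l - k) * gegenbauer_density (\<mu> - 1 / 2) u)) (\<Sum>k\<le>l. f k)"
    unfolding f_def by (intro has_bochner_integral_sum has_bochner_integral_mult_right)
  moreover have "(2 * (fst p \<bullet> fst q + u * Y)) ^ l / fact l * gegenbauer_density (\<mu> - 1 / 2) u =
    (\<Sum>k\<le>l. X ^ k / fact k * ((2 * Y) ^ (l - k) / fact (l - k)) *
    (u ^ (l - k) * gegenbauer_density (\<mu> - 1 / 2) u))" for u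
  proof -
    have "2 * (fst p \<bullet> fst q + u * Y) = X + u * (2 * Y)" by (simp add: X_def)
    then have "(2 * (fst p \<bullet> fst q + u * Y)) ^ l / fact l =
      (\<Sum>k\<le>l. X ^ k / fact k * ((u * (2 * Y)) ^ (l - k) / fact (l - k)))"
      by (simp only: power_add_div_fact)
    then show ?thesis by (simp add: sum_distrib_right sum_distrib_left power_mult_distrib mult_ac)
  qed
  moreover have "(\<Sum>k\<le>l. f k) = hexp \<mu> l p q"
  proof -
    have "(\<Sum>k\<le>l. f k) = (\<Sum>g\<le>l div 2. f (l - 2 * g))"
      by (rule sum_even_offset) (simp add: f_def M_def)
    also have "\<dots> = hexp \<mu> l p q" unfolding hexp_def
    proof (intro sum.cong refl)
      fix i assume "i \<in> {..l div 2}"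
      then have i: "l - (l - 2 * i) = 2 * i" by auto
      have "(2 * Y) ^ (2 * i) = 4 ^ i * (h2 p ^ i * h2 q ^ i)"
        by (simp add: power_mult power_mult_distrib Y)
      moreover have "pochhammer (1 / 2 :: real) i \<noteq> 0" using pochhammer_pos[of "1 / 2 :: real" i] by simp
      ultimately show "f (l - 2 * i) = h2 p ^ i / (fact i * pochhammer (\<mu> + 1 / 2) i) *
        (lpow (fst p) (l - 2 * i) (fst q) * h2 q ^ i)"
        unfolding f_def i fact_double_pochhammer by (simp add: M_def lpow_def X_def power_mult_distrib mult_ac)
    qed
    finally show ?thesis .
  qed
  ultimately show ?thesis by simp
qed

text \<open>Where the Rothe numbers come from: \<open>pochhammer \<kappa> (2 * k)\<close> belongs to
  the moment in \<open>z1\<close>, and the last quotient is the moment of order \<open>2 * k\<close>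
  in \<open>z2\<close>.\<close>

lemma rothe_eq_moment:
  assumes \<kappa>: "\<kappa> > 0"
  shows "rothe \<kappa> k = 4 ^ k / fact (2 * k) * pochhammer \<kappa> (2 * k) * (pochhammer (1 / 2) k / pochhammer (\<kappa> + 1) k)"
proof -
  have n: "pochhammer (1 / 2 :: real) k \<noteq> 0" "pochhammer (\<kappa> + 1) k \<noteq> 0"
    using pochhammer_pos[of "1 / 2 :: real" k] pochhammer_pos[of "\<kappa> + 1" k] \<kappa> by auto
  have "rothe \<kappa> k = pochhammer \<kappa> (2 * k) / (fact k * pochhammer (\<kappa> + 1) k)"
  proof (cases k)
    case (Suc j)
    have "pochhammer \<kappa> (2 * k) = \<kappa> * pochhammer (\<kappa> + 1) (Suc j + j)"
      using pochhammer_rec[of \<kappa> "Suc (2 * j)"] by (simp add: Suc mult_2)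
    also have "pochhammer (\<kappa> + 1) (Suc j + j) = pochhammer (\<kappa> + 1) (Suc j) * pochhammer (\<kappa> + 1 + real (Suc j)) j"
      by (rule pochhammer_product')
    finally show ?thesis using n by (simp add: Suc add_ac)
  qed simp
  then show ?thesis using n by (simp add: fact_double_pochhammer)
qed

definition cube_weight :: "real \<Rightarrow> real \<Rightarrow> 'd itself \<Rightarrow> real \<times> real \<times> real \<Rightarrow> real" where
  "cube_weight \<beta> \<mu> _ = (\<lambda>(z1, z2, u). jacobi_density (\<mu> + (real CARD('d) + 1) / 2) (\<beta> - 1 / 2) z1 *
     (gegenbauer_density (\<beta> - 1 / 2) z2 * gegenbauer_density (\<mu> - 1 / 2) u))"

lemma double_cone_h2: "p \<in> double_cone \<Longrightarrow> h2 p \<ge> 0"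
  by (cases p) (auto simp: double_cone_def h2_def abs_le_square_iff[symmetric])

text \<open>A binomial expansion in the two summands of \<open>cone_phi\<close> splits the cube
  integral into products of three one-dimensional integrals, over \<open>z1\<close>,
  \<open>z2\<close> and \<open>u\<close>. Odd powers of \<open>z2\<close> drop out, which leaves the
  sum over \<open>k\<close> in \<open>gexp\<close>.\<close>

lemma gexp_integral:
  fixes p q :: "(real ^ 'd) \<times> real"
  assumes \<beta>: "\<beta> > 1 / 2" and \<mu>: "\<mu> > 0" and p: "p \<in> double_cone" and q: "q \<in> double_cone"
  shows "has_bochner_integral lborel
    (\<lambda>z. (2 * (case z of (z1, z2, u) \<Rightarrow> cone_phi p q z1 z2 u)) ^ n / fact n * cube_weight \<beta> \<mu> TYPE('d) z)
    (gexp \<beta> \<mu> n p q)"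
proof -
  define \<delta> \<kappa> where "\<delta> = \<mu> + (real CARD('d) + 1) / 2" and "\<kappa> = \<beta> - 1 / 2"
  define T where "T = snd p * snd q"
  define Y where "Y = sqrt (h2 p) * sqrt (h2 q) * sgn (snd q * snd p)"
  have pos: "\<delta> > 0" "\<kappa> > 0" using \<beta> \<mu> by (auto simp: \<delta>_def \<kappa>_def intro!: add_pos_pos)
  have h2: "h2 p \<ge> 0" "h2 q \<ge> 0" using p q by (auto intro: double_cone_h2)
  have Y: "Y\<^sup>2 = h2 p * h2 q"
  proof (cases "snd p = 0 \<or> snd q = 0")
    case True
    \<comment> \<open>On the cone \<open>t = 0\<close> forces \<open>x = 0\<close>, so
      \<open>h2\<close> vanishes as well and the zero of \<open>sgn\<close> does no harm.\<close>
    then have "h2 p = 0 \<or> h2 q = 0" using p q h2 by (cases p; cases q) (auto simp: double_cone_def h2_def)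
    then show ?thesis by (auto simp: Y_def)
  next
    case False
    then show ?thesis using h2 by (simp add: Y_def power_mult_distrib sgn_mult sgn_if)
  qed
  have phi: "cone_phi p q z1 z2 u = (1 - z1) / 2 * (fst p \<bullet> fst q + u * Y) + (1 + z1) / 2 * z2 * T" for z1 z2 u
    by (cases p; cases q) (simp add: cone_phi_def Y_def T_def h2_def mult_ac)
  define M where "M n = (if even n then pochhammer (1 / 2) (n div 2) / pochhammer (\<kappa> + 1) (n div 2) else 0)" for n
  define f where "f l = (2 * T) ^ (n - l) / fact (n - l) *
    (pochhammer \<delta> l * pochhammer \<kappa> (n - l) / pochhammer (\<delta> + \<kappa>) (l + (n - l)) * (M (n - l) * hexp \<mu> l p q))" for l
  have "has_bochner_integral lborel (\<lambda>z. z ^ n * gegenbauer_density \<kappa> z) (M n)" for n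
    using gegenbauer_moment[of \<kappa> n] pos by (simp add: M_def)
  then have "has_bochner_integral lborel (\<lambda>z. \<Sum>l\<le>n. (2 * T) ^ (n - l) / fact (n - l) *
     (case z of (z1, z) \<Rightarrow> (((1 - z1) / 2) ^ l * ((1 + z1) / 2) ^ (n - l) * jacobi_density \<delta> \<kappa> z1) *
       (case z of (z2, u) \<Rightarrow> (z2 ^ (n - l) * gegenbauer_density \<kappa> z2) *
        ((2 * (fst p \<bullet> fst q + u * Y)) ^ l / fact l * gegenbauer_density (\<mu> - 1 / 2) u)))) (\<Sum>l\<le>n. f l)"
    unfolding f_def using pos \<mu> Y
    by (intro has_bochner_integral_sum has_bochner_integral_mult_right has_bochner_integral_pair_mult
      jacobi_moment hexp_integral)
  moreover have "(\<Sum>l\<le>n. (2 * T) ^ (n - l) / fact (n - l) *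
     (case z of (z1, z) \<Rightarrow> (((1 - z1) / 2) ^ l * ((1 + z1) / 2) ^ (n - l) * jacobi_density \<delta> \<kappa> z1) *
       (case z of (z2, u) \<Rightarrow> (z2 ^ (n - l) * gegenbauer_density \<kappa> z2) *
        ((2 * (fst p \<bullet> fst q + u * Y)) ^ l / fact l * gegenbauer_density (\<mu> - 1 / 2) u)))) =
     (2 * (case z of (z1, z2, u) \<Rightarrow> cone_phi p q z1 z2 u)) ^ n / fact n * cube_weight \<beta> \<mu> TYPE('d) z" for z
  proof -
    obtain z1 z2 u where z: "z = (z1, z2, u)" by (cases z)
    have "2 * cone_phi p q z1 z2 u = (1 - z1) / 2 * (2 * (fst p \<bullet> fst q + u * Y)) + (1 + z1) / 2 * z2 * (2 * T)"
      by (simp add: phi algebra_simps)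
    then show ?thesis unfolding z
      by (simp only: prod.case power_add_div_fact sum_distrib_right cube_weight_def power_mult_distrib
        flip: \<delta>_def \<kappa>_def) (intro sum.cong refl, simp add: mult_ac)
  qed
  moreover have "(\<Sum>l\<le>n. f l) = gexp \<beta> \<mu> n p q"
  proof -
    have "(\<Sum>l\<le>n. f l) = (\<Sum>g\<le>n div 2. f (n - 2 * g))"
      by (rule sum_even_offset) (simp add: f_def M_def)
    also have "\<dots> = gexp \<beta> \<mu> n p q" unfolding gexp_def
    proof (intro sum.cong refl)
      fix k assume "k \<in> {..n div 2}"
      then have k: "n - (n - 2 * k) = 2 * k" "n - 2 * k + 2 * k = n" by auto
      have \<gamma>: "\<beta> + \<mu> + real CARD('d) / 2 = \<delta> + \<kappa>" by (simp add: \<delta>_def \<kappa>_def add_divide_distrib)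
      have "(2 * T) ^ (2 * k) = 4 ^ k * T ^ (2 * k)"
        by (simp add: power_mult power_mult_distrib)
      then have "(2 * T) ^ (2 * k) / fact (2 * k) = 4 ^ k / fact (2 * k) * T ^ (2 * k)" by simp
      then show "f (n - 2 * k) = pochhammer (\<mu> + (real CARD('d) + 1) / 2) (n - 2 * k) * rothe (\<beta> - 1 / 2) k /
         pochhammer (\<beta> + \<mu> + real CARD('d) / 2) n * (snd p * snd q) ^ (2 * k) * hexp \<mu> (n - 2 * k) p q"
        unfolding f_def k \<gamma> \<delta>_def[symmetric] \<kappa>_def[symmetric] T_def[symmetric] rothe_eq_moment[OF pos(2)]
        by (simp only: M_def) (simp add: mult_ac)
    qed
    finally show ?thesis .
  qed
  ultimately show ?thesis by simp
qed

section \<open>Bounds and continuity in the parameters\<close>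

text \<open>\<open>cone_phi\<close> is a convex combination, with weights
  \<open>(1 - z1) / 2\<close> and \<open>(1 + z1) / 2\<close>, of two numbers bounded by
  \<open>\<bar>s * t\<bar>\<close>. For the first, Cauchy-Schwarz is applied in one more dimension,
  to \<open>(norm x, a)\<close> and \<open>(norm y, b)\<close>, which have lengths
  \<open>\<bar>t\<bar>\<close> and \<open>\<bar>s\<bar>\<close>.\<close>

lemma cone_phi_bound:
  assumes p: "p \<in> double_cone" and q: "q \<in> double_cone"
    and z: "z1 \<in> {-1..1}" "z2 \<in> {-1..1}" "u \<in> {-1..1}"
  shows "\<bar>cone_phi p q z1 z2 u\<bar> \<le> \<bar>snd p * snd q\<bar>"
proof -
  obtain x t y s where pq: "p = (x, t)" "q = (y, s)" by (cases p; cases q)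
  define a b where "a = sqrt (t\<^sup>2 - (norm x)\<^sup>2)" and "b = sqrt (s\<^sup>2 - (norm y)\<^sup>2)"
  have xy: "norm x \<le> \<bar>t\<bar>" "norm y \<le> \<bar>s\<bar>" using p q by (auto simp: pq double_cone_def)
  then have "(norm x)\<^sup>2 \<le> t\<^sup>2" "(norm y)\<^sup>2 \<le> s\<^sup>2"
    by (metis abs_le_square_iff abs_norm_cancel)+
  then have a: "a\<^sup>2 = t\<^sup>2 - (norm x)\<^sup>2" "b\<^sup>2 = s\<^sup>2 - (norm y)\<^sup>2" "a \<ge> 0" "b \<ge> 0"
    by (auto simp: a_def b_def)
  have "(norm x * norm y + a * b)\<^sup>2 \<le> ((norm x)\<^sup>2 + a\<^sup>2) * ((norm y)\<^sup>2 + b\<^sup>2)"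
    using zero_le_power2[of "norm x * b - a * norm y"] by (simp add: power2_eq_square algebra_simps)
  also have "\<dots> = (\<bar>t * s\<bar>)\<^sup>2" by (simp add: a power_mult_distrib)
  finally have ab: "norm x * norm y + a * b \<le> \<bar>t * s\<bar>"
    by (rule power2_le_imp_le) simp
  have u: "\<bar>u * (a * b) * sgn (s * t)\<bar> \<le> a * b"
  proof -
    have "\<bar>u\<bar> * \<bar>sgn (s * t)\<bar> \<le> 1 * 1" using z by (intro mult_mono) (auto simp: abs_sgn_eq)
    then have "(\<bar>u\<bar> * \<bar>sgn (s * t)\<bar>) * (a * b) \<le> 1 * (a * b)" using a by (intro mult_right_mono) auto
    then show ?thesis using a by (simp add: abs_mult mult_ac)
  qed
  have 1: "\<bar>x \<bullet> y + u * (a * b) * sgn (s * t)\<bar> \<le> \<bar>t * s\<bar>"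
    using Cauchy_Schwarz_ineq2[of x y] u ab by linarith
  have 2: "\<bar>z2 * (s * t)\<bar> \<le> \<bar>t * s\<bar>"
    using z mult_right_mono[of "\<bar>z2\<bar>" 1 "\<bar>s * t\<bar>"] by (auto simp: abs_mult mult_ac)
  have "\<bar>cone_phi p q z1 z2 u\<bar> \<le> (1 - z1) / 2 * \<bar>x \<bullet> y + u * (a * b) * sgn (s * t)\<bar> + (1 + z1) / 2 * \<bar>z2 * (s * t)\<bar>"
  proof -
    have "cone_phi p q z1 z2 u = (1 - z1) / 2 * (x \<bullet> y + u * (a * b) * sgn (s * t)) + (1 + z1) / 2 * (z2 * (s * t))"
      by (simp add: pq cone_phi_def a_def b_def mult_ac)
    also have "\<bar>\<dots>\<bar> \<le> \<bar>(1 - z1) / 2 * (x \<bullet> y + u * (a * b) * sgn (s * t))\<bar> + \<bar>(1 + z1) / 2 * (z2 * (s * t))\<bar>"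
      by (rule abs_triangle_ineq)
    also have "\<dots> = (1 - z1) / 2 * \<bar>x \<bullet> y + u * (a * b) * sgn (s * t)\<bar> + (1 + z1) / 2 * \<bar>z2 * (s * t)\<bar>"
      using z by (simp only: abs_mult[of "(1 - z1) / 2"] abs_mult[of "(1 + z1) / 2"]) simp
    finally show ?thesis .
  qed
  also have "\<dots> \<le> (1 - z1) / 2 * \<bar>t * s\<bar> + (1 + z1) / 2 * \<bar>t * s\<bar>"
    using z 1 2 by (intro add_mono mult_left_mono) auto
  also have "\<dots> = \<bar>t * s\<bar>" by (simp add: field_simps)
  finally show ?thesis by (simp add: pq)
qed

lemma poisson_integrand_eq:
  "indicator cube3 z * poisson_integrand \<beta> \<mu> r (p :: (real ^ 'd) \<times> real) q z =
    exp (2 * r / (1 - r\<^sup>2) * (case z of (z1, z2, u) \<Rightarrow> cone_phi p q z1 z2 u)) * cube_weight \<beta> \<mu> TYPE('d) z"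
proof -
  have e: "\<mu> + (real CARD('d) - 1) / 2 = \<mu> + (real CARD('d) + 1) / 2 - 1" "\<beta> - 3 / 2 = \<beta> - 1 / 2 - 1"
    "\<beta> - 1 = \<beta> - 1 / 2 - 1 / 2" "\<mu> - 1 = \<mu> - 1 / 2 - 1 / 2"
    by (simp_all add: field_simps)
  obtain z1 z2 u where z: "z = (z1, z2, u)" by (cases z)
  have "indicator cube3 z = (indicator {-1..1} z1 * (indicator {-1..1} z2 * indicator {-1..1} u) :: real)"
    by (simp add: z cube3_def indicator_times)
  then show ?thesis
    unfolding z poisson_integrand_def cube_weight_def jacobi_density_def gegenbauer_density_def Let_def prod.case e
    by (simp only: mult_ac)
qed

lemma cone_phi_borel [measurable]:
  "(\<lambda>z. case z of (z1, z2, u) \<Rightarrow> cone_phi p q z1 z2 u) \<in> borel_measurable borel"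
proof -
  obtain x t y s where pq: "p = (x, t)" "q = (y, s)" by (cases p; cases q)
  define X Y T where "X = x \<bullet> y" and "Y = sqrt (t\<^sup>2 - (norm x)\<^sup>2) * sqrt (s\<^sup>2 - (norm y)\<^sup>2) * sgn (s * t)" and "T = s * t"
  have "(\<lambda>z. case z of (z1, z2, u) \<Rightarrow> cone_phi p q z1 z2 u) =
    (\<lambda>z. (1 - fst z) / 2 * (X + snd (snd z) * Y) + (1 + fst z) / 2 * fst (snd z) * T)"
    by (simp only: fun_eq_iff pq cone_phi_def prod.case case_prod_beta X_def Y_def T_def mult.assoc fst_conv snd_conv simp_thms)
  also have "\<dots> \<in> borel_measurable borel"
    by (intro borel_measurable_continuous_onI continuous_intros) simp_all
  finally show ?thesis .
qed

lemma cube_weight_nonneg: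
  assumes "\<beta> > 1 / 2" "\<mu> > 0"
  shows "cube_weight \<beta> \<mu> TYPE('d) z \<ge> 0"
proof -
  define \<delta> \<kappa> where "\<delta> = \<mu> + (real CARD('d) + 1) / 2" and "\<kappa> = \<beta> - 1 / 2"
  have pos: "\<delta> > 0" "\<kappa> > 0" using assms by (auto simp: \<delta>_def \<kappa>_def intro!: add_pos_pos)
  have G: "Gamma x \<ge> 0" if "x > 0" for x :: real using Gamma_real_pos[OF that] by (rule less_imp_le)
  have "c_jacobi (\<delta> - 1) (\<kappa> - 1) \<ge> 0" "c_gegenbauer \<kappa> \<ge> 0" "c_gegenbauer (\<mu> - 1 / 2) \<ge> 0"
    unfolding c_jacobi_def c_gegenbauer_def using pos assms
    by (intro divide_nonneg_nonneg mult_nonneg_nonneg G; simp)+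
  then show ?thesis
    by (auto simp: cube_weight_def jacobi_density_def gegenbauer_density_def \<delta>_def \<kappa>_def split_beta
      split: split_indicator intro!: mult_nonneg_nonneg)
qed

lemma cube_weight_support:
  "cube_weight \<beta> \<mu> TYPE('d) (z1, z2, u) \<noteq> 0 \<Longrightarrow> z1 \<in> {-1..1} \<and> z2 \<in> {-1..1} \<and> u \<in> {-1..1}"
  by (auto simp: cube_weight_def jacobi_density_def gegenbauer_density_def split: split_indicator_asm)

lemma gexp_0: "gexp \<beta> \<mu> 0 p q = 1"
  by (simp add: gexp_def hexp_def lpow_def)

lemma gexp_continuous:
  "continuous_on ({1 / 2..} \<times> {0..}) (\<lambda>x. gexp (fst x) (snd x) n p (q :: (real ^ 'd) \<times> real))"
proof -
  have r: "continuous_on A (\<lambda>x. rothe (fst x - 1 / 2) k)" for A :: "(real \<times> real) set" and k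
  proof -
    obtain P where "\<And>x. rothe x k = poly P x" using poly_rothe by blast
    then show ?thesis by (simp add: continuous_intros)
  qed
  have P: "pochhammer a n > 0" if "a > 0" for a :: real and n using that by (rule pochhammer_pos)
  have "pochhammer (fst x + snd x + real CARD('d) / 2) n \<noteq> 0"
    "pochhammer (snd x + 1 / 2) n \<noteq> 0" if "x \<in> {1 / 2..} \<times> {0..}" for x :: "real \<times> real" and n
  proof -
    have "fst x + snd x + real CARD('d) / 2 > 0" "snd x + 1 / 2 > 0"
      using that by (auto simp: mem_Times_iff intro!: add_pos_pos add_pos_nonneg)
    then show "pochhammer (fst x + snd x + real CARD('d) / 2) n \<noteq> 0" "pochhammer (snd x + 1 / 2) n \<noteq> 0"
      using P less_irrefl by metis+
  qed
  then show ?thesis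
    unfolding gexp_def hexp_def pochhammer_prod
    by (intro continuous_intros r) (auto simp: pochhammer_prod)
qed

context
  fixes p q :: "(real ^ 'd) \<times> real"
  assumes p: "p \<in> double_cone" and q: "q \<in> double_cone"
begin

lemma cone_phi_bound_support:
  assumes "cube_weight \<beta> \<mu> TYPE('d) z \<noteq> 0"
  shows "\<bar>case z of (z1, z2, u) \<Rightarrow> cone_phi p q z1 z2 u\<bar> \<le> \<bar>snd p * snd q\<bar>"
proof -
  obtain z1 z2 u where z: "z = (z1, z2, u)" by (cases z)
  show ?thesis using cone_phi_bound[OF p q, of z1 z2 u] cube_weight_support[of \<beta> \<mu> z1 z2 u, where 'd = 'd] assms by (simp add: z)
qed

context
  fixes \<beta> \<mu> :: real
  assumes \<beta>: "\<beta> > 1 / 2" and \<mu>: "\<mu> > 0"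
begin

lemma cube_weight_integral: "has_bochner_integral lborel (cube_weight \<beta> \<mu> TYPE('d)) 1"
  using gexp_integral[OF \<beta> \<mu> p q, of 0] by (simp add: gexp_0)

lemma gexp_bound_open: "\<bar>gexp \<beta> \<mu> n p q\<bar> \<le> (2 * \<bar>snd p * snd q\<bar>) ^ n / fact n"
proof -
  let ?\<phi> = "\<lambda>z. 2 * (case z of (z1, z2, u) \<Rightarrow> cone_phi p q z1 z2 u)"
  let ?w = "cube_weight \<beta> \<mu> TYPE('d)"
  have w: "integrable lborel ?w" "integral\<^sup>L lborel ?w = 1"
    using cube_weight_integral by (auto simp: has_bochner_integral_iff)
  have "gexp \<beta> \<mu> n p q = (\<integral>z. ?\<phi> z ^ n * ?w z / fact n \<partial>lborel)"
    using gexp_integral[OF \<beta> \<mu> p q, of n] by (simp add: has_bochner_integral_iff)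
  also have "\<dots> = (\<integral>z. ?\<phi> z ^ n * ?w z \<partial>lborel) / fact n" by simp
  finally have eq: "gexp \<beta> \<mu> n p q = (\<integral>z. ?\<phi> z ^ n * ?w z \<partial>lborel) / fact n" .
  have "\<bar>\<integral>z. ?\<phi> z ^ n * ?w z \<partial>lborel\<bar> \<le> \<bar>2 * \<bar>snd p * snd q\<bar>\<bar> ^ n * (\<integral>z. \<bar>?w z\<bar> \<partial>lborel)"
    using cone_phi_bound_support by (intro integral_exp_series(4) w(1)) (auto simp: abs_mult)
  also have "(\<integral>z. \<bar>?w z\<bar> \<partial>lborel) = 1"
    using w(2) cube_weight_nonneg[OF \<beta> \<mu>, where 'd = 'd] by simp
  finally show ?thesis unfolding eq by (simp add: divide_right_mono)
qed

lemma poisson_integral: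
  shows "set_integrable lborel cube3 (poisson_integrand \<beta> \<mu> r p q)"
    and "(\<lambda>n. (r / (1 - r\<^sup>2)) ^ n * gexp \<beta> \<mu> n p q) sums (set_lebesgue_integral lborel cube3 (poisson_integrand \<beta> \<mu> r p q))"
proof -
  define c where "c = r / (1 - r\<^sup>2)"
  let ?\<psi> = "\<lambda>z. 2 * (case z of (z1, z2, u) \<Rightarrow> cone_phi p q z1 z2 u)"
  let ?\<phi> = "\<lambda>z. c * ?\<psi> z"
  let ?w = "cube_weight \<beta> \<mu> TYPE('d)"
  have w: "integrable lborel ?w"
    using cube_weight_integral by (auto simp: has_bochner_integral_iff)
  have eq: "indicator cube3 z * poisson_integrand \<beta> \<mu> r p q z = exp (?\<phi> z) * ?w z" for z
    using poisson_integrand_eq[of z \<beta> \<mu> r p q] by (simp add: c_def)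
  have bnd: "\<bar>?\<phi> z\<bar> \<le> \<bar>c\<bar> * (2 * \<bar>snd p * snd q\<bar>)" if "?w z \<noteq> 0" for z
    using cone_phi_bound_support[OF that] unfolding abs_mult by (intro mult_left_mono) (auto simp: abs_mult)
  have m: "?\<phi> \<in> borel_measurable lborel" by measurable
  show "set_integrable lborel cube3 (poisson_integrand \<beta> \<mu> r p q)"
    unfolding set_integrable_def real_scaleR_def eq by (rule integral_exp_series(1)[OF w m bnd])
  have "(\<integral>z. ?\<phi> z ^ n * ?w z \<partial>lborel) / fact n = c ^ n * gexp \<beta> \<mu> n p q" for n
  proof -
    have "(\<integral>z. ?\<phi> z ^ n * ?w z \<partial>lborel) / fact n = (\<integral>z. ?\<phi> z ^ n * ?w z / fact n \<partial>lborel)"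
      by (rule Bochner_Integration.integral_divide_zero[symmetric])
    also have "\<dots> = (\<integral>z. c ^ n * (?\<psi> z ^ n / fact n * ?w z) \<partial>lborel)"
      by (intro Bochner_Integration.integral_cong refl) (simp only: power_mult_distrib times_divide_eq_left times_divide_eq_right mult.assoc)
    also have "\<dots> = c ^ n * (\<integral>z. ?\<psi> z ^ n / fact n * ?w z \<partial>lborel)"
      by (rule Bochner_Integration.integral_mult_right_zero)
    also have "(\<integral>z. ?\<psi> z ^ n / fact n * ?w z \<partial>lborel) = gexp \<beta> \<mu> n p q"
      using gexp_integral[OF \<beta> \<mu> p q, of n] by (simp add: has_bochner_integral_iff)
    finally show ?thesis .
  qed
  then show "(\<lambda>n. (r / (1 - r\<^sup>2)) ^ n * gexp \<beta> \<mu> n p q) sums (set_lebesgue_integral lborel cube3 (poisson_integrand \<beta> \<mu> r p q))"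
    unfolding set_lebesgue_integral_def real_scaleR_def eq c_def[symmetric]
    using integral_exp_series(2)[OF w m bnd] by simp
qed

end

text \<open>At the boundary parameters there is no integral to estimate. The bound is transported
  from \<open>(\<beta> + 1 / (k + 1), \<mu> + 1 / (k + 1))\<close> by continuity of the closed form;
  its right-hand side does not depend on the parameters.\<close>

lemma gexp_bound:
  assumes "\<beta> \<ge> 1 / 2" "\<mu> \<ge> 0"
  shows "\<bar>gexp \<beta> \<mu> n p q\<bar> \<le> (2 * \<bar>snd p * snd q\<bar>) ^ n / fact n"
proof -
  have "((\<lambda>k. (\<beta> + 1 / real (Suc k), \<mu> + 1 / real (Suc k))) \<longlongrightarrow> (\<beta> + 0, \<mu> + 0)) sequentially"
    by (intro tendsto_intros LIMSEQ_Suc lim_1_over_n)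
  then have "((\<lambda>k. gexp (\<beta> + 1 / real (Suc k)) (\<mu> + 1 / real (Suc k)) n p q) \<longlongrightarrow> gexp \<beta> \<mu> n p q) sequentially"
    using continuous_on_tendsto_compose[OF gexp_continuous[of n p q], of "\<lambda>k. (\<beta> + 1 / real (Suc k), \<mu> + 1 / real (Suc k))" "(\<beta>, \<mu>)" sequentially] assms
    by (simp add: add_nonneg_nonneg add_increasing2)
  then have "((\<lambda>k. \<bar>gexp (\<beta> + 1 / real (Suc k)) (\<mu> + 1 / real (Suc k)) n p q\<bar>) \<longlongrightarrow> \<bar>gexp \<beta> \<mu> n p q\<bar>) sequentially"
    by (rule tendsto_rabs)
  then show ?thesis
  proof (rule tendsto_upperbound[OF _ always_eventually sequentially_bot], intro allI)
    fix k
    show "\<bar>gexp (\<beta> + 1 / real (Suc k)) (\<mu> + 1 / real (Suc k)) n p q\<bar> \<le> (2 * \<bar>snd p * snd q\<bar>) ^ n / fact n"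
  proof (rule gexp_bound_open)
    have "1 / real (Suc k) > 0" by simp
    then show "\<beta> + 1 / real (Suc k) > 1 / 2" "\<mu> + 1 / real (Suc k) > 0" using assms by linarith+
  qed
  qed
qed

lemma gexp_term_bound:
  assumes "\<beta> \<ge> 1 / 2" "\<mu> \<ge> 0"
  shows "\<bar>c ^ n * gexp \<beta> \<mu> n p q\<bar> \<le> (\<bar>c\<bar> * (2 * \<bar>snd p * snd q\<bar>)) ^ n /\<^sub>R fact n"
proof -
  have "\<bar>c ^ n * gexp \<beta> \<mu> n p q\<bar> = \<bar>c\<bar> ^ n * \<bar>gexp \<beta> \<mu> n p q\<bar>" by (simp add: abs_mult power_abs)
  also have "\<dots> \<le> \<bar>c\<bar> ^ n * ((2 * \<bar>snd p * snd q\<bar>) ^ n / fact n)"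
    by (intro mult_left_mono gexp_bound assms) simp
  also have "\<dots> = (\<bar>c\<bar> * (2 * \<bar>snd p * snd q\<bar>)) ^ n /\<^sub>R fact n"
    by (simp only: power_mult_distrib real_scaleR_def divide_inverse mult_ac)
  finally show ?thesis .
qed

lemma summable_abs_gexp:
  assumes "\<beta> \<ge> 1 / 2" "\<mu> \<ge> 0"
  shows "summable (\<lambda>n. \<bar>c ^ n * gexp \<beta> \<mu> n p q\<bar>)"
  by (rule summable_comparison_test'[where N = 0, OF summable_exp_generic])
    (simp only: real_norm_def abs_idempotent, rule gexp_term_bound[OF assms])

lemma gexp_series_continuous:
  "continuous_on ({1 / 2..} \<times> {0..}) (\<lambda>x. \<Sum>n. c ^ n * gexp (fst x) (snd x) n p q)"
proof -
  have "uniform_limit ({1 / 2..} \<times> {0..}) (\<lambda>N x. \<Sum>n<N. c ^ n * gexp (fst x) (snd x) n p q)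
    (\<lambda>x. \<Sum>n. c ^ n * gexp (fst x) (snd x) n p q) sequentially"
  proof (rule Weierstrass_m_test)
    show "summable (\<lambda>n. (\<bar>c\<bar> * (2 * \<bar>snd p * snd q\<bar>)) ^ n /\<^sub>R fact n)" by (rule summable_exp_generic)
    show "norm (c ^ n * gexp (fst x) (snd x) n p q) \<le> (\<bar>c\<bar> * (2 * \<bar>snd p * snd q\<bar>)) ^ n /\<^sub>R fact n"
      if "x \<in> {1 / 2..} \<times> {0..}" for n x
      using that gexp_term_bound[of "fst x" "snd x" c n] by (simp only: mem_Times_iff atLeast_iff real_norm_def)
  qed
  then show ?thesis
    by (rule uniform_limit_theorem[rotated])
      (intro always_eventually allI continuous_intros gexp_continuous sequentially_bot)+
qed

end

section \<open>The generating function of the kernels\<close>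

lemma negative_binomial_sums:
  fixes x a :: real
  assumes "\<bar>x\<bar> < 1"
  shows "(\<lambda>m. pochhammer a m / fact m * x ^ m) sums ((1 - x) powr (- a))"
proof -
  have "((- a) gchoose m) * (- x) ^ m = pochhammer a m / fact m * x ^ m" for m
    by (simp add: gbinomial_pochhammer flip: power_mult_distrib mult.assoc)
  then show ?thesis using gen_binomial_real[of "- x" "- a"] assms by simp
qed

lemma has_sum_exp: "((\<lambda>j. c ^ j / fact j) has_sum exp c) UNIV" for c :: real
proof (rule norm_summable_imp_has_sum)
  show "(\<lambda>j. c ^ j / fact j) sums exp c" using exp_converges[of c] by (simp add: divide_inverse mult.commute)
  have "summable (\<lambda>n. norm (c ^ n /\<^sub>R fact n))" by (rule summable_norm_exp)
  then show "summable (\<lambda>j. norm (c ^ j / fact j))" by (simp add: divide_inverse mult.commute)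
qed

text \<open>The summation index is \<open>N = n + 2 (j + m)\<close>; absolute convergence allows summing over \<open>m\<close>
  first (a binomial series), then over \<open>j\<close> (an exponential series).\<close>

lemma kern_series:
  fixes p q :: "(real ^ 'd) \<times> real"
  assumes p: "p \<in> double_cone" and q: "q \<in> double_cone" and \<beta>: "\<beta> \<ge> 1 / 2" and \<mu>: "\<mu> \<ge> 0"
    and r: "0 \<le> r" "r < 1"
  shows "(\<lambda>N. kern \<beta> \<mu> N p q * r ^ N) sums
    ((1 - r\<^sup>2) powr (- (\<beta> + \<mu> + real CARD('d) / 2)) * exp (- (((snd q)\<^sup>2 + (snd p)\<^sup>2) / (1 - r\<^sup>2) * r\<^sup>2)) *
     (\<Sum>n. (r / (1 - r\<^sup>2)) ^ n * gexp \<beta> \<mu> n p q))"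
proof -
  define \<gamma> where "\<gamma> = \<beta> + \<mu> + real CARD('d) / 2"
  define e where "e = (snd p)\<^sup>2 + (snd q)\<^sup>2"
  define D where "D = 1 - r\<^sup>2"
  define c where "c = e * r\<^sup>2 / D"
  define A where "A n = D powr (- \<gamma>) * ((r / D) ^ n * gexp \<beta> \<mu> n p q)" for n
  define f where "f = (\<lambda>(n, j, m). gexp \<beta> \<mu> n p q * r ^ n * ((- e * r\<^sup>2) ^ j / fact j) *
    (pochhammer (\<gamma> + real n + real j) m / fact m * (r\<^sup>2) ^ m))"
  have r2: "r\<^sup>2 < 1" "0 \<le> r\<^sup>2" using r by (auto simp: power_less_one_iff abs_square_less_1)
  then have D: "D > 0" by (simp add: D_def)
  have e: "e \<ge> 0" by (simp add: e_def)
  have c: "c \<ge> 0" using e D by (simp add: c_def)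
  have \<gamma>: "\<gamma> > 0" using \<beta> \<mu> by (simp add: \<gamma>_def add_pos_nonneg)
  have poch: "pochhammer (\<gamma> + real n + real j) m \<ge> 0" for n j m
    using \<gamma> by (intro less_imp_le pochhammer_pos) auto
  \<comment> \<open>The exponent of the binomial series splits: \<open>D ^ n\<close> completes
    \<open>r / D\<close>, and \<open>D ^ j\<close> completes the argument \<open>c\<close> of the
    exponential.\<close>
  have Dp: "D powr (- (\<gamma> + real n + real j)) = D powr (- \<gamma>) / D ^ n / D ^ j" for n j
  proof -
    have "- (\<gamma> + real n + real j) = - \<gamma> - real n - real j" by simp
    then show ?thesis using D by (simp only: powr_diff powr_realpow)
  qed
  have inner: "((\<lambda>m. pochhammer (\<gamma> + real n + real j) m / fact m * (r\<^sup>2) ^ m) has_sum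
      (D powr (- \<gamma>) / D ^ n / D ^ j)) UNIV" for n j
    unfolding Dp[symmetric] unfolding D_def using r2 poch
    by (intro sums_nonneg_imp_has_sum negative_binomial_sums) auto
  define w where "w n j m = pochhammer (\<gamma> + real n + real j) m / fact m * (r\<^sup>2) ^ m" for n j m
  have w: "w n j m \<ge> 0" for n j m using poch by (simp add: w_def)
  define a where "a n j = gexp \<beta> \<mu> n p q * r ^ n * ((- e * r\<^sup>2) ^ j / fact j)" for n j
  have f: "f (n, j, m) = a n j * w n j m" for n j m by (simp only: f_def a_def w_def prod.case)
  have a: "a n j * (D powr (- \<gamma>) / D ^ n / D ^ j) = A n * ((- c) ^ j / fact j)" for n j
  proof -
    have "- c = (- e * r\<^sup>2) / D" by (simp add: c_def)
    then show ?thesis by (simp only: A_def a_def power_divide) (simp add: mult_ac)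
  qed
  have f1: "((\<lambda>m. f (n, j, m)) has_sum (A n * ((- c) ^ j / fact j))) UNIV" for n j
    unfolding f a[symmetric] w_def by (intro has_sum_cmult_right inner)
  \<comment> \<open>With absolute values the sign of \<open>c\<close> is lost, and the sum over
    \<open>j\<close> will be \<open>exp c\<close> in place of \<open>exp (- c)\<close>. It is still
    finite, and this gives the absolute summability needed for reordering.\<close>
  have f1a: "((\<lambda>m. \<bar>f (n, j, m)\<bar>) has_sum (\<bar>A n\<bar> * (c ^ j / fact j))) UNIV" for n j
  proof -
    have "\<bar>a n j\<bar> * (D powr (- \<gamma>) / D ^ n / D ^ j) = \<bar>a n j * (D powr (- \<gamma>) / D ^ n / D ^ j)\<bar>"
      using D by (simp add: abs_mult)
    also have "\<dots> = \<bar>A n\<bar> * (c ^ j / fact j)"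
      unfolding a using c by (simp add: abs_mult power_abs)
    finally have eq: "\<bar>A n\<bar> * (c ^ j / fact j) = \<bar>a n j\<bar> * (D powr (- \<gamma>) / D ^ n / D ^ j)" ..
    have "\<bar>f (n, j, m)\<bar> = \<bar>a n j\<bar> * w n j m" for m using w[of n j m] by (simp add: f abs_mult)
    then show ?thesis unfolding eq by (simp only: w_def) (intro has_sum_cmult_right inner)
  qed
  have U: "UNIV = Sigma UNIV (\<lambda>_. UNIV)" by auto
  have f2a: "((\<lambda>z. \<bar>f (n, z)\<bar>) has_sum (\<bar>A n\<bar> * exp c)) UNIV" for n
  proof -
    have g: "((\<lambda>j. \<bar>A n\<bar> * (c ^ j / fact j)) has_sum (\<bar>A n\<bar> * exp c)) UNIV"
      by (intro has_sum_cmult_right has_sum_exp)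
    have "(\<lambda>z. \<bar>f (n, z)\<bar>) summable_on Sigma UNIV (\<lambda>_. UNIV)"
      by (rule summable_on_SigmaI[OF f1a has_sum_imp_summable[OF g]]) simp
    then show ?thesis unfolding U by (rule has_sum_SigmaI[OF f1a g])
  qed
  have A: "summable (\<lambda>n. \<bar>A n\<bar>)"
    using summable_mult[OF summable_abs_gexp[OF p q \<beta> \<mu>, of "r / D"], of "D powr (- \<gamma>)"]
    by (simp add: A_def abs_mult)
  have fa: "(\<lambda>z. \<bar>f z\<bar>) summable_on Sigma UNIV (\<lambda>_. UNIV)"
  proof (rule summable_on_SigmaI[OF f2a])
    show "(\<lambda>n. \<bar>A n\<bar> * exp c) summable_on UNIV"
      using A by (intro summable_on_cmult_left summable_nonneg_imp_summable_on) auto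
  qed simp
  have f2: "((\<lambda>z. f (n, z)) has_sum (A n * exp (- c))) UNIV" for n
  proof -
    have g: "((\<lambda>j. A n * ((- c) ^ j / fact j)) has_sum (A n * exp (- c))) UNIV"
      by (intro has_sum_cmult_right has_sum_exp)
    have "(\<lambda>z. f (n, z)) summable_on Sigma UNIV (\<lambda>_. UNIV)"
    proof (rule abs_summable_summable)
      show "(\<lambda>z. norm (f (n, z))) summable_on Sigma UNIV (\<lambda>_. UNIV)"
        using has_sum_imp_summable[OF f2a[of n]] by simp
    qed
    then show ?thesis unfolding U by (rule has_sum_SigmaI[OF f1 g])
  qed
  have f3: "(f has_sum ((\<Sum>n. A n) * exp (- c))) (Sigma UNIV (\<lambda>_. UNIV))"
  proof (rule has_sum_SigmaI[OF f2])
    show "f summable_on Sigma UNIV (\<lambda>_. UNIV)"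
      by (rule abs_summable_summable) (use fa in simp)
    show "((\<lambda>n. A n * exp (- c)) has_sum ((\<Sum>n. A n) * exp (- c))) UNIV"
      using A by (intro has_sum_cmult_left norm_summable_imp_has_sum) (auto intro: summable_sums summable_rabs_cancel)
  qed
  let ?T = "Sigma (UNIV :: nat set) (\<lambda>N. Sigma {..N div 2} (\<lambda>i. {..i}))"
  have "((\<lambda>(N, i, j). f (N - 2 * i, j, i - j)) has_sum ((\<Sum>n. A n) * exp (- c))) ?T \<longleftrightarrow>
    (f has_sum ((\<Sum>n. A n) * exp (- c))) (Sigma UNIV (\<lambda>_. UNIV))"
    by (rule has_sum_reindex_bij_witness[where i = "\<lambda>(n, j, m). (n + 2 * (j + m), j + m, j)"
        and j = "\<lambda>(N, i, j). (N - 2 * i, j, i - j)"]) auto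
  with f3 have "((\<lambda>(N, i, j). f (N - 2 * i, j, i - j)) has_sum ((\<Sum>n. A n) * exp (- c))) ?T" by simp
  then have "((\<lambda>N. \<Sum>(i, j)\<in>Sigma {..N div 2} (\<lambda>i. {..i}). f (N - 2 * i, j, i - j)) has_sum ((\<Sum>n. A n) * exp (- c))) UNIV"
    by (rule has_sum_SigmaD) (simp add: has_sum_finite)
  moreover have "(\<Sum>(i, j)\<in>Sigma {..N div 2} (\<lambda>i. {..i}). f (N - 2 * i, j, i - j)) = kern \<beta> \<mu> N p q * r ^ N" for N
  proof -
    have "(\<Sum>(i, j)\<in>Sigma {..N div 2} (\<lambda>i. {..i}). f (N - 2 * i, j, i - j)) =
      (\<Sum>i\<le>N div 2. \<Sum>j\<le>i. f (N - 2 * i, j, i - j))"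
      by (rule sum.Sigma[symmetric]) auto
    also have "\<dots> = kern \<beta> \<mu> N p q * r ^ N"
      unfolding kern_def sum_distrib_right
    proof (intro sum.cong refl)
      fix i j assume ij: "i \<in> {..N div 2}" "j \<in> {..i}"
      then have "N = (N - 2 * i) + (2 * j + 2 * (i - j))" by auto
      then have "r ^ N = r ^ (N - 2 * i) * ((r\<^sup>2) ^ j * (r\<^sup>2) ^ (i - j))"
        by (metis power_add power_mult)
      moreover have "(- e * r\<^sup>2) ^ j = (-1) ^ j * e ^ j * (r\<^sup>2) ^ j"
        by (metis mult_minus1 power_mult_distrib)
      ultimately show "f (N - 2 * i, j, i - j) = (- 1) ^ j / fact j *
         (pochhammer (\<beta> + \<mu> + real CARD('d) / 2 + real (N - 2 * i) + real j) (i - j) / fact (i - j)) *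
         (((snd p)\<^sup>2 + (snd q)\<^sup>2) ^ j * gexp \<beta> \<mu> (N - 2 * i) p q) * r ^ N"
        unfolding f_def prod.case \<gamma>_def[symmetric] e_def[symmetric] by (simp only: times_divide_eq_left times_divide_eq_right divide_divide_eq_left mult_ac)
    qed
    finally show ?thesis .
  qed
  ultimately have "(\<lambda>N. kern \<beta> \<mu> N p q * r ^ N) sums ((\<Sum>n. A n) * exp (- c))"
    by (intro has_sum_imp_sums) simp
  moreover have "(\<Sum>n. A n) = D powr (- \<gamma>) * (\<Sum>n. (r / D) ^ n * gexp \<beta> \<mu> n p q)"
    unfolding A_def by (intro suminf_mult summable_rabs_cancel[OF summable_abs_gexp[OF p q \<beta> \<mu>]])
  moreover have "c = ((snd q)\<^sup>2 + (snd p)\<^sup>2) / D * r\<^sup>2" by (simp add: c_def e_def add.commute)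
  ultimately show ?thesis by (simp add: D_def \<gamma>_def mult_ac)
qed

section \<open>The Poisson kernel and its limiting cases\<close>

text \<open>The link between both sides of the theorem: it equals the sum of the kernels on the
  closed parameter range, equals the integral formula in its interior, and is continuous
  throughout.\<close>

definition poisson_series :: "real \<Rightarrow> (real ^ 'd) \<times> real \<Rightarrow> (real ^ 'd) \<times> real \<Rightarrow> real \<times> real \<Rightarrow> real" where
  "poisson_series r p q x =
    (1 - r\<^sup>2) powr (- (fst x + snd x + real CARD('d) / 2)) * exp (- (((snd q)\<^sup>2 + (snd p)\<^sup>2) / (1 - r\<^sup>2) * r\<^sup>2)) *
     (\<Sum>n. (r / (1 - r\<^sup>2)) ^ n * gexp (fst x) (snd x) n p q)"

context
  fixes p q :: "(real ^ 'd) \<times> real" and r :: real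
  assumes p: "p \<in> double_cone" and q: "q \<in> double_cone" and r: "0 \<le> r" "r < 1"
begin

lemma poisson_even_sums:
  assumes "\<beta> \<ge> 1 / 2" "\<mu> \<ge> 0"
  shows "(\<lambda>n. P_even \<beta> \<mu> n p q * r ^ n) sums poisson_series r p q (\<beta>, \<mu>)"
  using kern_series[OF p q assms r] by (simp add: P_even_eq_kern[OF assms] poisson_series_def)

lemma poisson_formula_eq_series:
  assumes "\<beta> > 1 / 2" "\<mu> > 0"
  shows "poisson_formula \<beta> \<mu> r p q = poisson_series r p q (\<beta>, \<mu>)"
proof -
  have "set_lebesgue_integral lborel cube3 (poisson_integrand \<beta> \<mu> r p q) = (\<Sum>n. (r / (1 - r\<^sup>2)) ^ n * gexp \<beta> \<mu> n p q)"
    using poisson_integral(2)[OF p q assms, of r] by (rule sums_unique)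
  then show ?thesis
    unfolding poisson_formula_def poisson_series_def fst_conv snd_conv powr_minus_divide by simp
qed

lemma poisson_series_continuous: "continuous_on ({1 / 2..} \<times> {0..}) (poisson_series r p q)"
proof -
  have "r\<^sup>2 < 1" using r by (simp add: abs_square_less_1)
  then show ?thesis unfolding poisson_series_def
    by (intro continuous_intros gexp_series_continuous p q) auto
qed

text \<open>Stated for an arbitrary filter and path \<open>g\<close> in the open parameter range, so
  that letting one parameter or both tend to the boundary are all instances.\<close>

lemma poisson_formula_limit:
  assumes "(g \<longlongrightarrow> (\<beta>, \<mu>)) F" and "\<beta> \<ge> 1 / 2" "\<mu> \<ge> 0"
    and ev: "\<forall>\<^sub>F x in F. fst (g x) > 1 / 2 \<and> snd (g x) > 0"
  shows "((\<lambda>x. poisson_formula (fst (g x)) (snd (g x)) r p q) \<longlongrightarrow> poisson_even \<beta> \<mu> r p q) F"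
proof -
  have "((\<lambda>x. poisson_series r p q (g x)) \<longlongrightarrow> poisson_series r p q (\<beta>, \<mu>)) F"
    using assms(2,3) by (intro continuous_on_tendsto_compose[OF poisson_series_continuous assms(1)])
      (auto intro: eventually_mono[OF ev] simp: mem_Times_iff)
  moreover have "\<forall>\<^sub>F x in F. poisson_series r p q (g x) = poisson_formula (fst (g x)) (snd (g x)) r p q"
    using ev by eventually_elim (simp add: poisson_formula_eq_series)
  moreover have "poisson_even \<beta> \<mu> r p q = poisson_series r p q (\<beta>, \<mu>)"
    unfolding poisson_even_def using poisson_even_sums[OF assms(2,3)] by (rule sums_unique[symmetric])
  ultimately show ?thesis by (simp add: tendsto_cong)
qed

end

theorem theorem7p13:
  fixes x y :: "real ^ 'd" and t s \<beta> \<mu> r :: real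
  assumes "\<beta> \<ge> 1/2" and "\<mu> \<ge> 0"
    and "(x, t) \<in> double_cone" and "(y, s) \<in> double_cone"
    and "0 \<le> r" and "r < 1"
  shows "summable (\<lambda>n. P_even \<beta> \<mu> n (x, t) (y, s) * r ^ n) \<and>
    (\<beta> > 1/2 \<and> \<mu> > 0 \<longrightarrow>
       set_integrable lborel cube3 (poisson_integrand \<beta> \<mu> r (x, t) (y, s)) \<and>
       poisson_even \<beta> \<mu> r (x, t) (y, s) = poisson_formula \<beta> \<mu> r (x, t) (y, s)) \<and>
    (\<beta> = 1/2 \<and> \<mu> > 0 \<longrightarrow>
       ((\<lambda>b. poisson_formula b \<mu> r (x, t) (y, s)) \<longlongrightarrow> poisson_even \<beta> \<mu> r (x, t) (y, s))
         (at_right (1/2))) \<and>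
    (\<beta> > 1/2 \<and> \<mu> = 0 \<longrightarrow>
       ((\<lambda>m. poisson_formula \<beta> m r (x, t) (y, s)) \<longlongrightarrow> poisson_even \<beta> \<mu> r (x, t) (y, s))
         (at_right 0)) \<and>
    (\<beta> = 1/2 \<and> \<mu> = 0 \<longrightarrow>
       ((\<lambda>(b, m). poisson_formula b m r (x, t) (y, s)) \<longlongrightarrow> poisson_even \<beta> \<mu> r (x, t) (y, s))
         (at (1/2, 0) within {1/2<..} \<times> {0<..}))"
proof (intro conjI impI)
  note sums = poisson_even_sums[OF assms(3-6,1,2)]
  note lim = poisson_formula_limit[OF assms(3-6) _ assms(1,2)]
  show "summable (\<lambda>n. P_even \<beta> \<mu> n (x, t) (y, s) * r ^ n)" using sums by (rule sums_summable)
  show "set_integrable lborel cube3 (poisson_integrand \<beta> \<mu> r (x, t) (y, s))" if "\<beta> > 1/2 \<and> \<mu> > 0"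
    using that assms by (intro poisson_integral) auto
  show "poisson_even \<beta> \<mu> r (x, t) (y, s) = poisson_formula \<beta> \<mu> r (x, t) (y, s)" if "\<beta> > 1/2 \<and> \<mu> > 0"
    using sums_unique[OF sums] poisson_formula_eq_series[OF assms(3-6), of \<beta> \<mu>] that
    by (simp add: poisson_even_def)
  show "((\<lambda>b. poisson_formula b \<mu> r (x, t) (y, s)) \<longlongrightarrow> poisson_even \<beta> \<mu> r (x, t) (y, s)) (at_right (1/2))"
    if h: "\<beta> = 1/2 \<and> \<mu> > 0"
  proof -
    have b: "1/2 = \<beta>" using h by simp
    have "((\<lambda>b. (b, \<mu>)) \<longlongrightarrow> (\<beta>, \<mu>)) (at_right (1/2))" unfolding b by (intro tendsto_intros)
    moreover have "\<forall>\<^sub>F b in at_right (1/2 :: real). fst (b, \<mu>) > 1/2 \<and> snd (b, \<mu>) > 0"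
      using h eventually_at_right_less[of "1/2 :: real"] by simp
    ultimately show ?thesis using lim[of "\<lambda>b. (b, \<mu>)" "at_right (1/2)"] by (simp only: fst_conv snd_conv)
  qed
  show "((\<lambda>m. poisson_formula \<beta> m r (x, t) (y, s)) \<longlongrightarrow> poisson_even \<beta> \<mu> r (x, t) (y, s)) (at_right 0)"
    if h: "\<beta> > 1/2 \<and> \<mu> = 0"
  proof -
    have b: "0 = \<mu>" using h by simp
    have "((\<lambda>m. (\<beta>, m)) \<longlongrightarrow> (\<beta>, \<mu>)) (at_right 0)" unfolding b by (intro tendsto_intros)
    moreover have "\<forall>\<^sub>F m in at_right (0 :: real). fst (\<beta>, m) > 1/2 \<and> snd (\<beta>, m) > 0"
      using h eventually_at_right_less[of "0 :: real"] by simp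
    ultimately show ?thesis using lim[of "\<lambda>m. (\<beta>, m)" "at_right 0"] by (simp only: fst_conv snd_conv)
  qed
  show "((\<lambda>(b, m). poisson_formula b m r (x, t) (y, s)) \<longlongrightarrow> poisson_even \<beta> \<mu> r (x, t) (y, s))
      (at (1/2, 0) within {1/2<..} \<times> {0<..})"
    if h: "\<beta> = 1/2 \<and> \<mu> = 0"
  proof -
    have "\<forall>\<^sub>F x :: real \<times> real in at (1/2, 0) within {1/2<..} \<times> {0<..}. fst x > 1/2 \<and> snd x > 0"
      by (auto simp: eventually_at_filter intro!: always_eventually)
    moreover have b: "\<beta> = 1/2" "\<mu> = 0" using h by simp_all
    ultimately show ?thesis
      using lim[of "\<lambda>x. x" "at (1/2, 0) within {1/2<..} \<times> {0<..}"]
      unfolding b case_prod_beta by (simp only: tendsto_ident_at)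
  qed
qed

end
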